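(* Let $G^c$ be a $c$-edge-coloured multigraph on $n \geq 11$ vertices with $c\geq 3$ and $m$ edges. If $rd(G^c)=c$ and $m\geq c\binom{n-2}{2}+2c+1$, then $G^c$ has a proper Hamiltonian path.
   Context: A $c$-edge-coloured multigraph $G^c$ is a multigraph in which every edge receives one colour from $\{1,\ldots,c\}$ and no two parallel edges joining the same pair of vertices have the same colour; $m$ counts all edges. The rainbow degree $rd(x)$ of a vertex $x$ is the number of distinct colours on edges incident to $x$, and $rd(G^c)$ is the minimum of $rd(x)$ over all vertices. A path is proper if any two consecutive edges have different colours; a proper Hamiltonian path is a proper path containing all vertices. *)

theory Defs
  imports Complex_Main
begin

text \<open>
  Edges are objects of their own, so parallel edges are distinct elements of \<open>edges G\<close>
  with the same set of endpoints. Counting edges is therefore \<open>card (edges G)\<close>.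
\<close>

record ('v, 'e) coloured_multigraph =
  verts :: "'v set"
  edges :: "'e set"
  ends :: "'e \<Rightarrow> 'v set"
  colour :: "'e \<Rightarrow> nat"

locale edge_coloured_multigraph =
  fixes c :: nat and G :: "('v, 'e) coloured_multigraph"
  assumes finite_verts: "finite (verts G)"
    and finite_edges: "finite (edges G)"
    and ends_subset: "e \<in> edges G \<Longrightarrow> ends G e \<subseteq> verts G"
    and no_loops: "e \<in> edges G \<Longrightarrow> card (ends G e) = 2"
    and colour_range: "e \<in> edges G \<Longrightarrow> colour G e \<in> {1..c}"
    and parallel_colours:
      "\<lbrakk>e \<in> edges G; f \<in> edges G; e \<noteq> f; ends G e = ends G f\<rbrakk> \<Longrightarrow> colour G e \<noteq> colour G f"

definition rd :: "('v, 'e) coloured_multigraph \<Rightarrow> 'v \<Rightarrow> nat" where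
  "rd G x = card (colour G ` {e \<in> edges G. x \<in> ends G e})"

text \<open>Only meaningful if the vertex set is finite and nonempty.\<close>

definition min_rd :: "('v, 'e) coloured_multigraph \<Rightarrow> nat" where
  "min_rd G = Min (rd G ` verts G)"

text \<open>
  In a multigraph the vertices do not determine a path; it is given by its vertices
  together with its edges, where the \<open>i\<close>-th edge joins the \<open>i\<close>-th and the next vertex.
\<close>

definition is_path :: "('v, 'e) coloured_multigraph \<Rightarrow> 'v list \<Rightarrow> 'e list \<Rightarrow> bool" where
  "is_path G vs es \<longleftrightarrow>
     length vs = length es + 1 \<and> distinct vs \<and>
     set vs \<subseteq> verts G \<and> set es \<subseteq> edges G \<and>
     (\<forall>i < length es. ends G (es ! i) = {vs ! i, vs ! (i + 1)})"

definition proper_path :: "('v, 'e) coloured_multigraph \<Rightarrow> 'v list \<Rightarrow> 'e list \<Rightarrow> bool" where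
  "proper_path G vs es \<longleftrightarrow>
     is_path G vs es \<and> successively (\<lambda>e f. colour G e \<noteq> colour G f) es"

definition proper_hamiltonian_path ::
    "('v, 'e) coloured_multigraph \<Rightarrow> 'v list \<Rightarrow> 'e list \<Rightarrow> bool" where
  "proper_hamiltonian_path G vs es \<longleftrightarrow> proper_path G vs es \<and> set vs = verts G"

end

theory Submission
  imports Defs "HOL-Library.Multiset"
begin

text \<open>
  The three largest colour classes \<open>r\<close>, \<open>b\<close>, \<open>g\<close> together miss at most \<open>6n - 16\<close> edges, and the
  largest one, \<open>r\<close>, misses at most \<open>2n - 6\<close>. Cover the vertices by disjoint edges of colour \<open>b\<close> or
  \<open>g\<close> and \<open>b\<close>-\<open>g\<close>-paths with three vertices (triples) and by single vertices, minimising
  twice the number of single vertices plus the number of triples. All parts but the single vertices end in edges coloured \<open>b\<close> or \<open>g\<close>, so they may be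
  concatenated freely along edges of colour \<open>r\<close>.

  Two facts make this work. First, \<open>j\<close> segments can be concatenated as soon as at most
  \<open>4j - 5\<close> pairs of their end points are not linked (\<open>4j - 4\<close> if \<open>j \<ge> 5\<close> and no segment is isolated):
  by averaging there is always a link whose contraction, which removes its two end points, gets rid
  of four missing pairs. Second, a minimal cover with a single vertex or with many triples forces many
  missing edges in \<open>b\<close> and \<open>g\<close>, hence few in \<open>r\<close>. With exactly two triples one may also have to
  exchange the roles of the colours: then \<open>r\<close> has a perfect matching whose edges are linked by \<open>b\<close>
  and \<open>g\<close>.
\<close>

section \<open>Linking segments at their end points\<close>

text \<open>A segment with both ends unlinked already accounts for 4(j - 1) missing pairs. This is
  why 4j - 5 is the natural bound and why the sharper one has to exclude such a segment. With t
  triples and no single vertex there are j = (n - t)/2 segments, so 4j - 5 = 2n - 2t - 5: enough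
  against 2n - 6 for t = 0, one short for t = 1, three short for t = 2. For t = 1 the sharper bound
  fits exactly, and in its exceptional case the count leaves no freedom in colour r, so a repaired
  family of segments can be written down. For t \<ge> 3 the pairs missing in both b and g weigh
  twice in the total, and r is left with few missing edges. A single vertex has no edge of its own
  in b or g; it is hung on a segment by an r-edge and becomes a dead tip, which is never extended
  and counts as unlinked to everything.\<close>

text \<open>Missing pairs are counted as ordered pairs, here and in \<open>nonadjacent\<close> below, so all bounds
  are twice those for edges.\<close>

definition nonlinks :: "('a \<Rightarrow> 'a \<Rightarrow> bool) \<Rightarrow> 'a set \<Rightarrow> ('a \<Rightarrow> 'a) \<Rightarrow> ('a \<times> 'a) set" where
  "nonlinks L P m = {(s, t). s \<in> P \<and> t \<in> P \<and> s \<noteq> t \<and> t \<noteq> m s \<and> \<not> L s t}"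

definition defect :: "('a \<Rightarrow> 'a \<Rightarrow> bool) \<Rightarrow> 'a set \<Rightarrow> ('a \<Rightarrow> 'a) \<Rightarrow> 'a \<Rightarrow> nat" where
  "defect L P m s = card {t \<in> P. s \<noteq> t \<and> t \<noteq> m s \<and> \<not> L s t}"

lemma finite_nonlinks [simp]: "finite P \<Longrightarrow> finite (nonlinks L P m)"
  by (rule finite_subset[of _ "P \<times> P"]) (auto simp: nonlinks_def)

lemma card_nonlinks:
  assumes "finite P" shows "card (nonlinks L P m) = (\<Sum>s\<in>P. defect L P m s)"
proof -
  have "nonlinks L P m = (SIGMA s:P. {t \<in> P. s \<noteq> t \<and> t \<noteq> m s \<and> \<not> L s t})"
    by (auto simp: nonlinks_def)
  then show ?thesis using assms by (simp add: defect_def)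
qed

text \<open>Removing one element removes its row and its column, which are equally long and
  disjoint. Counts of ordered pairs are therefore even, and several estimates below close only by
  this parity.\<close>

lemma even_card_symmetric:
  assumes "finite A" and "\<And>s t. s \<in> A \<Longrightarrow> t \<in> A \<Longrightarrow> r s t \<Longrightarrow> r t s"
    and "\<And>s. s \<in> A \<Longrightarrow> \<not> r s s"
  shows "even (card {(s, t). s \<in> A \<and> t \<in> A \<and> r s t})"
  using assms
proof (induction A rule: finite_induct)
  case empty
  then show ?case by simp
next
  case (insert v A)
  let ?B = "{(s, t). s \<in> A \<and> t \<in> A \<and> r s t}" and ?C = "{t \<in> A. r v t}"
  have fin: "finite ?B" "finite ?C"
    using insert.hyps by (auto intro: finite_subset[of _ "A \<times> A"])
  have eq: "{(s, t). s \<in> insert v A \<and> t \<in> insert v A \<and> r s t}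
      = ?B \<union> (Pair v ` ?C \<union> (\<lambda>t. (t, v)) ` ?C)"
    using insert.prems by auto
  have "card (Pair v ` ?C \<union> (\<lambda>t. (t, v)) ` ?C) = card ?C + card ?C"
    using fin insert.hyps
    by (subst card_Un_disjoint) (auto simp: card_image inj_on_def)
  then have "card {(s, t). s \<in> insert v A \<and> t \<in> insert v A \<and> r s t} = card ?B + 2 * card ?C"
    unfolding eq using fin insert.hyps
    by (subst card_Un_disjoint) auto
  moreover have "even (card ?B)" using insert.prems by (intro insert.IH) blast+
  ultimately show ?case by simp
qed

text \<open>\<open>Q s t X\<close> stands for a segment with ends \<open>s\<close> and
  \<open>t\<close> that covers \<open>X\<close>. Only reversal and concatenation along a link are
  kept, so the counting argument never sees colours.\<close>

locale joining =
  fixes L :: "'a \<Rightarrow> 'a \<Rightarrow> bool" and Q :: "'a \<Rightarrow> 'a \<Rightarrow> 'b set \<Rightarrow> bool"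
  assumes L_sym: "L s t \<Longrightarrow> L t s"
    and Q_sym: "Q s t X \<Longrightarrow> Q t s X"
    and Q_join: "Q a y X \<Longrightarrow> Q x b Y \<Longrightarrow> L y x \<Longrightarrow> X \<inter> Y = {} \<Longrightarrow> Q a b (X \<union> Y)"
begin

text \<open>A family of segments is encoded by its end points: \<open>m\<close> exchanges the two
  ends of a segment, and \<open>W\<close> gives its vertex set at either end. Joining two segments
  then deletes two ports and redirects two mates.\<close>

definition system :: "'a set \<Rightarrow> ('a \<Rightarrow> 'a) \<Rightarrow> ('a \<Rightarrow> 'b set) \<Rightarrow> bool" where
  "system P m W \<longleftrightarrow> finite P \<and>
     (\<forall>s\<in>P. m s \<in> P \<and> m s \<noteq> s \<and> m (m s) = s \<and> Q s (m s) (W s) \<and> W (m s) = W s) \<and>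
     (\<forall>s\<in>P. \<forall>t\<in>P. t \<noteq> s \<longrightarrow> t \<noteq> m s \<longrightarrow> W s \<inter> W t = {})"

lemma systemD:
  assumes "system P m W"
  shows "finite P" "s \<in> P \<Longrightarrow> m s \<in> P" "s \<in> P \<Longrightarrow> m s \<noteq> s" "s \<in> P \<Longrightarrow> m (m s) = s"
    "s \<in> P \<Longrightarrow> Q s (m s) (W s)" "s \<in> P \<Longrightarrow> W (m s) = W s"
    "s \<in> P \<Longrightarrow> t \<in> P \<Longrightarrow> t \<noteq> s \<Longrightarrow> t \<noteq> m s \<Longrightarrow> W s \<inter> W t = {}"
  using assms unfolding system_def by blast+

lemma even_card_ports: assumes "system P m W" shows "even (card P)"
proof -
  note S = systemD[OF assms]
  have "even (card {(s, t). s \<in> P \<and> t \<in> P \<and> t = m s})"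
    by (rule even_card_symmetric) (use S(1) S(4) in \<open>auto dest: S(3)[symmetric]\<close>)
  also have "{(s, t). s \<in> P \<and> t \<in> P \<and> t = m s} = (\<lambda>s. (s, m s)) ` P"
    using S(2) by auto
  finally show ?thesis by (simp add: card_image inj_on_def)
qed

lemma even_card_nonlinks: assumes "system P m W" shows "even (card (nonlinks L P m))"
  unfolding nonlinks_def using systemD[OF assms] L_sym
  by (intro even_card_symmetric) auto

text \<open>The ports \<open>y\<close> and \<open>x\<close> become inner vertices, so all nonlinks
  at them disappear; none is counted at both, because \<open>y\<close> and \<open>x\<close> are
  linked. Since \<open>m y\<close> and \<open>m x\<close> become mates, a nonlink between them is no
  longer counted either.\<close>

lemma contract:
  assumes sys: "system P m W" and y: "y \<in> P" and x: "x \<in> P" and xy: "x \<noteq> y" "x \<noteq> m y" "L y x"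
  obtains P' m' W' where "system P' m' W'" "card P' + 2 = card P"
    "(\<Union>s\<in>P'. W' s) = (\<Union>s\<in>P. W s)"
    "card (nonlinks L P' m') + 2 * (defect L P m y + defect L P m x) +
       (if L (m y) (m x) then 0 else 2) \<le> card (nonlinks L P m)"
proof -
  note S = systemD[OF sys]
  define P' where "P' = P - {y, x}"
  define m' where "m' = m(m y := m x, m x := m y)"
  define W' where "W' = W(m y := W y \<union> W x, m x := W y \<union> W x)"
  have my: "m y \<in> P'" "m x \<in> P'" "m y \<noteq> m x"
  proof -
    show "m y \<noteq> m x" using S(4) x y xy by metis
    have "m y \<noteq> y" "m x \<noteq> x" "m x \<noteq> y" using S(3,4) x y xy by metis+
    then show "m y \<in> P'" "m x \<in> P'" using S(2) x y xy by (auto simp: P'_def)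
  qed
  have m'y: "m' (m y) = m x" "m' (m x) = m y" "W' (m y) = W y \<union> W x" "W' (m x) = W y \<union> W x"
    using my by (auto simp: m'_def W'_def)
  have oth: "m' s = m s" "W' s = W s" "m s \<in> P'" "m s \<noteq> m y" "m s \<noteq> m x"
    if s: "s \<in> P'" "s \<noteq> m y" "s \<noteq> m x" for s
  proof -
    have sP: "s \<in> P" "s \<noteq> y" "s \<noteq> x" using s by (auto simp: P'_def)
    show "m' s = m s" "W' s = W s" using s by (auto simp: m'_def W'_def)
    show ne: "m s \<noteq> m y" "m s \<noteq> m x" using S(4) sP x y by metis+
    have "m s \<noteq> y" "m s \<noteq> x" using S(4) sP s by metis+
    then show "m s \<in> P'" using S(2) sP by (simp add: P'_def)
  qed
  have dj: "W y \<inter> W x = {}" using S x y xy by auto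
  have Qn: "Q (m y) (m x) (W y \<union> W x)"
    using Q_join[OF Q_sym[OF S(5)[OF y]] S(5)[OF x] xy(3) dj] .
  have sys': "system P' m' W'"
    unfolding system_def
  proof (intro conjI ballI impI)
    show "finite P'" using S by (simp add: P'_def)
  next
    fix s assume s: "s \<in> P'"
    then have sP: "s \<in> P" by (simp add: P'_def)
    have "m' s \<in> P' \<and> m' s \<noteq> s \<and> m' (m' s) = s \<and> Q s (m' s) (W' s) \<and> W' (m' s) = W' s"
    proof (cases "s = m y \<or> s = m x")
      case True
      then show ?thesis using my m'y Qn Q_sym[OF Qn] by auto
    next
      case False
      then have o: "m' s = m s" "W' s = W s" "m s \<in> P'" "m s \<noteq> m y" "m s \<noteq> m x" using oth[OF s] by auto
      then show ?thesis using oth[OF o(3-5)] S(2-6)[OF sP] by simp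
    qed
    then show "m' s \<in> P'" "m' s \<noteq> s" "m' (m' s) = s" "Q s (m' s) (W' s)" "W' (m' s) = W' s"
      by simp_all
  next
    fix s t assume s: "s \<in> P'" and t: "t \<in> P'" and ne: "t \<noteq> s" "t \<noteq> m' s"
    have inP: "s \<in> P" "t \<in> P" "s \<noteq> x" "s \<noteq> y" "t \<noteq> x" "t \<noteq> y" using s t by (auto simp: P'_def)
    show "W' s \<inter> W' t = {}"
    proof (cases "s = m y \<or> s = m x")
      case True
      then have tn: "t \<noteq> m y" "t \<noteq> m x" using ne m'y by auto
      have "W y \<inter> W t = {}" "W x \<inter> W t = {}" using S(7) x y inP tn by auto
      then show ?thesis using True m'y oth[OF t tn] by auto
    next
      case False
      then have sn: "s \<noteq> m y" "s \<noteq> m x" by auto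
      show ?thesis
      proof (cases "t = m y \<or> t = m x")
        case True
        have "W s \<inter> W y = {}" "W s \<inter> W x = {}" using S(7)[of y s] S(7)[of x s] x y inP sn by auto
        then show ?thesis using True m'y oth[OF s sn] by auto
      next
        case False
        then show ?thesis using S(7) inP ne oth[OF s sn] oth[OF t] by auto
      qed
    qed
  qed
  have cardP': "card P' + 2 = card P"
  proof -
    have "card {y, x} = 2" using xy by simp
    moreover have "card {y, x} \<le> card P" using x y S(1) by (intro card_mono) auto
    ultimately show ?thesis unfolding P'_def using x y S(1) by (subst card_Diff_subset) auto
  qed
  have Un: "(\<Union>s\<in>P'. W' s) = (\<Union>s\<in>P. W s)"
  proof (intro equalityI subsetI)
    fix v assume "v \<in> (\<Union>s\<in>P'. W' s)"
    then obtain s where "s \<in> P'" "v \<in> W' s" by blast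
    then show "v \<in> (\<Union>s\<in>P. W s)" using m'y x y oth[of s]
      by (cases "s = m y \<or> s = m x") (auto simp: P'_def)
  next
    fix v assume "v \<in> (\<Union>s\<in>P. W s)"
    then obtain s where s: "s \<in> P" "v \<in> W s" by blast
    show "v \<in> (\<Union>s\<in>P'. W' s)"
    proof (cases "s \<in> {y, x, m y, m x}")
      case True
      then have "v \<in> W' (m y)" using s S(6) x y m'y by auto
      then show ?thesis using my by blast
    next
      case False
      then have "s \<in> P'" using s by (simp add: P'_def)
      then show ?thesis using False oth[of s] s by auto
    qed
  qed
  let ?D = "\<lambda>s. {t \<in> P. s \<noteq> t \<and> t \<noteq> m s \<and> \<not> L s t}"
  let ?Z = "if L (m y) (m x) then {} else {(m y, m x), (m x, m y)}"
  let ?U = "Pair y ` ?D y \<union> (\<lambda>t. (t, y)) ` ?D y \<union> (Pair x ` ?D x \<union> (\<lambda>t. (t, x)) ` ?D x)"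
  have Lxy: "L x y" using xy L_sym by auto
  have fD: "finite (?D s)" for s using S(1) by simp
  have cU1: "card (Pair s ` ?D s \<union> (\<lambda>t. (t, s)) ` ?D s) = 2 * defect L P m s" for s
    using fD by (subst card_Un_disjoint) (auto simp: card_image inj_on_def defect_def)
  have cU: "card ?U = 2 * (defect L P m y + defect L P m x)"
    using fD xy Lxy cU1 by (subst card_Un_disjoint) auto
  have cZ: "card ?Z = (if L (m y) (m x) then 0 else 2)" using my by simp
  have sub: "nonlinks L P' m' \<union> (?U \<union> ?Z) \<subseteq> nonlinks L P m"
  proof -
    have "nonlinks L P' m' \<subseteq> nonlinks L P m"
    proof
      fix p assume "p \<in> nonlinks L P' m'"
      then obtain s t where p: "p = (s, t)" and st: "s \<in> P'" "t \<in> P'" "s \<noteq> t" "t \<noteq> m' s" "\<not> L s t"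
        by (auto simp: nonlinks_def)
      have "t \<noteq> m s"
      proof
        assume "t = m s"
        then have "s \<noteq> m y" "s \<noteq> m x" using st(2) S(4) x y by (auto simp: P'_def)
        then show False using \<open>t = m s\<close> st oth(1) by auto
      qed
      then show "p \<in> nonlinks L P m" using p st by (auto simp: nonlinks_def P'_def)
    qed
    moreover have "?U \<subseteq> nonlinks L P m"
      using x y S(2,3,4) L_sym by (auto simp: nonlinks_def)
    moreover have "?Z \<subseteq> nonlinks L P m" using my x y xy S(2,3,4) L_sym
      by (auto simp: nonlinks_def P'_def)
    ultimately show ?thesis by blast
  qed
  have "?U \<inter> ?Z = {}" using my by (auto simp: P'_def)
  moreover have "nonlinks L P' m' \<inter> (?U \<union> ?Z) = {}"
    using my m'y by (auto simp: nonlinks_def P'_def split: if_splits)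
  moreover have "finite ?U" "finite ?Z" "finite (nonlinks L P' m')" using fD S(1) by (auto simp: P'_def)
  ultimately have "card (nonlinks L P' m' \<union> (?U \<union> ?Z)) = card (nonlinks L P' m') + (card ?U + card ?Z)"
    by (simp add: card_Un_disjoint)
  then have "card (nonlinks L P' m') + (card ?U + card ?Z) \<le> card (nonlinks L P m)"
    using card_mono[OF _ sub] S(1) by simp
  then show thesis using that[OF sys' cardP' Un] cU cZ by simp
qed

section \<open>Links whose contraction removes enough nonlinks\<close>

definition gain :: "'a set \<Rightarrow> ('a \<Rightarrow> 'a) \<Rightarrow> 'a \<Rightarrow> 'a \<Rightarrow> nat" where
  "gain P m y x = 2 * (defect L P m y + defect L P m x) + (if L (m y) (m x) then 0 else 2)"

definition adj :: "'a set \<Rightarrow> ('a \<Rightarrow> 'a) \<Rightarrow> 'a \<Rightarrow> 'a \<Rightarrow> bool" where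
  "adj P m y x \<longleftrightarrow> y \<in> P \<and> x \<in> P \<and> x \<noteq> y \<and> x \<noteq> m y \<and> L y x"

definition isolated :: "'a set \<Rightarrow> ('a \<Rightarrow> 'a) \<Rightarrow> 'a \<Rightarrow> bool" where
  "isolated P m y \<longleftrightarrow> (\<forall>x. \<not> adj P m y x)"

lemma adj_sym: "system P m W \<Longrightarrow> adj P m y x \<Longrightarrow> adj P m x y"
  using systemD[of P m W] L_sym unfolding adj_def by metis

lemma card_neighbours:
  assumes "system P m W" "y \<in> P"
  shows "card {x. adj P m y x} + defect L P m y + 2 = card P"
proof -
  note S = systemD[OF assms(1)]
  let ?A = "{x. adj P m y x}" and ?D = "{t \<in> P. y \<noteq> t \<and> t \<noteq> m y \<and> \<not> L y t}"
  have P: "P = (?A \<union> ?D) \<union> {y, m y}" using assms(2) S(2) by (auto simp: adj_def)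
  have fin: "finite ?A" "finite ?D"
    using S(1) by (auto simp: adj_def intro: finite_subset[of _ P])
  have "card P = card (?A \<union> ?D) + card {y, m y}"
  proof -
    have "(?A \<union> ?D) \<inter> {y, m y} = {}" by (auto simp: adj_def)
    then show ?thesis using fin by (subst P, subst card_Un_disjoint) simp_all
  qed
  also have "card (?A \<union> ?D) = card ?A + card ?D"
  proof -
    have "?A \<inter> ?D = {}" by (auto simp: adj_def)
    then show ?thesis using fin by (simp add: card_Un_disjoint)
  qed
  also have "card {y, m y} = 2" using S(3)[OF assms(2)] by (metis card_2_iff)
  finally show ?thesis by (simp add: defect_def)
qed

lemma defect_le: "system P m W \<Longrightarrow> y \<in> P \<Longrightarrow> defect L P m y + 2 \<le> card P"
  using card_neighbours by fastforce

lemma isolated_iff: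
  assumes "system P m W" "y \<in> P"
  shows "isolated P m y \<longleftrightarrow> defect L P m y + 2 = card P"
proof -
  have "finite {x. adj P m y x}"
    using systemD(1)[OF assms(1)] by (auto simp: adj_def intro: finite_subset[of _ P])
  then have "isolated P m y \<longleftrightarrow> card {x. adj P m y x} = 0" by (auto simp: isolated_def)
  then show ?thesis using card_neighbours[OF assms] by linarith
qed

text \<open>There are \<open>2 * (card P - 2)\<close> nonlinks at \<open>y\<close>, and
  \<open>2 * (card P - 3)\<close> at \<open>s\<close> that are not at \<open>y\<close>: together
  \<open>4 * card P - 10\<close>. Under the bound assumed in \<open>good_pair\<close> nothing else
  can be missing.\<close>

lemma two_isolated:
  assumes sys: "system P m W" and y: "y \<in> P" "isolated P m y" and s: "s \<in> P" "isolated P m s"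
    and ne: "s \<noteq> y" "s \<noteq> m y"
  shows "card {p \<in> nonlinks L P m. fst p \<notin> {y, s} \<and> snd p \<notin> {y, s}} + 4 * card P
    \<le> card (nonlinks L P m) + 10"
proof -
  note S = systemD[OF sys]
  let ?R = "{p \<in> nonlinks L P m. fst p \<notin> {y, s} \<and> snd p \<notin> {y, s}}"
  let ?A = "P - {y, m y}" and ?B = "P - {s, m s, y}"
  let ?U = "Pair y ` ?A \<union> (\<lambda>t. (t, y)) ` ?A" and ?V = "Pair s ` ?B \<union> (\<lambda>t. (t, s)) ` ?B"
  have nl: "t \<in> P \<Longrightarrow> t \<noteq> y \<Longrightarrow> t \<noteq> m y \<Longrightarrow> \<not> L y t \<and> \<not> L t y"
      "t \<in> P \<Longrightarrow> t \<noteq> s \<Longrightarrow> t \<noteq> m s \<Longrightarrow> \<not> L s t \<and> \<not> L t s" for t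
    using y s L_sym unfolding isolated_def adj_def by blast+
  have inv: "t \<in> P \<Longrightarrow> u \<in> P \<Longrightarrow> t = m u \<longleftrightarrow> u = m t" for t u using S(4) by metis
  have fin: "finite ?A" "finite ?B" "finite (nonlinks L P m)" using S(1) by auto
  have msy: "m s \<noteq> y" using inv s y ne by metis
  have "card ?A = card P - 2"
    using S(1,2) S(3)[OF y(1)] y(1) by (subst card_Diff_subset) (auto simp: card_insert_if)
  then have cA: "card ?A + 2 = card P" using defect_le[OF sys y(1)] by linarith
  have "card {s, m s, y} = 3" using S(3)[OF s(1)] ne msy by (auto simp: card_insert_if)
  moreover have sub3: "{s, m s, y} \<subseteq> P" using S(2) s y by auto
  ultimately have cB: "card ?B + 3 = card P"
    using card_mono[OF S(1) sub3] by (subst card_Diff_subset) auto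
  have cU: "card ?U = 2 * card ?A"
    using fin(1) by (subst card_Un_disjoint) (auto simp: card_image inj_on_def)
  have cV: "card ?V = 2 * card ?B"
    using fin(2) by (subst card_Un_disjoint) (auto simp: card_image inj_on_def)
  have "?U \<inter> ?V = {}" using ne by auto
  then have cUV: "card (?U \<union> ?V) = card ?U + card ?V" using fin by (intro card_Un_disjoint) auto
  have "?R \<inter> (?U \<union> ?V) = {}" by auto
  then have "card (?R \<union> (?U \<union> ?V)) = card ?R + card (?U \<union> ?V)"
    using fin by (intro card_Un_disjoint) auto
  moreover have "?U \<subseteq> nonlinks L P m" using y(1) nl(1) inv by (auto simp: nonlinks_def)
  moreover have "?V \<subseteq> nonlinks L P m" using s(1) nl(2) inv by (auto simp: nonlinks_def)
  ultimately have "card ?R + card (?U \<union> ?V) \<le> card (nonlinks L P m)"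
    by (metis (no_types, lifting) fin(3) card_mono le_sup_iff mem_Collect_eq subsetI)
  then show ?thesis using cUV cU cV cA cB by linarith
qed

text \<open>Each of the two ends misses \<open>card P - 2\<close> ports, in both orders. This is the
  obstruction that both chain theorems exclude, one by its bound and the other by
  hypothesis.\<close>

lemma isolated_node:
  assumes sys: "system P m W" and y: "y \<in> P" "isolated P m y" "isolated P m (m y)"
  shows "card {p \<in> nonlinks L P m. fst p \<notin> {y, m y} \<and> snd p \<notin> {y, m y}} + 4 * card P
    \<le> card (nonlinks L P m) + 8"
proof -
  note S = systemD[OF sys]
  let ?R = "{p \<in> nonlinks L P m. fst p \<notin> {y, m y} \<and> snd p \<notin> {y, m y}}"
  let ?A = "P - {y, m y}"
  let ?X = "{y, m y} \<times> ?A" and ?Y = "?A \<times> {y, m y}"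
  have my: "m y \<in> P" "m y \<noteq> y" "m (m y) = y" using S y by auto
  have nl: "\<not> L y t \<and> \<not> L t y \<and> \<not> L (m y) t \<and> \<not> L t (m y)" if "t \<in> ?A" for t
    using that y my L_sym unfolding isolated_def adj_def by blast
  have inv: "t \<in> P \<Longrightarrow> u \<in> P \<Longrightarrow> t = m u \<longleftrightarrow> u = m t" for t u using S(4) by metis
  have fin: "finite ?A" "finite (nonlinks L P m)" using S(1) by auto
  have c2: "card {y, m y} = 2" using my by simp
  have cA: "card ?A + 2 = card P"
    using S(1) my y(1) c2 card_mono[of P "{y, m y}"] by (subst card_Diff_subset) auto
  have cX: "card ?X = 2 * card ?A" "card ?Y = 2 * card ?A"
    by (simp_all only: card_cartesian_product c2)
  have "card (?X \<union> ?Y) = card ?X + card ?Y" using fin by (intro card_Un_disjoint) auto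
  moreover have "card (?R \<union> (?X \<union> ?Y)) = card ?R + card (?X \<union> ?Y)"
    using fin by (intro card_Un_disjoint) auto
  moreover have "?R \<union> (?X \<union> ?Y) \<subseteq> nonlinks L P m"
    using y(1) my nl inv by (auto simp: nonlinks_def)
  then have "card (?R \<union> (?X \<union> ?Y)) \<le> card (nonlinks L P m)" using fin by (intro card_mono) auto
  ultimately show ?thesis using cX cA by linarith
qed

text \<open>Near an isolated port \<open>y\<close> the nonlinks at \<open>y\<close> are discounted from the defects;
  its mate loses none, which the last summand of the gain makes up for.\<close>

definition rest_defect :: "'a set \<Rightarrow> ('a \<Rightarrow> 'a) \<Rightarrow> 'a \<Rightarrow> 'a \<Rightarrow> nat" where
  "rest_defect P m y s = (if s = m y then defect L P m s else defect L P m s - 1)"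

text \<open>The nonlinks at \<open>y\<close> are counted \<open>card P - 2\<close> times at
  \<open>y\<close> itself and once at each of the \<open>card P - 2\<close> ports it misses; this
  gives the constants of the sum.\<close>

lemma rest_defect:
  assumes sys: "system P m W" and y: "y \<in> P" "isolated P m y"
  shows "s \<in> P \<Longrightarrow> s \<noteq> y \<Longrightarrow> s \<noteq> m y \<Longrightarrow> defect L P m s = rest_defect P m y s + 1"
    and "(\<Sum>s\<in>P - {y}. rest_defect P m y s) + 2 * card P = card (nonlinks L P m) + 4"
    and "adj P m s t \<Longrightarrow> gain P m s t \<ge> 4 + 2 * rest_defect P m y s + 2 * rest_defect P m y t"
proof -
  note S = systemD[OF sys]
  have nl: "t \<in> P \<Longrightarrow> t \<noteq> y \<Longrightarrow> t \<noteq> m y \<Longrightarrow> \<not> L y t \<and> \<not> L t y" for t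
    using y L_sym unfolding isolated_def adj_def by blast
  have inv: "t \<in> P \<Longrightarrow> u \<in> P \<Longrightarrow> t = m u \<longleftrightarrow> u = m t" for t u using S(4) by metis
  show *: "defect L P m s = rest_defect P m y s + 1" if "s \<in> P" "s \<noteq> y" "s \<noteq> m y" for s
  proof -
    have "y \<in> {t \<in> P. s \<noteq> t \<and> t \<noteq> m s \<and> \<not> L s t}" using that y nl inv by auto
    then have "defect L P m s > 0" using S(1) unfolding defect_def by (auto simp: card_gt_0_iff)
    then show ?thesis using that by (simp add: rest_defect_def)
  qed
  have my: "m y \<in> P" "m y \<noteq> y" using S y by auto
  have "(\<Sum>s\<in>P. defect L P m s) = defect L P m y + (defect L P m (m y) + (\<Sum>s\<in>P - {y} - {m y}. defect L P m s))"
    using S(1) y(1) my by (simp add: sum.remove)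
  also have "(\<Sum>s\<in>P - {y} - {m y}. defect L P m s) = (\<Sum>s\<in>P - {y} - {m y}. rest_defect P m y s + 1)"
    using * by (intro sum.cong) auto
  also have "\<dots> = (\<Sum>s\<in>P - {y} - {m y}. rest_defect P m y s) + (card P - 2)"
    using S(1) y(1) my by (subst sum.distrib) (simp add: card_Diff_singleton)
  finally have "card (nonlinks L P m) = defect L P m y + (defect L P m (m y) +
      ((\<Sum>s\<in>P - {y} - {m y}. rest_defect P m y s) + (card P - 2)))"
    using S(1) by (simp add: card_nonlinks)
  moreover have "(\<Sum>s\<in>P - {y}. rest_defect P m y s) = defect L P m (m y) + (\<Sum>s\<in>P - {y} - {m y}. rest_defect P m y s)"
    using S(1) my by (subst sum.remove[of _ "m y"]) (auto simp: rest_defect_def)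
  moreover have "defect L P m y + 2 = card P" using isolated_iff[OF sys y(1)] y(2) by simp
  ultimately show "(\<Sum>s\<in>P - {y}. rest_defect P m y s) + 2 * card P = card (nonlinks L P m) + 4" by linarith
  show "gain P m s t \<ge> 4 + 2 * rest_defect P m y s + 2 * rest_defect P m y t" if a: "adj P m s t"
  proof -
    have st: "s \<in> P" "t \<in> P" "t \<noteq> s" "t \<noteq> m s" "L s t" "s \<noteq> m t" using a inv by (auto simp: adj_def)
    have sy: "s \<noteq> y" using a y by (auto simp: isolated_def)
    have ty: "t \<noteq> y" using adj_sym[OF sys a] y by (auto simp: isolated_def)
    consider "s = m y" | "t = m y" | "s \<noteq> m y" "t \<noteq> m y" by blast
    then show ?thesis
    proof cases
      case 1
      then have "m s = y" "m t \<noteq> y" "m t \<noteq> m y" using S(4) y(1) st ty by metis+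
      then have "\<not> L (m s) (m t)" using nl[of "m t"] S(2) st by auto
      moreover have "t \<noteq> m y" using 1 st by auto
      ultimately show ?thesis using *[OF st(2) ty] 1 by (simp add: gain_def rest_defect_def)
    next
      case 2
      then have "m t = y" "m s \<noteq> y" "m s \<noteq> m y" using S(4) y(1) st sy by metis+
      then have "\<not> L (m s) (m t)" using nl[of "m s"] S(2) st by auto
      moreover have "s \<noteq> m y" using 2 st by auto
      ultimately show ?thesis using *[OF st(1) sy] 2 by (simp add: gain_def rest_defect_def)
    next
      case 3
      then show ?thesis using * st sy ty by (simp add: gain_def)
    qed
  qed
qed

text \<open>The ports not adjacent to \<open>y\<close>, including \<open>y\<close> and its mate,
  number \<open>defect L P m y + 2\<close>. The lemma is applied at a port of large defect: its
  neighbours have small defect, since otherwise linking to one of them would gain enough.\<close>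

lemma sum_le_neighbours:
  fixes f :: "'a \<Rightarrow> nat"
  assumes sys: "system P m W" and y: "y \<in> P" and b: "\<And>s. s \<in> P \<Longrightarrow> f s \<le> b"
    and a: "\<And>x. adj P m y x \<Longrightarrow> f x \<le> a"
  shows "(\<Sum>s\<in>P. f s) \<le> b * (defect L P m y + 2) + a * card {x. adj P m y x}"
proof -
  let ?A = "{x. adj P m y x}"
  have sub: "?A \<subseteq> P" by (auto simp: adj_def)
  have fin: "finite P" "finite ?A" using systemD(1)[OF sys] sub finite_subset by auto
  have "card (P - ?A) = defect L P m y + 2"
    using card_neighbours[OF sys y] fin sub by (subst card_Diff_subset) auto
  moreover have "(\<Sum>s\<in>P. f s) = (\<Sum>s\<in>P - ?A. f s) + (\<Sum>s\<in>?A. f s)"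
    using fin sub by (simp add: sum.subset_diff)
  moreover have "(\<Sum>s\<in>P - ?A. f s) \<le> card (P - ?A) * b"
    using sum_bounded_above[of "P - ?A" f b] b by auto
  moreover have "(\<Sum>s\<in>?A. f s) \<le> card ?A * a"
    using sum_bounded_above[of ?A f a] a by auto
  ultimately show ?thesis by (simp add: mult.commute)
qed

text \<open>The bound has to survive the loss of two ports, so a gain of 8 is needed at equality and
  less below it. If all links gain less, a port of large defect has only neighbours of small defect,
  and the total becomes too small. Isolated ports, which offer no link, are treated
  separately.\<close>

lemma good_pair:
  assumes sys: "system P m W" and N: "card P \<ge> 6" and M: "card (nonlinks L P m) + 10 \<le> 4 * card P"
  shows "\<exists>y x. adj P m y x \<and> card (nonlinks L P m) + 18 \<le> 4 * card P + gain P m y x"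
proof (rule ccontr)
  assume neg: "\<not> ?thesis"
  have bad: "gain P m y x + 4 * card P < card (nonlinks L P m) + 18" if "adj P m y x" for y x
  proof -
    have "\<not> card (nonlinks L P m) + 18 \<le> 4 * card P + gain P m y x"
      using that neg by blast
    then show ?thesis by linarith
  qed
  note S = systemD[OF sys]
  let ?d = "defect L P m" and ?M = "card (nonlinks L P m)"
  have g: "2 * ?d y + 2 * ?d x \<le> gain P m y x" for y x by (simp add: gain_def)
  have sumd: "(\<Sum>s\<in>P. ?d s) = ?M" using card_nonlinks[OF S(1)] by metis
  have ex_adj: "\<exists>x. adj P m y x" if "y \<in> P" "\<not> isolated P m y" for y
    using that by (auto simp: isolated_def)
  show False
  proof (cases "\<exists>y\<in>P. isolated P m y")
    case True
    then obtain y where y: "y \<in> P" "isolated P m y" by blast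
    let ?e = "rest_defect P m y"
    note e = rest_defect[OF sys y]
    have my: "m y \<in> P" "m y \<noteq> y" using S y by auto
    have "\<not> isolated P m (m y)"
    proof
      assume "isolated P m (m y)"
      then show False using isolated_node[OF sys y] M by linarith
    qed
    then obtain x0 where x0: "adj P m (m y) x0" using ex_adj my by blast
    show False
    proof (cases "\<exists>s\<in>P. s \<noteq> y \<and> ?e s \<ge> 2")
      case True
      \<comment> \<open>A non-isolated \<open>s\<close> would have a link of gain 8. So
        \<open>s\<close> is isolated, \<open>y\<close> and \<open>s\<close> use up all nonlinks, and
        \<open>m y\<close> can be linked to a port \<open>t\<close> of a third segment; both
        \<open>t\<close> and \<open>m y\<close> still have a nonlink to spare.\<close>
      then obtain s where s: "s \<in> P" "s \<noteq> y" "?e s \<ge> 2" by blast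
      have iso: "isolated P m s"
      proof (rule ccontr)
        assume "\<not> isolated P m s"
        then obtain t where t: "adj P m s t" using ex_adj s by blast
        have "8 \<le> gain P m s t" using e(3)[OF t] s(3) by linarith
        then show False using bad[OF t] M by linarith
      qed
      then have sny: "s \<noteq> m y" using \<open>\<not> isolated P m (m y)\<close> by blast
      note two = two_isolated[OF sys y s(1) iso s(2) sny]
      then have "card {p \<in> nonlinks L P m. fst p \<notin> {y, s} \<and> snd p \<notin> {y, s}} = 0" and Meq: "?M + 10 = 4 * card P"
        using M by linarith+
      then have no: "(a, b) \<notin> nonlinks L P m" if "a \<notin> {y, s}" "b \<notin> {y, s}" for a b
        using that S(1) by (auto simp: card_eq_0_iff)
      have "card {y, m y, s, m s} \<le> 4" by (intro card_insert_le_m1) auto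
      then have "\<not> P \<subseteq> {y, m y, s, m s}" using N card_mono[of "{y, m y, s, m s}" P] by auto
      then obtain t where t: "t \<in> P" "t \<noteq> y" "t \<noteq> m y" "t \<noteq> s" "t \<noteq> m s" by blast
      have "(m y, t) \<notin> nonlinks L P m" using no[of "m y" t] t my sny by auto
      then have a: "adj P m (m y) t" using my t S(4)[OF y(1)] by (auto simp: nonlinks_def adj_def)
      have nl: "\<not> L u y" "\<not> L u s" if "u \<in> P" "u \<noteq> y" "u \<noteq> m y" "u \<noteq> s" "u \<noteq> m s" for u
        using that y s iso L_sym unfolding isolated_def adj_def by blast+
      have "{y, s} \<subseteq> {u \<in> P. t \<noteq> u \<and> u \<noteq> m t \<and> \<not> L t u}"
        using t nl[of t] y s S(4) by auto
      then have "card {y, s} \<le> ?d t" using S(1) unfolding defect_def by (intro card_mono) auto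
      then have "?e t \<ge> 1" using e(1)[of t] t s by auto
      moreover have "?e (m y) \<ge> 1"
      proof -
        have "\<not> L (m y) s" using iso my sny S(4) L_sym y s unfolding isolated_def adj_def by metis
        then have "s \<in> {u \<in> P. m y \<noteq> u \<and> u \<noteq> m (m y) \<and> \<not> L (m y) u}"
          using s sny S(4) y by auto
        then have "?d (m y) > 0" using S(1) unfolding defect_def by (auto simp: card_gt_0_iff)
        then show ?thesis by (simp add: rest_defect_def)
      qed
      ultimately have "gain P m (m y) t \<ge> 8" using e(3)[OF a] by linarith
      then show False using bad[OF a] M by linarith
    next
      case False
      then have e1: "?e s \<le> 1" if "s \<in> P - {y}" for s using that by fastforce
      have "(\<Sum>s\<in>P - {y}. ?e s) \<le> card (P - {y}) * 1" using sum_bounded_above[of "P - {y}" ?e 1] e1 by auto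
      then have M3: "?M + 5 \<le> 3 * card P" using e(2) y(1) S(1) N by simp
      show False
      proof (cases "\<exists>s\<in>P - {y}. ?e s = 1")
        case True
        then obtain s where s: "s \<in> P" "s \<noteq> y" "?e s = 1" by blast
        have "?d s \<le> 2" using s by (auto simp: rest_defect_def split: if_splits)
        then have "\<not> isolated P m s" using isolated_iff[OF sys s(1)] N by auto
        then obtain t where t: "adj P m s t" using ex_adj s by blast
        have "6 \<le> gain P m s t" using e(3)[OF t] s(3) by linarith
        then have "6 + 4 * card P < ?M + 18" using bad[OF t] by linarith
        \<comment> \<open>Parity excludes the only remaining solution, \<open>card P = 6\<close> and
          \<open>?M = 13\<close>.\<close>
        moreover have "even ?M" "even (card P)" using even_card_nonlinks[OF sys] even_card_ports[OF sys] by auto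
        moreover obtain a b where "?M = 2 * a" "card P = 2 * b" using calculation(2,3) by (auto elim!: evenE)
        ultimately have "4 * b < a + 6" "2 * a + 5 \<le> 6 * b" "3 \<le> b" using M3 N by simp_all
        moreover have "a + 3 \<le> 3 * b" using calculation(2) by linarith
        ultimately show False by linarith
      next
        case False
        then have "(\<Sum>s\<in>P - {y}. ?e s) = 0" using e1 by (intro sum.neutral) (metis One_nat_def le_Suc_eq le_zero_eq)
        then have "2 * card P = ?M + 4" using e(2) by simp
        moreover have "4 \<le> gain P m (m y) x0" using e(3)[OF x0] by linarith
        ultimately show False using bad[OF x0] N by linarith
      qed
    qed
  next
    case False
    then have niso: "\<exists>x. adj P m y x" if "y \<in> P" for y using ex_adj that by blast
    have d3: "?d y \<le> 3" if yP: "y \<in> P" for y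
    proof -
      obtain x where x: "adj P m y x" using niso yP by blast
      show ?thesis using bad[OF x] g[of y x] M by linarith
    qed
    have "finite (?d ` P)" "?d ` P \<noteq> {}" using S(1) N by auto
    then obtain y where y: "y \<in> P" and mx: "\<And>s. s \<in> P \<Longrightarrow> ?d s \<le> ?d y"
      using Max_in[of "?d ` P"] Max_ge[of "?d ` P"] by (smt (verit) image_iff)
    have cn: "card {x. adj P m y x} + ?d y + 2 = card P" using card_neighbours[OF sys y] .
    obtain x where x: "adj P m y x" using niso y by blast
    have mod: "even ?M" "even (card P)" using even_card_nonlinks[OF sys] even_card_ports[OF sys] by auto
    consider "?d y = 0" | "?d y = 1" | "?d y = 2" | "?d y = 3" using d3[OF y] by linarith
    then show False
    proof cases
      case 1
      then have "?M \<le> 0" using sum_le_neighbours[OF sys y, of ?d 0 0] mx sumd by (auto simp: adj_def)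
      then show False using bad[OF x] N by linarith
    next
      case 2
      have "?M \<le> card P" using sum_bounded_above[of P ?d 1] mx 2 sumd by auto
      then show False using bad[OF x] g[of y x] 2 N by linarith
    next
      case 3
      have "?d z \<le> 1" if z: "adj P m y z" for z using bad[OF z] g[of y z] M 3 by linarith
      then have "?M \<le> 2 * 4 + 1 * card {x. adj P m y x}"
        using sum_le_neighbours[OF sys y, of ?d 2 1] mx sumd 3 by auto
      then show False using bad[OF x] g[of y x] 3 cn N by linarith
    next
      case 4
      have d0: "?d z = 0" "L (m y) (m z)" if z: "adj P m y z" for z
        using bad[OF z] M 4 unfolding gain_def by (auto split: if_splits)
      have "?M \<le> 3 * 5 + 0 * card {x. adj P m y x}"
        using sum_le_neighbours[OF sys y, of ?d 3 0] mx sumd 4 d0 by auto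
      moreover have "6 + 4 * card P < ?M + 18" using bad[OF x] g[of y x] 4 by linarith
      moreover obtain a b where "?M = 2 * a" "card P = 2 * b" using mod by (auto elim!: evenE)
      \<comment> \<open>Only three segments with seven missing pairs are left. Then \<open>x\<close>
        is the sole neighbour of \<open>y\<close>, and the small gain of every link to
        \<open>x\<close> forces so many links at \<open>m x\<close> that its defect is at most 1,
        while the total requires 3.\<close>
      ultimately have N6: "card P = 6" and M14: "?M = 14" using N by auto
      have my: "m y \<in> P" "m y \<noteq> y" using S y by auto
      have xs: "x \<in> P" "x \<noteq> y" "x \<noteq> m y" "m x \<in> P" "m x \<noteq> x" "m x \<noteq> y" "m x \<noteq> m y" "y \<noteq> x" "m (m x) = x"
        using x y S(2,3,4) unfolding adj_def by metis+
      have "card {x. adj P m y x} = 1" using cn N6 4 by simp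
      then have only: "z = x" if "adj P m y z" for z
      proof -
        obtain w where "{x. adj P m y x} = {w}" using \<open>card {x. adj P m y x} = 1\<close> card_1_singletonE by blast
        then show ?thesis using that x by (metis mem_Collect_eq singletonD)
      qed
      have "card {y, m y, x, m x} \<le> 4" by (intro card_insert_le_m1) auto
      then have "\<not> P \<subseteq> {y, m y, x, m x}" using N card_mono[of "{y, m y, x, m x}" P] by auto
      then obtain s where s: "s \<in> P" "s \<noteq> y" "s \<noteq> m y" "s \<noteq> x" "s \<noteq> m x" by blast
      have ms: "m s \<in> P" "m s \<noteq> s" "m s \<noteq> y" "m s \<noteq> m y" "m s \<noteq> x" "m s \<noteq> m x" "m (m s) = s"
        using s S(2,3,4) y xs by metis+
      have Peq: "{y, m y, x, m x, s, m s} = P"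
      proof (rule card_subset_eq)
        show "{y, m y, x, m x, s, m s} \<subseteq> P" using y my xs s ms by auto
        have "card {y, m y, x, m x, s, m s} = 6" using my xs s ms by (auto simp: card_insert_if)
        then show "card {y, m y, x, m x, s, m s} = card P" using N6 by simp
      qed (use S in auto)
      have full: "L x z" if "z \<in> P" "z \<noteq> x" "z \<noteq> m x" for z
        using d0(1)[OF x] that S(1) xs unfolding defect_def by (auto simp: card_eq_0_iff)
      have ax: "adj P m x z" if "z \<in> {y, m y, s, m s}" for z
        using that full xs y my s ms unfolding adj_def by auto
      have az: "adj P m z x" if "z \<in> {y, m y, s, m s}" for z using adj_sym[OF sys ax[OF that]] .
      have "?M = ?d y + ?d (m y) + ?d x + ?d (m x) + ?d s + ?d (m s)"
      proof -
        have "?M = (\<Sum>z\<in>{y, m y, x, m x, s, m s}. ?d z)" using sumd Peq by simp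
        then show ?thesis using my xs s ms by simp
      qed
      then have s14: "?d (m y) + ?d (m x) + ?d s + ?d (m s) = 11" using M14 4 d0(1)[OF x] by simp
      have nyx: "\<not> L y (m x)" using only[of "m x"] xs y by (auto simp: adj_def)
      \<comment> \<open>Linking \<open>m y\<close> to \<open>x\<close> turns the unlinked ports
        \<open>y\<close> and \<open>m x\<close> into mates, an additional gain of 2.\<close>
      then have "?d (m y) \<le> 2" using bad[OF az, of "m y"] M14 N6 S(4)[OF y] by (simp add: gain_def)
      then have d333: "?d (m x) = 3" "?d s = 3" "?d (m s) = 3"
        using s14 d3[OF s(1)] d3[OF ms(1)] d3[OF xs(4)] by linarith+
      have l: "L (m s) (m x)" "L s (m x)" "L (m y) (m x)"
        using bad[OF az, of s] bad[OF az, of "m s"] d333 M14 N6 ms(7) d0(2)[OF x]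
        by (auto simp: gain_def split: if_splits)
      have "{t \<in> P. m x \<noteq> t \<and> t \<noteq> m (m x) \<and> \<not> L (m x) t} \<subseteq> {y}"
        using l L_sym xs unfolding Peq[symmetric] by auto
      then have "?d (m x) \<le> card {y}" unfolding defect_def by (intro card_mono) auto
      then show False using d333 by simp
    qed
  qed
qed

text \<open>By parity the only value beyond \<open>good_pair\<close> is
  \<open>4 * card P - 8\<close>, where a gain of 10 is needed. The argument is the same with all
  thresholds raised by one; ten ports leave enough room for the estimates.\<close>

lemma good_pair_no_isolated_node:
  assumes sys: "system P m W" and N: "card P \<ge> 10" and M: "card (nonlinks L P m) + 8 \<le> 4 * card P"
    and nin: "\<And>y. y \<in> P \<Longrightarrow> isolated P m y \<Longrightarrow> \<not> isolated P m (m y)"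
  shows "\<exists>y x. adj P m y x \<and> card (nonlinks L P m) + 18 \<le> 4 * card P + gain P m y x"
proof (cases "card (nonlinks L P m) + 10 \<le> 4 * card P")
  case True
  then show ?thesis using good_pair[OF sys] N by simp
next
  case False
  let ?d = "defect L P m" and ?M = "card (nonlinks L P m)"
  note S = systemD[OF sys]
  have Meq: "?M + 8 = 4 * card P"
  proof -
    have "even ?M" "even (4 * card P)" using even_card_nonlinks[OF sys] by auto
    then obtain a b where "?M = 2 * a" "4 * card P = 2 * b" by (auto elim!: evenE)
    then have "b < a + 5" "a + 4 \<le> b" using False M by linarith+
    then show ?thesis using \<open>?M = 2 * a\<close> \<open>4 * card P = 2 * b\<close> by linarith
  qed
  show ?thesis
  proof (rule ccontr)
    assume neg: "\<not> ?thesis"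
    have bad: "gain P m y x < 10" if "adj P m y x" for y x
    proof -
      have "\<not> ?M + 18 \<le> 4 * card P + gain P m y x" using that neg by blast
      then show ?thesis using Meq by linarith
    qed
    have g: "2 * ?d y + 2 * ?d x \<le> gain P m y x" for y x by (simp add: gain_def)
    have sumd: "(\<Sum>s\<in>P. ?d s) = ?M" using card_nonlinks[OF S(1)] by metis
    have ex_adj: "\<exists>x. adj P m y x" if "y \<in> P" "\<not> isolated P m y" for y
      using that by (auto simp: isolated_def)
    show False
    proof (cases "\<exists>y\<in>P. isolated P m y")
      case True
      then obtain y where y: "y \<in> P" "isolated P m y" by blast
      let ?e = "rest_defect P m y"
      note e = rest_defect[OF sys y]
      have my: "m y \<in> P" "m y \<noteq> y" "m (m y) = y" using S y by auto
      have nly: "\<not> L t y" if "t \<in> P" "t \<noteq> y" "t \<noteq> m y" for t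
        using y that L_sym unfolding isolated_def adj_def by blast
      show False
      proof (cases "\<exists>s\<in>P. s \<noteq> y \<and> ?e s \<ge> 3")
        case True
        then obtain s where s: "s \<in> P" "s \<noteq> y" "?e s \<ge> 3" by blast
        have iso: "isolated P m s"
        proof (rule ccontr)
          assume "\<not> isolated P m s"
          then obtain t where t: "adj P m s t" using ex_adj s by blast
          have "10 \<le> gain P m s t" using e(3)[OF t] s(3) by linarith
          then show False using bad[OF t] by linarith
        qed
        have sny: "s \<noteq> m y" using nin[OF y] iso by blast
        have ms: "m s \<in> P" "m s \<noteq> s" "m (m s) = s" "m s \<noteq> y" using S s sny by auto
        have myms: "m y \<noteq> m s" using ms(3) my(3) s(2) by metis
        have nls: "\<not> L t s" if "t \<in> P" "t \<noteq> s" "t \<noteq> m s" for t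
          using iso s(1) that L_sym unfolding isolated_def adj_def by blast
        let ?R = "{p \<in> nonlinks L P m. fst p \<notin> {y, s} \<and> snd p \<notin> {y, s}}"
        have fR: "finite ?R" using S(1) by simp
        have cR: "card ?R \<le> 2" using two_isolated[OF sys y s(1) iso s(2) sny] Meq by linarith
        show False
        proof (cases "?R = {}")
          case True
          let ?K = "(\<lambda>t. (y, t)) ` (P - {y, m y}) \<union> (\<lambda>t. (t, y)) ` (P - {y, m y}) \<union>
            ((\<lambda>t. (s, t)) ` (P - {s, m s, y}) \<union> (\<lambda>t. (t, s)) ` (P - {s, m s, y}))"
          have "nonlinks L P m \<subseteq> ?K"
          proof
            fix p assume p: "p \<in> nonlinks L P m"
            then have "fst p \<in> {y, s} \<or> snd p \<in> {y, s}" using True by blast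
            then show "p \<in> ?K" using p my ms myms sny S(4) s y unfolding nonlinks_def
              by (cases p) (auto simp: image_iff)
          qed
          then have "?M \<le> card ?K" using S(1) by (intro card_mono) auto
          also have "\<dots> \<le> (card (P - {y, m y}) + card (P - {y, m y})) + (card (P - {s, m s, y}) + card (P - {s, m s, y}))"
            using S(1) by (intro order_trans[OF card_Un_le] add_mono card_image_le) auto
          also have "card (P - {y, m y}) = card P - 2"
            using S(1) my y by (subst card_Diff_subset) auto
          also have "card (P - {s, m s, y}) = card P - 3"
            using S(1) ms s y by (subst card_Diff_subset) (auto simp: card_insert_if)
          finally show False using Meq N by linarith
        next
          case False
          \<comment> \<open>Exactly one missing pair avoids \<open>y\<close> and \<open>s\<close>.
            Linking its end \<open>p\<close> to an uninvolved port \<open>t\<close> removes this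
            pair together with the nonlinks from \<open>p\<close> and \<open>t\<close> to
            \<open>y\<close> and \<open>s\<close>.\<close>
          then obtain p q where pq: "(p, q) \<in> nonlinks L P m" "p \<notin> {y, s}" "q \<notin> {y, s}" by auto
          then have pqP: "p \<in> P" "q \<in> P" "p \<noteq> q" "q \<noteq> m p" "\<not> L p q" by (auto simp: nonlinks_def)
          have qp: "(q, p) \<in> nonlinks L P m" using pqP L_sym S(4) by (auto simp: nonlinks_def)
          have "{(p, q), (q, p)} \<subseteq> ?R" using pq qp by auto
          moreover have "card {(p, q), (q, p)} = 2" using pqP by auto
          ultimately have R: "?R = {(p, q), (q, p)}" using cR fR by (metis (no_types, lifting) card_seteq)
          have "card {y, m y, s, m s, p, m p, q} \<le> 7" by (intro card_insert_le_m1) auto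
          then have "\<not> P \<subseteq> {y, m y, s, m s, p, m p, q}"
            using N card_mono[of "{y, m y, s, m s, p, m p, q}" P] by auto
          then obtain t where t: "t \<in> P" "t \<noteq> y" "t \<noteq> m y" "t \<noteq> s" "t \<noteq> m s" "t \<noteq> p" "t \<noteq> m p" "t \<noteq> q"
            by blast
          have "(p, t) \<notin> ?R" using R t pqP by auto
          then have "(p, t) \<notin> nonlinks L P m" using pq t by auto
          then have a: "adj P m p t" using pqP t by (auto simp: nonlinks_def adj_def)
          have "{y, s} \<subseteq> {u \<in> P. t \<noteq> u \<and> u \<noteq> m t \<and> \<not> L t u}"
            using t nly[of t] nls[of t] y s S(4) by auto
          then have "card {y, s} \<le> ?d t" using S(1) unfolding defect_def by (intro card_mono) auto
          then have "?e t \<ge> 1" using e(1)[of t] t s by auto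
          moreover have "?e p \<ge> 2"
          proof (cases "p = m y")
            case True
            have "{s, q} \<subseteq> {u \<in> P. p \<noteq> u \<and> u \<noteq> m p \<and> \<not> L p u}"
              using nls[OF pqP(1)] pqP pq s True my ms myms by auto
            then have "card {s, q} \<le> ?d p" using S(1) unfolding defect_def by (intro card_mono) auto
            then show ?thesis using True pq by (auto simp: rest_defect_def)
          next
            case pmy: False
            have py: "y \<noteq> m p" using pmy S(4)[OF pqP(1)] by metis
            have sub2: "{y, q} \<subseteq> {u \<in> P. p \<noteq> u \<and> u \<noteq> m p \<and> \<not> L p u}"
              using nly[of p] pqP pq y pmy py by auto
            have "?d p \<ge> 3 \<or> p = m s"
            proof (cases "p = m s")
              case False
              then have "s \<noteq> m p" using S(4)[OF pqP(1)] by metis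
              then have "{y, q, s} \<subseteq> {u \<in> P. p \<noteq> u \<and> u \<noteq> m p \<and> \<not> L p u}"
                using sub2 nls[of p] pqP pq s False by auto
              then have "card {y, q, s} \<le> ?d p" using S(1) unfolding defect_def by (intro card_mono) auto
              then show ?thesis using pq s by (auto simp: card_insert_if)
            qed simp
            then show ?thesis
            proof
              assume "?d p \<ge> 3"
              then show ?thesis using pmy by (simp add: rest_defect_def)
            next
              \<comment> \<open>As the mate of \<open>p\<close>, \<open>s\<close> does not count in
                its defect. Instead, contraction makes the unlinked ports \<open>s\<close> and
                \<open>m t\<close> mates, which supplies the missing 2.\<close>
              assume pms: "p = m s"
              have "card {y, q} \<le> ?d p" using S(1) sub2 unfolding defect_def by (intro card_mono) auto
              then have dp: "?d p \<ge> 2" using pq by auto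
              have mt: "m t \<in> P" "m t \<noteq> s" "m t \<noteq> m s" using S(2,4) t s(1) by metis+
              then have "\<not> L (m p) (m t)" using pms ms nls[of "m t"] L_sym by auto
              then have "gain P m p t = 2 * (?d p + ?d t) + 2" by (simp add: gain_def)
              moreover have "?d t \<ge> 2" using \<open>card {y, s} \<le> ?d t\<close> s by simp
              ultimately have "gain P m p t \<ge> 10" using dp by simp
              then show ?thesis using bad[OF a] by linarith
            qed
          qed
          ultimately have "gain P m p t \<ge> 10" using e(3)[OF a] by linarith
          then show False using bad[OF a] by linarith
        qed
      next
        case False
        then have e2: "?e s \<le> 2" if "s \<in> P" "s \<noteq> y" for s using that by fastforce
        have sume: "(\<Sum>s\<in>P - {y}. ?e s) + 4 = 2 * card P" using e(2) Meq by linarith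
        have "\<exists>s\<in>P - {y}. ?e s = 2"
        proof (rule ccontr)
          assume no2: "\<not> ?thesis"
          have "?e s \<le> 1" if "s \<in> P - {y}" for s
          proof -
            have "?e s \<noteq> 2" "?e s \<le> 2" using no2 that e2[of s] by auto
            then show ?thesis by linarith
          qed
          then have "(\<Sum>s\<in>P - {y}. ?e s) \<le> card (P - {y}) * 1"
            using sum_bounded_above[of "P - {y}" ?e 1] by auto
          also have "card (P - {y}) \<le> card P" using S(1) by (intro card_mono) auto
          finally show False using sume N by linarith
        qed
        then obtain s where s: "s \<in> P" "s \<noteq> y" "?e s = 2" by blast
        define f where "f z = (if z = y then 0 else ?e z)" for z
        \<comment> \<open>Neighbours of \<open>s\<close> have reduced defect 0, so at most five
          ports contribute, at most 2 each; the sum should be \<open>2 * card P - 4\<close>, at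
          least 16.\<close>
        have "(\<Sum>z\<in>P. f z) \<le> 2 * (?d s + 2) + 0 * card {x. adj P m s x}"
        proof (rule sum_le_neighbours[OF sys s(1)])
          show "f z \<le> 2" if "z \<in> P" for z using that e2 by (simp add: f_def)
          show "f z \<le> 0" if z: "adj P m s z" for z
            using e(3)[OF z] bad[OF z] s(3) by (simp add: f_def)
        qed
        moreover have "?d s \<le> 3" using s by (auto simp: rest_defect_def split: if_splits)
        moreover have "(\<Sum>z\<in>P. f z) = (\<Sum>z\<in>P - {y}. ?e z)"
          using S(1) y(1) by (simp add: sum.remove[of P y] f_def)
        ultimately show False using sume N by simp
      qed
    next
      case False
      then have niso: "\<exists>x. adj P m y x" if "y \<in> P" for y using ex_adj that by blast
      have d4: "?d y \<le> 4" if yP: "y \<in> P" for y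
      proof -
        obtain x where x: "adj P m y x" using niso yP by blast
        show ?thesis using bad[OF x] g[of y x] by linarith
      qed
      have "\<exists>y\<in>P. ?d y = 4"
      proof (rule ccontr)
        assume no4: "\<not> ?thesis"
        have "?d s \<le> 3" if "s \<in> P" for s
        proof -
          have "?d s \<noteq> 4" "?d s \<le> 4" using no4 that d4[of s] by auto
          then show ?thesis by linarith
        qed
        then have "?M \<le> card P * 3" using sum_bounded_above[of P ?d 3] sumd by auto
        then show False using Meq N by linarith
      qed
      then obtain y where y: "y \<in> P" "?d y = 4" by blast
      have "?d z \<le> 0" if z: "adj P m y z" for z using bad[OF z] g[of y z] y by linarith
      then have "?M \<le> 4 * 6 + 0 * card {x. adj P m y x}"
        using sum_le_neighbours[OF sys y(1), of ?d 4 0] d4 sumd y(2) by auto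
      then show False using Meq N by linarith
    qed
  qed
qed

text \<open>Contracting a pair from \<open>good_pair\<close> preserves the bound. With four ports
  any link will do, since a single segment results, and some link exists because no segment has both
  ends isolated.\<close>

theorem chain_exists:
  assumes "system P m W" and "P \<noteq> {}"
    and "card P = 2 \<or> card (nonlinks L P m) + 10 \<le> 4 * card P"
  shows "\<exists>s t. Q s t (\<Union>s\<in>P. W s)"
  using assms
proof (induction "card P" arbitrary: P m W rule: less_induct)
  case less
  note sys = less.prems(1)
  note S = systemD[OF sys]
  obtain s where s: "s \<in> P" using less.prems by blast
  have cP: "card P > 0" using S(1) s by (auto simp: card_gt_0_iff)
  obtain k where k: "card P = 2 * k" using even_card_ports[OF sys] by (auto elim!: evenE)
  show ?case
  proof (cases "card P = 2")
    case True
    have "card {s, m s} = card P" using True S(3)[OF s] by (simp add: card_insert_if)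
    then have "{s, m s} = P" using s S(1,2) by (intro card_subset_eq) auto
    then have "(\<Union>s\<in>P. W s) = W s" using S(6)[OF s] by auto
    then show ?thesis using S(5)[OF s] by metis
  next
    case False
    then have M: "card (nonlinks L P m) + 10 \<le> 4 * card P" using less.prems by blast
    have "k \<noteq> 0" "k \<noteq> 1" using False cP k by auto
    then have N4: "card P \<ge> 4" using k by linarith
    have "\<exists>y x. adj P m y x \<and> (card P = 4 \<or> card (nonlinks L P m) + 18 \<le> 4 * card P + gain P m y x)"
    proof (cases "card P = 4")
      case True
      have "\<not> isolated P m s \<or> \<not> isolated P m (m s)"
        using isolated_node[OF sys s] M by linarith
      then show ?thesis using True by (auto simp: isolated_def)
    next
      case False
      then have "k \<noteq> 2" using k by auto
      then have "card P \<ge> 6" using N4 k by linarith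
      then show ?thesis using good_pair[OF sys _ M] by blast
    qed
    then obtain y x where a: "adj P m y x"
      and gn: "card P = 4 \<or> card (nonlinks L P m) + 18 \<le> 4 * card P + gain P m y x" by blast
    have yx: "y \<in> P" "x \<in> P" "x \<noteq> y" "x \<noteq> m y" "L y x" using a by (auto simp: adj_def)
    from contract[OF sys yx] obtain P' m' W' where c: "system P' m' W'" "card P' + 2 = card P"
      "(\<Union>s\<in>P'. W' s) = (\<Union>s\<in>P. W s)"
      "card (nonlinks L P' m') + gain P m y x \<le> card (nonlinks L P m)"
      unfolding gain_def add.assoc by blast
    have "P' \<noteq> {}" using c(2) N4 by auto
    moreover have "card P' = 2 \<or> card (nonlinks L P' m') + 10 \<le> 4 * card P'"
      using gn c(2,4) by linarith
    ultimately show ?thesis using less.hyps[OF _ c(1)] c(2,3) by simp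
  qed
qed

text \<open>One contraction with a larger gain brings the count back below the bound of
  \<open>chain_exists\<close>, which finishes the chain.\<close>

theorem chain_exists_no_isolated_node:
  assumes sys: "system P m W" and N: "card P \<ge> 10" and "card (nonlinks L P m) + 8 \<le> 4 * card P"
    and "\<And>y. y \<in> P \<Longrightarrow> isolated P m y \<Longrightarrow> \<not> isolated P m (m y)"
  shows "\<exists>s t. Q s t (\<Union>s\<in>P. W s)"
proof -
  obtain y x where a: "adj P m y x"
    and gn: "card (nonlinks L P m) + 18 \<le> 4 * card P + gain P m y x"
    using good_pair_no_isolated_node[OF assms] by blast
  have yx: "y \<in> P" "x \<in> P" "x \<noteq> y" "x \<noteq> m y" "L y x" using a by (auto simp: adj_def)
  from contract[OF sys yx] obtain P' m' W' where c: "system P' m' W'" "card P' + 2 = card P"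
    "(\<Union>s\<in>P'. W' s) = (\<Union>s\<in>P. W s)"
    "card (nonlinks L P' m') + gain P m y x \<le> card (nonlinks L P m)"
    unfolding gain_def add.assoc by blast
  have "P' \<noteq> {}" using c(2) N by auto
  moreover have "card (nonlinks L P' m') + 10 \<le> 4 * card P'" using gn c(2,4) by linarith
  ultimately show ?thesis using chain_exists[OF c(1)] c(3) by metis
qed

end

section \<open>Minimal covers by edges and two-coloured triples\<close>

lemma sum_concat_parts:
  assumes "(\<Sum>K\<in>#C. mset K) = mset_set V"
  shows "(\<Sum>t\<in>V. f t) = (\<Sum>K\<in>#C. sum_list (map f K))"
proof -
  have "(\<Sum>K\<in>#C. sum_list (map f K)) = sum_mset (image_mset f (\<Sum>K\<in>#C. mset K))"
    by (induction C) (simp_all add: sum_mset_sum_list[symmetric] flip: mset_map)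
  then show ?thesis by (simp add: assms sum_unfold_sum_mset)
qed

definition nonadjacent :: "'v set \<Rightarrow> ('v \<Rightarrow> 'v \<Rightarrow> bool) \<Rightarrow> ('v \<times> 'v) set" where
  "nonadjacent V E = {(s, t). s \<in> V \<and> t \<in> V \<and> s \<noteq> t \<and> \<not> E s t}"

lemma finite_nonadjacent [simp]: "finite V \<Longrightarrow> finite (nonadjacent V E)"
  by (rule finite_subset[of _ "V \<times> V"]) (auto simp: nonadjacent_def)

lemma card_nonadjacent:
  assumes "finite V"
  shows "card (nonadjacent V E) = (\<Sum>s\<in>V. \<Sum>t\<in>V. of_bool (s \<noteq> t \<and> \<not> E s t))"
proof -
  have "nonadjacent V E = (SIGMA s:V. {t \<in> V. s \<noteq> t \<and> \<not> E s t})"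
    by (auto simp: nonadjacent_def)
  moreover have "(\<Sum>t\<in>V. of_bool (s \<noteq> t \<and> \<not> E s t)) = card {t \<in> V. s \<noteq> t \<and> \<not> E s t}" for s
    using assms by (simp add: sum_of_bool_eq Int_def)
  ultimately show ?thesis using assms by simp
qed

text \<open>\<open>B\<close> and \<open>G\<close> may coincide. The locale is used for two different
  colours and also for one colour in both roles, where a cover by edges alone is a perfect matching
  of that colour.\<close>

locale two_graphs =
  fixes V :: "'v set" and B G :: "'v \<Rightarrow> 'v \<Rightarrow> bool"
  assumes finite_V: "finite V"
    and B_sym: "B s t \<Longrightarrow> B t s" and G_sym: "G s t \<Longrightarrow> G t s"
    and B_irrefl: "\<not> B s s" and G_irrefl: "\<not> G s s"
    and B_nbr: "s \<in> V \<Longrightarrow> \<exists>t\<in>V. B s t" and G_nbr: "s \<in> V \<Longrightarrow> \<exists>t\<in>V. G s t"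
begin

definition H :: "'v \<Rightarrow> 'v \<Rightarrow> bool" where "H s t \<longleftrightarrow> B s t \<or> G s t"

lemma H_sym: "H s t \<Longrightarrow> H t s" using B_sym G_sym by (auto simp: H_def)

definition part :: "'v list \<Rightarrow> bool" where
  "part K \<longleftrightarrow> (\<exists>u. K = [u]) \<or> (\<exists>a b. K = [a, b] \<and> H a b) \<or> (\<exists>x y z. K = [x, y, z] \<and> B x y \<and> G y z)"

text \<open>One equation of multisets says that the parts are disjoint, repeat no vertex and exhaust
  \<open>V\<close>; an exchange of parts only requires comparing two sums.\<close>

definition cover :: "'v list multiset \<Rightarrow> bool" where
  "cover C \<longleftrightarrow> (\<forall>K\<in>#C. part K) \<and> (\<Sum>K\<in>#C. mset K) = mset_set V"

text \<open>With these weights, merging a single vertex and an edge into a triple pays, and so does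
  replacing two triples by three edges, whereas changing which vertex is single is free.\<close>

definition cost :: "'v list multiset \<Rightarrow> nat" where
  "cost C = (\<Sum>K\<in>#C. if length K = 1 then 2 else if length K = 3 then 1 else 0)"

definition minimal :: "'v list multiset \<Rightarrow> bool" where
  "minimal C \<longleftrightarrow> cover C \<and> (\<forall>C'. cover C' \<longrightarrow> cost C \<le> cost C')"

definition singles :: "'v list multiset \<Rightarrow> nat" where
  "singles C = size {#K \<in># C. length K = 1#}"

lemma part_simps [simp]: "part [u]" "part [a, b] \<longleftrightarrow> H a b" "part [x, y, z] \<longleftrightarrow> B x y \<and> G y z"
  by (auto simp: part_def)

lemma cost_simps [simp]: "cost {#} = 0" "cost (C + D) = cost C + cost D"
  "cost (add_mset K C) = (if length K = 1 then 2 else if length K = 3 then 1 else 0) + cost C"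
  by (auto simp: cost_def)

lemma singles_simps [simp]: "singles {#} = 0" "singles (C + D) = singles C + singles D"
  "singles (add_mset K C) = (if length K = 1 then 1 else 0) + singles C"
  by (auto simp: singles_def)

lemma ex_minimal: "\<exists>C. minimal C"
proof -
  have "cover (image_mset (\<lambda>u. [u]) (mset_set V))"
    by (auto simp: cover_def image_mset.compositionality o_def)
  then have "\<exists>C. cover C \<and> (\<forall>C'. cover C' \<longrightarrow> cost C \<le> cost C')"
    by (rule ex_has_least_nat)
  then show ?thesis by (simp add: minimal_def)
qed

lemma cover_part: "cover C \<Longrightarrow> K \<in># C \<Longrightarrow> part K"
  by (simp add: cover_def)

lemma cover_subset:
  assumes "cover C" "K \<in># C" shows "set K \<subseteq> V"
proof -
  obtain C0 where "C = add_mset K C0" using assms multi_member_split by metis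
  then have "set_mset (mset K) \<subseteq> set_mset (mset_set V)" using assms(1) unfolding cover_def by (metis image_mset_add_mset mset_subset_eq_add_left set_mset_mono sum_mset.insert)
  then show ?thesis using finite_V by simp
qed

lemma cover_distinct:
  assumes "cover (add_mset K C)" shows "distinct K"
proof -
  have "mset K \<subseteq># mset_set V" using assms unfolding cover_def by (metis image_mset_add_mset mset_subset_eq_add_left sum_mset.insert)
  then have "count (mset K) v \<le> 1" for v
    by (metis count_mset_set' le_trans mset_subset_eq_count order_refl zero_le_one)
  then show ?thesis unfolding distinct_count_atmost_1
    by (metis One_nat_def count_greater_eq_one_iff count_mset_0_iff le_antisym set_mset_mset)
qed

lemma cover_disjoint:
  assumes "cover (add_mset K (add_mset K' C))" shows "set K \<inter> set K' = {}"
proof -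
  have sub: "mset K + mset K' \<subseteq># mset_set V" using assms unfolding cover_def
    by (metis add.assoc image_mset_add_mset mset_subset_eq_add_left sum_mset.insert)
  show ?thesis
  proof (rule ccontr)
    assume "\<not> ?thesis"
    then obtain v where v: "v \<in># mset K" "v \<in># mset K'" by auto
    then have "count (mset K) v \<ge> 1" "count (mset K') v \<ge> 1" by simp_all
    moreover have "count (mset K + mset K') v \<le> count (mset_set V) v" using sub mset_subset_eq_count by metis
    moreover have "count (mset_set V) v \<le> 1" by (simp add: count_mset_set')
    ultimately show False by (simp only: count_union)
  qed
qed

lemma two_parts:
  assumes "K \<in># C" "K' \<in># C" "K \<noteq> K'"
  obtains C0 where "C = add_mset K (add_mset K' C0)"
  using assms by (metis insert_noteq_member multi_member_split)

text \<open>The exchange principle behind all structural facts: what remains of the cover plays no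
  part in the comparison.\<close>

lemma minimal_replace:
  assumes "minimal (D + C)" and "\<forall>K\<in>#D'. part K" and "(\<Sum>K\<in>#D'. mset K) = (\<Sum>K\<in>#D. mset K)"
  shows "cost D \<le> cost D'" and "cost D' = cost D \<Longrightarrow> minimal (D' + C)"
proof -
  have cov: "cover (D' + C)" using assms unfolding minimal_def cover_def by auto
  then have "cost (D + C) \<le> cost (D' + C)" using assms(1) unfolding minimal_def by blast
  then show "cost D \<le> cost D'" by simp
  show "minimal (D' + C)" if "cost D' = cost D"
    using cov assms(1) that unfolding minimal_def by simp
qed

lemma minimal_cover: "minimal C \<Longrightarrow> cover C" by (simp add: minimal_def)

section \<open>Vertices that can be left single\<close>

definition exposed :: "nat \<Rightarrow> 'v set" where
  "exposed k = {v. \<exists>C. minimal C \<and> singles C = k \<and> [v] \<in># C}"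

lemma exposed_subset: "exposed k \<subseteq> V"
  using cover_subset minimal_cover by (fastforce simp: exposed_def)

text \<open>Moving along an edge from a single vertex \<open>u\<close> into a part either lowers the cost
  or exposes another vertex of that part; distinct coloured edges expose distinct vertices.\<close>

lemma degree_into_part:
  assumes C: "minimal C" "singles C = k" and u: "[u] \<in># C" and K: "K \<in># C"
  shows "sum_list (map (\<lambda>t. of_bool (B u t) + of_bool (G u t)) K) + (if length K = 1 then 1 else 0)
    \<le> (sum_list (map (\<lambda>t. of_bool (t \<in> exposed k)) K) :: nat)"
proof -
  consider u' where "K = [u']" | a b where "K = [a, b]" "H a b" | x y z where "K = [x, y, z]" "B x y" "G y z"
    using cover_part[OF minimal_cover[OF C(1)] K] unfolding part_def by blast
  then show ?thesis
  proof cases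
    case 1
    have "u' \<in> exposed k" using C K 1 by (auto simp: exposed_def)
    moreover have "\<not> H u u'"
    proof
      assume h: "H u u'"
      then have "u \<noteq> u'" using B_irrefl G_irrefl by (auto simp: H_def)
      then obtain C0 where "C = {#[u], [u']#} + C0" using two_parts[OF u K] 1 by auto
      then show False using minimal_replace(1)[of "{#[u], [u']#}" C0 "{#[u, u']#}"] C h by simp
    qed
    ultimately show ?thesis using 1 by (simp add: H_def)
  next
    case 2
    obtain C0 where C0: "C = {#[u], [a, b]#} + C0" using two_parts[OF u K] 2 by auto
    have *: "p \<in> exposed k \<and> \<not> (B u q \<and> G u q)"
      if m: "minimal ({#[u], [q, p]#} + C0)" and h: "H u q" "H q p" for p q
    proof -
      note r = minimal_replace[OF m]
      \<comment> \<open>If \<open>u\<close> and \<open>q\<close> are adjacent in both relations, one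
        of the two edges goes with the edge from \<open>q\<close> to \<open>p\<close> to form a
        triple of cost 1, in place of parts of cost 2.\<close>
      have "\<not> (B u q \<and> G q p)"
        using r(1)[of "{#[u, q, p]#}"] by (auto simp: add_mset_commute)
      moreover have "\<not> (G u q \<and> B q p)"
        using r(1)[of "{#[p, q, u]#}"] B_sym G_sym by (auto simp: add_mset_commute)
      moreover have "minimal ({#[u, q], [p]#} + C0)"
        using r(2)[of "{#[u, q], [p]#}"] h by (auto simp: add_mset_commute)
      then have "p \<in> exposed k" unfolding exposed_def using C(2) C0 by fastforce
      ultimately show ?thesis using \<open>H q p\<close> by (auto simp: H_def)
    qed
    have "minimal ({#[u], [b, a]#} + C0)"
      using minimal_replace(2)[of "{#[u], [a, b]#}" C0 "{#[u], [b, a]#}"] C(1) C0 2 H_sym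
      by (auto simp: add_mset_commute)
    then have "H u b \<Longrightarrow> a \<in> exposed k \<and> \<not> (B u b \<and> G u b)" using *[of b a] 2 H_sym by auto
    moreover have "H u a \<Longrightarrow> b \<in> exposed k \<and> \<not> (B u a \<and> G u a)" using *[of a b] 2 C(1) C0 by auto
    ultimately show ?thesis using 2 by (auto simp: H_def)
  next
    case 3
    obtain C0 where C0: "C = {#[u], [x, y, z]#} + C0" using two_parts[OF u K] 3 by auto
    note r = minimal_replace[of "{#[u], [x, y, z]#}" C0]
    have "\<not> H u x" using r(1)[of "{#[u, x], [y, z]#}"] C(1) C0 3 by (auto simp: H_def)
    moreover have "\<not> H u z" using r(1)[of "{#[u, z], [x, y]#}"] C(1) C0 3 by (auto simp: H_def add_mset_commute)
    moreover have "x \<in> exposed k" if "B u y"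
    proof -
      have "minimal ({#[u, y, z], [x]#} + C0)"
        using r(2)[of "{#[u, y, z], [x]#}"] C(1) C0 that 3 by (auto simp: add_mset_commute)
      then show ?thesis unfolding exposed_def using C(2) C0 by fastforce
    qed
    moreover have "z \<in> exposed k" if "G u y"
    proof -
      have "minimal ({#[x, y, u], [z]#} + C0)"
        using r(2)[of "{#[x, y, u], [z]#}"] C(1) C0 that 3 G_sym by (auto simp: add_mset_commute)
      then show ?thesis unfolding exposed_def using C(2) C0 by fastforce
    qed
    ultimately show ?thesis using 3 by (auto simp: H_def)
  qed
qed

text \<open>\<open>degree_into_part\<close> is added up over one cover that leaves \<open>v\<close>
  single; the extra 1 for each single part gives \<open>k\<close>. The set \<open>exposed k\<close>
  plays the role of the vertices missed by some maximum matching in Gallai-Edmonds theory. The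
  number \<open>k\<close> is fixed because equal cost alone does not determine it.\<close>

lemma exposed_degree:
  assumes v: "v \<in> exposed k"
  shows "card {t \<in> V. B v t} + card {t \<in> V. G v t} + k \<le> card (exposed k)"
proof -
  obtain C where C: "minimal C" "singles C = k" "[v] \<in># C" using v by (auto simp: exposed_def)
  have p: "(\<Sum>K\<in>#C. mset K) = mset_set V" using C by (simp add: minimal_def cover_def)
  have "(\<Sum>t\<in>V. of_bool (B v t) + of_bool (G v t)) + k
      = (\<Sum>K\<in>#C. sum_list (map (\<lambda>t. of_bool (B v t) + of_bool (G v t)) K) + (if length K = 1 then 1 else 0))"
  proof -
    have "(\<Sum>K\<in>#C. if length K = 1 then 1 else 0) = singles C"
      by (induction C) auto
    then show ?thesis unfolding sum_concat_parts[OF p] using C by (simp add: sum_mset.distrib)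
  qed
  also have "\<dots> \<le> (\<Sum>K\<in>#C. sum_list (map (\<lambda>t. of_bool (t \<in> exposed k)) K))"
    using degree_into_part[OF C] by (rule sum_mset_mono)
  also have "\<dots> = (\<Sum>t\<in>V. of_bool (t \<in> exposed k))"
    unfolding sum_concat_parts[OF p] ..
  also have "\<dots> = card (exposed k)"
    using finite_V exposed_subset[of k] by (simp add: Int_absorb1)
  finally show ?thesis using finite_V by (simp add: sum.distrib Int_def)
qed

lemma nonadjacent_rows:
  fixes q :: "'v \<Rightarrow> 'v \<Rightarrow> nat"
  defines "q \<equiv> \<lambda>s t. of_bool (s \<noteq> t \<and> \<not> B s t) + of_bool (s \<noteq> t \<and> \<not> G s t)"
  shows "card (nonadjacent V B) + card (nonadjacent V G) = (\<Sum>s\<in>V. \<Sum>t\<in>V. q s t)"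
    and "v \<in> V \<Longrightarrow> (\<Sum>t\<in>V. q v t) + card {t \<in> V. B v t} + card {t \<in> V. G v t} + 2 = 2 * card V"
proof -
  show "card (nonadjacent V B) + card (nonadjacent V G) = (\<Sum>s\<in>V. \<Sum>t\<in>V. q s t)"
    by (simp add: card_nonadjacent[OF finite_V] q_def sum.distrib)
  assume v: "v \<in> V"
  have "card V = card {t \<in> V. E v t} + card {t \<in> V. v \<noteq> t \<and> \<not> E v t} + 1" if "\<not> E v v" for E
  proof -
    have "V = ({t \<in> V. E v t} \<union> {t \<in> V. v \<noteq> t \<and> \<not> E v t}) \<union> {v}" using v by auto
    then have "card V = card (({t \<in> V. E v t} \<union> {t \<in> V. v \<noteq> t \<and> \<not> E v t}) \<union> {v})" by simp
    also have "\<dots> = card {t \<in> V. E v t} + card {t \<in> V. v \<noteq> t \<and> \<not> E v t} + 1"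
      using finite_V that by (subst card_Un_disjoint, auto)+
    finally show ?thesis .
  qed
  from this[of B, OF B_irrefl] this[of G, OF G_irrefl]
  show "(\<Sum>t\<in>V. q v t) + card {t \<in> V. B v t} + card {t \<in> V. G v t} + 2 = 2 * card V"
    using finite_V by (simp add: q_def sum.distrib Int_def)
qed

text \<open>With \<open>w\<close> exposed vertices, each of their rows misses at least
  \<open>2 * n - 2 - (w - k)\<close> entries, and by symmetry the entries leaving the exposed set
  recur in the other rows. For \<open>k = 1\<close> this yields \<open>4 * w * (n - w)\<close>,
  which is at least \<open>12 * n - 36\<close> for \<open>w\<close> between 3 and
  \<open>n - 3\<close>; for larger \<open>w\<close> the exposed rows alone give nearly
  \<open>n * n\<close>, where \<open>n \<ge> 11\<close> enters. Against the total for three colours,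
  the first bound leaves the third colour almost complete and the second is contradictory.\<close>

lemma exposed_bound:
  assumes C: "minimal C" "singles C = k" "k \<ge> 1" and n: "card V \<ge> 11"
  shows "12 * card V \<le> card (nonadjacent V B) + card (nonadjacent V G) + 36"
    and "k \<ge> 2 \<Longrightarrow> 12 * card V < card (nonadjacent V B) + card (nonadjacent V G) + 32"
proof -
  let ?X = "exposed k"
  define q :: "'v \<Rightarrow> 'v \<Rightarrow> nat" where
    "q = (\<lambda>s t. of_bool (s \<noteq> t \<and> \<not> B s t) + of_bool (s \<noteq> t \<and> \<not> G s t))"
  define T where "T = card (nonadjacent V B) + card (nonadjacent V G)"
  define n where "n = card V"
  define w where "w = card ?X"
  have T: "T = (\<Sum>s\<in>V. \<Sum>t\<in>V. q s t)" unfolding T_def q_def by (rule nonadjacent_rows)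
  have X: "?X \<subseteq> V" "finite ?X" using exposed_subset finite_V finite_subset by blast+
  have wn: "w \<le> n" using X finite_V by (simp add: w_def n_def card_mono)
  have deg: "card {t \<in> V. B v t} + card {t \<in> V. G v t} + k \<le> w" if "v \<in> ?X" for v
    using exposed_degree[OF that] by (simp add: w_def)
  have row: "2 * n + k \<le> (\<Sum>t\<in>V. q v t) + w + 2" if "v \<in> ?X" for v
    using nonadjacent_rows(2)[of v] deg[OF that] that X unfolding q_def n_def by fastforce
  \<comment> \<open>An exposed vertex has a neighbour in each relation; this provides the lower end
    3 (or 4, if \<open>k \<ge> 2\<close>) of the range of \<open>w\<close> below.\<close>
  have kw: "k + 2 \<le> w"
  proof -
    have "{#K \<in># C. length K = 1#} \<noteq> {#}"
    proof
      assume "{#K \<in># C. length K = 1#} = {#}"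
      then have "singles C = 0" unfolding singles_def by (simp only: size_empty)
      then show False using C by simp
    qed
    then obtain K where "K \<in># {#K \<in># C. length K = 1#}" by (meson multiset_nonemptyE)
    then have K: "K \<in># C" "length K = 1" by simp_all
    then obtain v where v: "v \<in> ?X" using C by (auto simp: exposed_def length_Suc_conv)
    then have "v \<in> V" using X by auto
    then obtain s t where "s \<in> V" "B v s" "t \<in> V" "G v t" using B_nbr G_nbr by meson
    then have "card {t \<in> V. B v t} > 0" "card {t \<in> V. G v t} > 0" using finite_V by (auto simp: card_gt_0_iff)
    then show ?thesis using deg[OF v] by linarith
  qed
  have split: "T = (\<Sum>s\<in>?X. \<Sum>t\<in>V. q s t) + (\<Sum>s\<in>V - ?X. \<Sum>t\<in>V. q s t)"
    unfolding T using X finite_V by (subst add.commute, intro sum.subset_diff) auto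
  define R where "R = (\<Sum>s\<in>?X. \<Sum>t\<in>V. q s t)"
  have R: "w * (2 * n + k) \<le> R + w * (w + 2)"
  proof -
    have "(\<Sum>s\<in>?X. 2 * n + k) \<le> (\<Sum>s\<in>?X. (\<Sum>t\<in>V. q s t) + (w + 2))"
      using row by (intro sum_mono) (simp add: add.assoc)
    then show ?thesis unfolding sum.distrib sum_constant R_def w_def of_nat_id by (simp add: algebra_simps)
  qed
  \<comment> \<open>Entries of \<open>R\<close> with second vertex outside \<open>?X\<close>
    reappear transposed in the other rows; at most \<open>2 * w * (w - 1)\<close> entries lie inside
    \<open>?X\<close>.\<close>
  have "(\<Sum>s\<in>V - ?X. \<Sum>t\<in>V. q s t) + 2 * w * (w - 1) \<ge> R"
  proof -
    have "R = (\<Sum>s\<in>?X. (\<Sum>t\<in>V - ?X. q s t) + (\<Sum>t\<in>?X. q s t))"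
      unfolding R_def using X finite_V by (intro sum.cong refl sum.subset_diff) auto
    also have "\<dots> = (\<Sum>t\<in>V - ?X. \<Sum>s\<in>?X. q s t) + (\<Sum>s\<in>?X. \<Sum>t\<in>?X. q s t)"
      by (simp only: sum.distrib sum.swap[of _ "V - ?X"])
    also have "(\<Sum>t\<in>V - ?X. \<Sum>s\<in>?X. q s t) = (\<Sum>t\<in>V - ?X. \<Sum>s\<in>?X. q t s)"
      using B_sym G_sym unfolding q_def by (intro sum.cong refl arg_cong2[where f = "(+)"] arg_cong[where f = of_bool]) blast+
    also have "\<dots> \<le> (\<Sum>t\<in>V - ?X. \<Sum>s\<in>V. q t s)"
      using X finite_V by (intro sum_mono sum_mono2) auto
    also have "(\<Sum>s\<in>?X. \<Sum>t\<in>?X. q s t) \<le> (\<Sum>s\<in>?X. 2 * (w - 1))"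
    proof (rule sum_mono)
      fix s assume s: "s \<in> ?X"
      have "(\<Sum>t\<in>?X. q s t) = (\<Sum>t\<in>?X - {s}. q s t)"
        using s X by (simp add: sum.remove q_def)
      also have "\<dots> \<le> card (?X - {s}) * 2"
        using sum_bounded_above[of "?X - {s}" "q s" 2] by (simp add: q_def)
      finally show "(\<Sum>t\<in>?X. q s t) \<le> 2 * (w - 1)" using s X by (simp add: w_def)
    qed
    finally show ?thesis by (simp add: w_def mult.commute mult.left_commute)
  qed
  then have T2: "T + 2 * w * (w - 1) \<ge> 2 * R" and T1: "T \<ge> R" using split by (simp_all add: R_def)
  define t n' w' k' :: int where "t = T" and "n' = n" and "w' = w" and "k' = k"
  have i: "w' * (2 * n' + k' - w' - 2) \<le> t" "2 * (w' * (2 * n' + k' - w' - 2)) \<le> t + 2 * w' * (w' - 1)"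
  proof -
    have r: "w' * (2 * n' + k') \<le> int R + w' * (w' + 2)"
      using R unfolding n'_def w'_def k'_def by (metis (mono_tags) of_nat_add of_nat_le_iff of_nat_mult of_nat_numeral)
    show "w' * (2 * n' + k' - w' - 2) \<le> t" using r T1 by (simp add: t_def algebra_simps)
    have "int (2 * w * (w - 1)) = 2 * w' * (w' - 1)" using kw by (simp add: w'_def of_nat_diff)
    then have "2 * int R \<le> t + 2 * w' * (w' - 1)" using T2 unfolding t_def by linarith
    then show "2 * (w' * (2 * n' + k' - w' - 2)) \<le> t + 2 * w' * (w' - 1)" using r by (simp add: algebra_simps)
  qed
  have h: "11 \<le> n'" "k' + 2 \<le> w'" "w' \<le> n'" "1 \<le> k'"
    using kw wn assms by (auto simp: n'_def w'_def k'_def n_def)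
  have j: "w' * (2 * n' + j - w' - 2) \<le> t" "2 * (w' * (2 * n' + j - w' - 2)) \<le> t + 2 * w' * (w' - 1)"
    if "j \<le> k'" for j
  proof -
    have "w' * (2 * n' + j - w' - 2) \<le> w' * (2 * n' + k' - w' - 2)"
      using h that by (intro mult_left_mono) auto
    then show "w' * (2 * n' + j - w' - 2) \<le> t" "2 * (w' * (2 * n' + j - w' - 2)) \<le> t + 2 * w' * (w' - 1)"
      using i by linarith+
  qed
  have "12 * n' \<le> t + 36"
  proof (cases "w' \<le> n' - 3")
    case True
    \<comment> \<open>The bound \<open>4 * w' * (n' - w')\<close> is concave in \<open>w'\<close>,
      so it is smallest at the ends 3 and \<open>n' - 3\<close>; this product expresses
      that.\<close>
    then have "0 \<le> (w' - 3) * (n' - 3 - w')" using h by (intro mult_nonneg_nonneg) auto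
    then show ?thesis using j(2)[of 1] h by (simp add: algebra_simps)
  next
    case False
    have "0 \<le> (n' - 11) * (n' - 2)" using h by (intro mult_nonneg_nonneg) auto
    then have sq: "13 * n' \<le> n' * n' + 22" by (simp add: algebra_simps)
    consider "w' = n'" | "w' = n' - 1" | "w' = n' - 2" using False h by linarith
    then show ?thesis
    proof cases
      case 1
      have "n' * n' - n' \<le> t" using j(1)[OF h(4), unfolded 1] by (simp add: algebra_simps)
      then show ?thesis using sq h by linarith
    next
      case 2
      have "n' * n' - n' \<le> t" using j(1)[OF h(4), unfolded 2] by (simp add: algebra_simps)
      then show ?thesis using sq h by linarith
    next
      case 3
      have "n' * n' - n' - 2 \<le> t" using j(1)[OF h(4), unfolded 3] by (simp add: algebra_simps)
      then show ?thesis using sq h by linarith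
    qed
  qed
  then show "12 * card V \<le> card (nonadjacent V B) + card (nonadjacent V G) + 36"
    by (simp add: t_def n'_def n_def T_def)
  have "12 * n' < t + 32" if "2 \<le> k'"
  proof (cases "w' \<le> n' - 4")
    case True
    then have "0 \<le> (w' - 4) * (n' - 4 - w')" using h that by (intro mult_nonneg_nonneg) auto
    then show ?thesis using j(2)[of 2] h that by (simp add: algebra_simps)
  next
    case False
    have "0 \<le> (n' - 11) * (n' - 1)" using h by (intro mult_nonneg_nonneg) auto
    then have sq: "12 * n' \<le> n' * n' + 11" by (simp add: algebra_simps)
    consider "w' = n'" | "w' = n' - 1" | "w' = n' - 2" | "w' = n' - 3" using False h by linarith
    then show ?thesis
    proof cases
      case 1
      have "n' * n' \<le> t" using j(1)[OF that, unfolded 1] by (simp add: algebra_simps)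
      then show ?thesis using sq h by linarith
    next
      case 2
      have "n' * n' - 1 \<le> t" using j(1)[OF that, unfolded 2] by (simp add: algebra_simps)
      then show ?thesis using sq h by linarith
    next
      case 3
      have "n' * n' - 4 \<le> t" using j(1)[OF that, unfolded 3] by (simp add: algebra_simps)
      then show ?thesis using sq h by linarith
    next
      case 4
      have "n' * n' - 9 \<le> t" using j(1)[OF that, unfolded 4] by (simp add: algebra_simps)
      then show ?thesis using sq h by linarith
    qed
  qed
  then show "12 * card V < card (nonadjacent V B) + card (nonadjacent V G) + 32" if "k \<ge> 2"
    using that by (simp add: t_def n'_def n_def T_def k'_def)
qed

section \<open>Missing pairs between the parts of a minimal cover\<close>

definition hm :: "'v \<Rightarrow> 'v \<Rightarrow> nat" where "hm s t = of_bool (s \<noteq> t \<and> \<not> H s t)"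

definition cross :: "'v list \<Rightarrow> 'v list \<Rightarrow> nat" where
  "cross K K' = (\<Sum>s\<leftarrow>K. \<Sum>t\<leftarrow>K'. hm s t)"

definition tips :: "'v list \<Rightarrow> 'v set" where "tips K = {hd K, last K}"

lemma hm_sym: "hm s t = hm t s" using H_sym by (auto simp: hm_def)

lemma cross_sym: "cross K K' = cross K' K"
proof -
  have "(\<Sum>s\<leftarrow>xs. \<Sum>t\<leftarrow>ys. hm s t) = (\<Sum>t\<leftarrow>ys. \<Sum>s\<leftarrow>xs. hm s t)" for xs ys
    by (induction xs) (simp_all add: sum_list_addf)
  then show ?thesis unfolding cross_def by (simp add: hm_sym)
qed

text \<open>Parts are nonempty and disjoint, so none occurs twice. This lets sums over the multiset
  become sums over a finite set.\<close>

lemma cover_eq_mset_set: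
  assumes "cover C" shows "C = mset_set (set_mset C)"
proof (rule multiset_eqI)
  fix K
  have "count C K \<le> 1"
  proof (rule ccontr)
    assume "\<not> ?thesis"
    then obtain C1 where "C = add_mset K C1" "K \<in># C1"
      by (metis count_add_mset in_countE less_Suc_eq_le linorder_not_less mset_add not_in_iff One_nat_def not_one_le_zero nat_le_linear add_diff_cancel_right' count_eq_zero_iff zero_less_diff Suc_le_eq)
    then obtain C0 where C0: "C = add_mset K (add_mset K C0)" by (metis multi_member_split)
    then have "set K = {}" using cover_disjoint[of K K C0] assms by simp
    then have "K = []" by simp
    moreover have "part K" using cover_part[OF assms] C0 by simp
    ultimately show False by (simp add: part_def)
  qed
  then show "count C K = count (mset_set (set_mset C)) K"
    by (simp add: count_mset_set' le_Suc_eq not_in_iff) (metis One_nat_def le_Suc_eq le_zero_eq not_in_iff)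
qed

lemma card_nonadjacent_H:
  assumes "cover C"
  shows "card (nonadjacent V H) = (\<Sum>K\<in>set_mset C. \<Sum>K'\<in>set_mset C. cross K K')"
proof -
  have p: "(\<Sum>K\<in>#C. mset K) = mset_set V" using assms by (simp add: cover_def)
  have S: "(\<Sum>t\<in>V. f t) = (\<Sum>K\<in>set_mset C. \<Sum>t\<leftarrow>K. f t)" for f :: "'v \<Rightarrow> nat"
    unfolding sum_concat_parts[OF p] using cover_eq_mset_set[OF assms]
    by (metis sum_unfold_sum_mset)
  have "card (nonadjacent V H) = (\<Sum>s\<in>V. \<Sum>t\<in>V. hm s t)"
    by (simp add: card_nonadjacent[OF finite_V] hm_def)
  also have "\<dots> = (\<Sum>K\<in>set_mset C. \<Sum>s\<leftarrow>K. \<Sum>K'\<in>set_mset C. \<Sum>t\<leftarrow>K'. hm s t)"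
    unfolding S[of "\<lambda>t. hm _ t"] by (rule S)
  also have "\<dots> = (\<Sum>K\<in>set_mset C. \<Sum>K'\<in>set_mset C. cross K K')"
  proof (rule sum.cong[OF refl])
    fix K
    show "(\<Sum>s\<leftarrow>K. \<Sum>K'\<in>set_mset C. \<Sum>t\<leftarrow>K'. hm s t) = (\<Sum>K'\<in>set_mset C. cross K K')"
      unfolding cross_def by (induction K) (simp_all add: sum.distrib)
  qed
  finally show ?thesis .
qed

text \<open>Either tip can be split off and leaves an edge of \<open>H\<close> behind; in the
  exchanges only this matters, not which relation the edge belongs to.\<close>

lemma triple_end:
  assumes "part K" "length K = 3" "p \<in> tips K"
  obtains q where "H (K ! 1) q" "q \<in> tips K" "mset K = {#p, K ! 1, q#}"
proof -
  obtain x y z where K: "K = [x, y, z]" "B x y" "G y z" using assms by (auto simp: part_def)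
  then have h: "H y x" "H y z" using B_sym by (auto simp: H_def)
  consider "p = x" | "p = z" using assms K by (auto simp: tips_def)
  then show ?thesis
    by cases (use that[of z] that[of x] K h in \<open>auto simp: tips_def add_mset_commute\<close>)
qed

text \<open>Each forbidden adjacency below would let edges alone cover a set of parts
  that contains two paths with three vertices.\<close>

context
  fixes C C0 :: "'v list multiset" and K K' :: "'v list"
  assumes C: "minimal C" and K: "length K = 3" "length K' = 3" "part K" "part K'"
begin

lemma tips_nonadjacent:
  assumes "C = {#K, K'#} + C0" "p \<in> tips K" "p' \<in> tips K'"
  shows "\<not> H p p'"
proof
  assume h: "H p p'"
  obtain q where q: "H (K ! 1) q" "mset K = {#p, K ! 1, q#}" using triple_end K assms by metis
  obtain q' where q': "H (K' ! 1) q'" "mset K' = {#p', K' ! 1, q'#}" using triple_end K assms by metis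
  show False
    using minimal_replace(1)[of "{#K, K'#}" C0 "{#[p, p'], [K ! 1, q], [K' ! 1, q']#}"] C assms(1) h q q' K
    by (auto simp: add_mset_commute)
qed

lemma centre_nonadjacent:
  assumes "C = {#K, K'#} + C0" "H (hd K) (last K)" "p' \<in> tips K'"
  shows "\<not> H (K ! 1) p'"
proof
  assume h: "H (K ! 1) p'"
  obtain x y z where k: "K = [x, y, z]" using K by (auto simp: part_def)
  obtain q' where q': "H (K' ! 1) q'" "mset K' = {#p', K' ! 1, q'#}" using triple_end K assms by metis
  show False
    using minimal_replace(1)[of "{#K, K'#}" C0 "{#[x, z], [y, p'], [K' ! 1, q']#}"] C assms h q' K k
    by (auto simp: add_mset_commute)
qed

lemma edge_nonadjacent:
  assumes "C = {#[a, b], K, K'#} + C0" "p \<in> tips K" "p' \<in> tips K'"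
  shows "\<not> (H a p \<and> H b p')"
proof
  assume h: "H a p \<and> H b p'"
  obtain q where q: "H (K ! 1) q" "mset K = {#p, K ! 1, q#}" using triple_end K assms by metis
  obtain q' where q': "H (K' ! 1) q'" "mset K' = {#p', K' ! 1, q'#}" using triple_end K assms by metis
  show False
    using minimal_replace(1)[of "{#[a, b], K, K'#}" C0 "{#[a, p], [b, p'], [K ! 1, q], [K' ! 1, q']#}"] C assms(1) h q q' K
    by (auto simp: add_mset_commute)
qed

end

definition pairs :: "'v list multiset \<Rightarrow> 'v list set" where
  "pairs C = {K \<in> set_mset C. length K = 2}"

definition triples :: "'v list multiset \<Rightarrow> 'v list set" where
  "triples C = {K \<in> set_mset C. length K = 3}"

lemma finite_pairs [simp]: "finite (pairs C)" "finite (triples C)"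
  by (auto simp: pairs_def triples_def)

lemma pairs_triples:
  assumes "cover C" "singles C = 0"
  shows "set_mset C = pairs C \<union> triples C" "pairs C \<inter> triples C = {}"
    "card V = 2 * card (pairs C) + 3 * card (triples C)"
proof -
  have "{#K \<in># C. length K = 1#} = {#}" using assms by (simp add: singles_def)
  then have "length K \<noteq> 1" if "K \<in># C" for K using that by (metis (mono_tags, lifting) empty_iff filter_mset_eq_conv set_mset_empty mem_Collect_eq set_mset_filter)
  then show eq: "set_mset C = pairs C \<union> triples C"
    using cover_part[OF assms(1)] by (fastforce simp: pairs_def triples_def part_def)
  show dis: "pairs C \<inter> triples C = {}" by (auto simp: pairs_def triples_def)
  have p: "(\<Sum>K\<in>#C. mset K) = mset_set V" using assms by (simp add: cover_def)
  have "card V = (\<Sum>K\<in>#C. \<Sum>t\<leftarrow>K. 1)" unfolding card_eq_sum by (rule sum_concat_parts[OF p])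
  also have "\<dots> = (\<Sum>K\<in>set_mset C. length K)"
    using cover_eq_mset_set[OF assms(1)] by (simp add: sum_list_triv) (metis sum_unfold_sum_mset)
  also have "\<dots> = (\<Sum>K\<in>pairs C. 2) + (\<Sum>K\<in>triples C. 3)"
    unfolding eq using dis by (subst sum.union_disjoint) (auto simp: pairs_def triples_def)
  finally show "card V = 2 * card (pairs C) + 3 * card (triples C)" by simp
qed

lemma card_nonadjacent_pairs_triples:
  assumes "cover C" "singles C = 0"
  shows "card (nonadjacent V H) = (\<Sum>K\<in>triples C. \<Sum>K'\<in>triples C. cross K K')
    + 2 * (\<Sum>P\<in>pairs C. \<Sum>K\<in>triples C. cross P K) + (\<Sum>P\<in>pairs C. \<Sum>P'\<in>pairs C. cross P P')"
proof -
  have "(\<Sum>K\<in>triples C. \<Sum>P\<in>pairs C. cross K P) = (\<Sum>P\<in>pairs C. \<Sum>K\<in>triples C. cross P K)"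
    by (subst sum.swap) (simp add: cross_sym)
  then show ?thesis
    unfolding card_nonadjacent_H[OF assms(1)] pairs_triples(1)[OF assms]
    using pairs_triples(2)[OF assms] by (simp add: sum.union_disjoint sum.distrib)
qed

definition triangle :: "'v list \<Rightarrow> nat" where "triangle K = of_bool (H (hd K) (last K))"

lemma triplesD:
  assumes "minimal C" "K \<in> triples C"
  shows "K \<in># C" "length K = 3" "part K"
  using assms cover_part[OF minimal_cover] by (auto simp: triples_def)

text \<open>All four pairs of tips are missing. If the tips of one triple are adjacent, its centre
  is moreover cut off from both tips of the other triple, which adds 2.\<close>

lemma cross_triples:
  assumes C: "minimal C" and K: "K \<in> triples C" "K' \<in> triples C" "K \<noteq> K'"
  shows "4 + 2 * triangle K + 2 * triangle K' \<le> cross K K'"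
    and "cross K K' \<le> 4 \<Longrightarrow> p' \<in> tips K' \<Longrightarrow> H (K ! 1) p'"
proof -
  note k = triplesD[OF C K(1)] triplesD[OF C K(2)]
  obtain C0 where "C = add_mset K (add_mset K' C0)" using two_parts[OF k(1) k(4) K(3)] .
  then have C0: "C = {#K, K'#} + C0" "C = {#K', K#} + C0" by (auto simp: add_mset_commute)
  obtain x y z where xyz: "K = [x, y, z]" using k by (auto simp: part_def)
  obtain x' y' z' where xyz': "K' = [x', y', z']" using k by (auto simp: part_def)
  have dis: "set K \<inter> set K' = {}" using cover_disjoint[of K K' C0] minimal_cover[OF C] C0 by simp
  have tips: "\<not> H s t" if "s \<in> tips K" "t \<in> tips K'" for s t
    using tips_nonadjacent[OF C k(2,5,3,6) C0(1) that] .
  have 1: "\<not> H y t" if "H x z" "t \<in> tips K'" for t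
    using centre_nonadjacent[OF C k(2,5,3,6) C0(1) _ that(2)] that(1) xyz by simp
  have 2: "\<not> H y' t" if "H x' z'" "t \<in> tips K" for t
    using centre_nonadjacent[OF C k(5,2,6,3) C0(2) _ that(2)] that(1) xyz' by simp
  have e: "tips K = {x, z}" "tips K' = {x', z'}" using xyz xyz' by (auto simp: tips_def)
  have h1: "hm x x' = 1" "hm x z' = 1" "hm z x' = 1" "hm z z' = 1"
    using dis tips unfolding xyz xyz' e[unfolded xyz xyz'] hm_def by auto
  have h2: "triangle K \<le> hm y x'" "triangle K \<le> hm y z'"
    using dis 1 unfolding xyz xyz' e[unfolded xyz xyz'] hm_def triangle_def by auto
  have h3: "triangle K' \<le> hm x y'" "triangle K' \<le> hm z y'"
    using dis 2 H_sym unfolding xyz xyz' e[unfolded xyz xyz'] hm_def triangle_def by auto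
  have c: "cross K K' = 4 + (hm y x' + hm y z' + hm x y' + hm z y' + hm y y')"
    using h1 unfolding cross_def xyz xyz' by simp
  show "4 + 2 * triangle K + 2 * triangle K' \<le> cross K K'" using c h2 h3 by linarith
  assume "cross K K' \<le> 4" "p' \<in> tips K'"
  then show "H (K ! 1) p'" using c dis unfolding xyz xyz' e[unfolded xyz xyz'] hm_def by auto
qed

lemma cross_self:
  assumes "minimal C" "K \<in> triples C"
  shows "2 \<le> cross K K + 2 * triangle K"
proof -
  note k = triplesD[OF assms]
  obtain x y z where xyz: "K = [x, y, z]" using k by (auto simp: part_def)
  obtain C0 where "C = add_mset K C0" using k(1) multi_member_split by metis
  then have "distinct K" using cover_distinct minimal_cover[OF assms(1)] by metis
  then have "x \<noteq> z" using xyz by simp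
  then have "hm x z = 1 - triangle K" "hm z x = 1 - triangle K" using H_sym by (auto simp: xyz hm_def triangle_def)
  then show ?thesis unfolding cross_def xyz by simp
qed

definition fan :: "'v \<Rightarrow> 'v list \<Rightarrow> nat" where
  "fan a K = of_bool (H a (hd K)) + of_bool (H a (last K))"

lemma cross_pair_triple:
  assumes C: "minimal C" and P: "[a, b] \<in> pairs C" and K: "K \<in> triples C"
  shows "4 \<le> cross [a, b] K + fan a K + fan b K"
proof -
  note k = triplesD[OF C K]
  have P': "[a, b] \<in># C" "[a, b] \<noteq> K" using P k by (auto simp: pairs_def)
  obtain C0 where "C = add_mset [a, b] (add_mset K C0)" using two_parts[OF P'(1) k(1) P'(2)] .
  then have dis: "set [a, b] \<inter> set K = {}" using cover_disjoint[of "[a, b]" K C0] minimal_cover[OF C] by simp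
  obtain x y z where xyz: "K = [x, y, z]" using k by (auto simp: part_def)
  have "hm a x = 1 - of_bool (H a x)" "hm a z = 1 - of_bool (H a z)"
    "hm b x = 1 - of_bool (H b x)" "hm b z = 1 - of_bool (H b z)"
    using dis xyz by (auto simp: hm_def)
  then show ?thesis unfolding cross_def fan_def xyz by simp
qed

lemma fan_le: "fan a K \<le> 2" by (simp add: fan_def)

lemma fan_fan:
  assumes C: "minimal C" and P: "[a, b] \<in> pairs C" and K: "K \<in> triples C" "K' \<in> triples C" "K \<noteq> K'"
  shows "fan a K = 0 \<or> fan b K' = 0"
proof (rule ccontr)
  assume "\<not> ?thesis"
  then obtain p p' where p: "p \<in> tips K" "H a p" "p' \<in> tips K'" "H b p'"
    by (auto simp: fan_def tips_def split: if_splits)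
  note k = triplesD[OF C K(1)] triplesD[OF C K(2)]
  have P': "[a, b] \<in># C" "[a, b] \<noteq> K" "[a, b] \<noteq> K'" using P k by (auto simp: pairs_def)
  obtain C1 where C1: "C = add_mset K (add_mset K' C1)" using two_parts[OF k(1) k(4) K(3)] .
  then have "[a, b] \<in># C1" using P' by auto
  then obtain C0 where "C1 = add_mset [a, b] C0" using multi_member_split by metis
  then have "C = {#[a, b], K, K'#} + C0" using C1 by (simp add: add_mset_commute)
  then show False using edge_nonadjacent[OF C k(2,5,3,6) _ p(1,3)] p by blast
qed

text \<open>By \<open>fan_fan\<close>, either one end of \<open>P\<close> is adjacent to no tip at
  all, and each triple misses at least two of its four pairs with tips; or all such adjacencies go
  to one triple \<open>K0\<close> and every other triple misses all four. From two triples on, four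
  for all but one is no less than two for each.\<close>

lemma pair_triples:
  assumes C: "minimal C" and P: "P \<in> pairs C" and c: "card (triples C) \<ge> 2"
  shows "2 * card (triples C) \<le> (\<Sum>K\<in>triples C. cross P K)"
proof -
  let ?T = "triples C"
  obtain a b where ab: "P = [a, b]" using P by (auto simp: pairs_def length_Suc_conv numeral_2_eq_2)
  note cr = cross_pair_triple[OF C P[unfolded ab]]
  note ff = fan_fan[OF C P[unfolded ab]]
  have all2: ?thesis if two: "\<And>K. K \<in> ?T \<Longrightarrow> fan a K + fan b K \<le> 2"
  proof -
    have "2 \<le> cross P K" if K: "K \<in> ?T" for K using cr[OF K] two[OF K] ab by simp
    then show ?thesis using sum_bounded_below[of ?T 2 "cross P"] by (simp add: mult.commute)
  qed
  show ?thesis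
  proof (cases "(\<forall>K\<in>?T. fan a K = 0) \<or> (\<forall>K\<in>?T. fan b K = 0)")
    case True
    then show ?thesis using all2 fan_le by (metis add.left_neutral add.right_neutral)
  next
    case False
    then obtain K0 K1 where K: "K0 \<in> ?T" "fan a K0 \<noteq> 0" "K1 \<in> ?T" "fan b K1 \<noteq> 0" by blast
    then have "K1 = K0" using ff[OF K(1,3)] by metis
    then have z: "fan a K = 0 \<and> fan b K = 0" if "K \<in> ?T" "K \<noteq> K0" for K
      using that K ff[of K K1] ff[of K0 K] by auto
    have "4 \<le> cross P K" if "K \<in> ?T - {K0}" for K using cr[of K] z[of K] that ab by auto
    then have "4 * card (?T - {K0}) \<le> (\<Sum>K\<in>?T - {K0}. cross P K)"
      using sum_bounded_below[of "?T - {K0}" 4 "cross P"] by (simp add: mult.commute)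
    also have "\<dots> \<le> (\<Sum>K\<in>?T. cross P K)" by (intro sum_mono2) auto
    finally show ?thesis using K(1) c by (simp add: card_Diff_singleton)
  qed
qed

text \<open>Adjacent tips lower \<open>cross K K\<close> by 2, but then \<open>K\<close> misses two
  more pairs with each other triple, of which there is at least one. So each triple misses at least
  \<open>4 * t - 2\<close> pairs with triples in either case.\<close>

lemma triples_bound:
  assumes C: "minimal C" "singles C = 0" and c: "card (triples C) \<ge> 2"
  defines "p \<equiv> card (pairs C)" and "t \<equiv> card (triples C)"
  shows "4 * t * t + 4 * t * p \<le> card (nonadjacent V H) + 2 * t"
proof -
  let ?T = "triples C"
  have "4 * t - 2 \<le> (\<Sum>K'\<in>?T. cross K K')" if K: "K \<in> ?T" for K
  proof -
    have ct: "card (?T - {K}) = t - 1" using K by (simp add: t_def card_Diff_singleton)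
    have "(4 + 2 * triangle K) * (t - 1) \<le> (\<Sum>K'\<in>?T - {K}. cross K K')"
    proof -
      have "4 + 2 * triangle K \<le> cross K K'" if "K' \<in> ?T - {K}" for K'
        using cross_triples(1)[OF C(1) K, of K'] that by auto
      then show ?thesis using sum_bounded_below[of "?T - {K}" "4 + 2 * triangle K" "cross K"] ct by (simp add: mult.commute)
    qed
    moreover have "(\<Sum>K'\<in>?T. cross K K') = cross K K + (\<Sum>K'\<in>?T - {K}. cross K K')"
      using K by (simp add: sum.remove)
    moreover have "2 * triangle K \<le> 2 * triangle K * (t - 1)"
    proof -
      have "1 \<le> t - 1" using c unfolding t_def by linarith
      from mult_le_mono2[OF this, of "2 * triangle K"] show ?thesis by simp
    qed
    moreover have "(4 + 2 * triangle K) * (t - 1) = 4 * (t - 1) + 2 * triangle K * (t - 1)" by (simp add: algebra_simps)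
    ultimately show ?thesis using cross_self[OF C(1) K] c[folded t_def] by linarith
  qed
  then have "t * (4 * t - 2) \<le> (\<Sum>K\<in>?T. \<Sum>K'\<in>?T. cross K K')"
    using sum_bounded_below[of ?T "4 * t - 2" "\<lambda>K. \<Sum>K'\<in>?T. cross K K'"] by (simp add: t_def)
  moreover have "p * (2 * t) \<le> (\<Sum>P\<in>pairs C. \<Sum>K\<in>?T. cross P K)"
    using sum_bounded_below[of "pairs C" "2 * t" "\<lambda>P. \<Sum>K\<in>?T. cross P K"] pair_triples[OF C(1) _ c]
    by (simp add: p_def t_def)
  moreover have "t * (4 * t - 2) + 2 * t = 4 * t * t" using c by (cases t) (auto simp: algebra_simps t_def)
  ultimately show ?thesis
    using card_nonadjacent_pairs_triples[OF minimal_cover[OF C(1)] C(2)] by (simp add: algebra_simps)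
qed

text \<open>\<open>triples_bound\<close> gives only 12 in place of 14. Below 14 all its estimates
  are tight: no triple has adjacent tips, the centre of each triple is adjacent to the tips of the
  other, different pairs are completely adjacent, and each pair has an end adjacent to all four
  tips. Two such pairs and both triples can then be covered by edges.\<close>

lemma two_triples_bound:
  assumes C: "minimal C" "singles C = 0" and c: "card (triples C) = 2" and p2: "card (pairs C) \<ge> 2"
  shows "8 * card (pairs C) + 14 \<le> card (nonadjacent V H)"
proof (rule ccontr)
  assume neg: "\<not> ?thesis"
  obtain K K' where T: "triples C = {K, K'}" "K \<noteq> K'" using c by (meson card_2_iff)
  then have KT: "K \<in> triples C" "K' \<in> triples C" by auto
  note k = triplesD[OF C(1) KT(1)] triplesD[OF C(1) KT(2)]
  let ?Q = "\<Sum>P\<in>pairs C. \<Sum>P'\<in>pairs C. cross P P'"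
  have tot: "card (nonadjacent V H) = cross K K + cross K' K' + 2 * cross K K'
      + 2 * (\<Sum>P\<in>pairs C. cross P K + cross P K') + ?Q"
    using card_nonadjacent_pairs_triples[OF minimal_cover[OF C(1)] C(2)] T cross_sym[of K' K] by simp
  note x1 = cross_triples(1)[OF C(1) KT T(2)]
  note s1 = cross_self[OF C(1) KT(1)] and s2 = cross_self[OF C(1) KT(2)]
  have four: "4 \<le> cross P K + cross P K'" if "P \<in> pairs C" for P
    using pair_triples[OF C(1) that] c T by simp
  then have all: "4 * card (pairs C) \<le> (\<Sum>P\<in>pairs C. cross P K + cross P K')"
    using sum_bounded_below[of "pairs C" 4 "\<lambda>P. cross P K + cross P K'"] by (simp add: mult.commute)
  have "2 * triangle K + 2 * triangle K' \<le> 1" using neg tot x1 s1 s2 all by linarith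
  then have t0: "triangle K = 0" "triangle K' = 0" by simp_all
  have x4: "cross K K' \<le> 4" using neg tot x1 s1 s2 all t0 by linarith
  have Q1: "?Q \<le> 1" using neg tot x1 s1 s2 all t0 by linarith
  have P4: "cross P K + cross P K' \<le> 4" if P: "P \<in> pairs C" for P
  proof -
    have "(\<Sum>P\<in>pairs C. cross P K + cross P K') = cross P K + cross P K' + (\<Sum>P\<in>pairs C - {P}. cross P K + cross P K')"
      using P by (simp add: sum.remove)
    moreover have "4 * card (pairs C - {P}) \<le> (\<Sum>P\<in>pairs C - {P}. cross P K + cross P K')"
      using sum_bounded_below[of "pairs C - {P}" 4 "\<lambda>P. cross P K + cross P K'"] four by (simp add: mult.commute)
    moreover have "card (pairs C - {P}) + 1 = card (pairs C)" using P p2 by (simp add: card_Diff_singleton)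
    ultimately show ?thesis using neg tot x1 s1 s2 t0 by linarith
  qed
  have ctr: "H (K ! 1) p'" if "p' \<in> tips K'" for p'
    using cross_triples(2)[OF C(1) KT T(2) x4 that] .
  have ctr': "H (K' ! 1) p" if "p \<in> tips K" for p
    using cross_triples(2)[OF C(1) KT(2,1) T(2)[symmetric] _ that] x4 cross_sym[of K K'] by simp
  \<comment> \<open>Tightness leaves at least four adjacencies between the pair and the tips. They
    cannot be divided between \<open>a\<close> and \<open>b\<close>: not across the triples, by
    \<open>fan_fan\<close>, and not between the two tips of one triple, since its centre would then
    be free to take a tip of the other.\<close>
  have hub: "\<exists>a b. mset P = {#a, b#} \<and> (\<forall>p\<in>tips K \<union> tips K'. H a p)" if P: "P \<in> pairs C" for P
  proof -
    obtain a b where ab: "P = [a, b]" using P by (auto simp: pairs_def length_Suc_conv numeral_2_eq_2)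
    have P': "[a, b] \<in># C" "[a, b] \<noteq> K" "[a, b] \<noteq> K'" using P k ab by (auto simp: pairs_def)
    obtain C1 where C1: "C = add_mset K (add_mset K' C1)" using two_parts[OF k(1) k(4) T(2)] .
    then have "[a, b] \<in># C1" using P' by auto
    then obtain C0 where "C1 = add_mset [a, b] C0" using multi_member_split by metis
    then have C0: "C = {#[a, b], K, K'#} + C0" using C1 by (simp add: add_mset_commute)
    obtain x y z where xyz: "K = [x, y, z]" using k by (auto simp: part_def)
    obtain x' y' z' where xyz': "K' = [x', y', z']" using k by (auto simp: part_def)
    have e: "tips K = {x, z}" "tips K' = {x', z'}" using xyz xyz' by (auto simp: tips_def)
    have hh: "H y x" "H y z" "H y' x'" "H y' z'" using k xyz xyz' B_sym by (auto simp: H_def)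
    have no: "\<not> (H p x \<and> H q z)" if "mset [a, b] = mset [p, q]" for p q
    proof
      assume "H p x \<and> H q z"
      then show False
        using minimal_replace(1)[of "{#[a, b], K, K'#}" C0 "{#[p, x], [q, z], [y, x'], [y', z']#}"]
          C(1) C0 that ctr[of x'] hh xyz xyz' e by (auto simp: add_mset_commute)
    qed
    have no': "\<not> (H p x' \<and> H q z')" if "mset [a, b] = mset [p, q]" for p q
    proof
      assume "H p x' \<and> H q z'"
      then show False
        using minimal_replace(1)[of "{#[a, b], K, K'#}" C0 "{#[p, x'], [q, z'], [y', x], [y, z]#}"]
          C(1) C0 that ctr'[of x] hh xyz xyz' e by (auto simp: add_mset_commute)
    qed
    have n1: "\<not> (H a x \<and> H b z)" "\<not> (H b x \<and> H a z)" "\<not> (H a x' \<and> H b z')" "\<not> (H b x' \<and> H a z')"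
      using no[of a b] no[of b a] no'[of a b] no'[of b a] by (auto simp: add_mset_commute)
    have f: "fan a K = 0 \<or> fan b K' = 0" "fan a K' = 0 \<or> fan b K = 0"
      using fan_fan[OF C(1) P[unfolded ab]] KT T(2) by metis+
    have "4 \<le> fan a K + fan b K + (fan a K' + fan b K')"
      using cross_pair_triple[OF C(1) P[unfolded ab] KT(1)] cross_pair_triple[OF C(1) P[unfolded ab] KT(2)]
        P4[OF P] ab by simp
    then have "(H a x \<and> H a z \<and> H a x' \<and> H a z') \<or> (H b x \<and> H b z \<and> H b x' \<and> H b z')"
      using n1 f unfolding fan_def xyz xyz'
      by (cases "H a x"; cases "H a z"; cases "H a x'"; cases "H a z'") (auto simp: of_bool_def split: if_splits)
    then show ?thesis
    proof
      assume "H a x \<and> H a z \<and> H a x' \<and> H a z'"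
      then show ?thesis unfolding ab e by (intro exI[of _ a] exI[of _ b]) auto
    next
      assume "H b x \<and> H b z \<and> H b x' \<and> H b z'"
      then show ?thesis unfolding ab e by (intro exI[of _ b] exI[of _ a]) (auto simp: add_mset_commute)
    qed
  qed
  obtain P P' where P: "P \<in> pairs C" "P' \<in> pairs C" "P \<noteq> P'"
  proof -
    obtain P where P: "P \<in> pairs C" using p2 by fastforce
    then have "pairs C - {P} \<noteq> {}" using p2 card_Diff_singleton[OF P] by (metis card.empty diff_is_0_eq not_less_eq_eq numeral_2_eq_2 One_nat_def)
    then show ?thesis using that P by blast
  qed
  obtain a b where ab: "mset P = {#a, b#}" "\<forall>p\<in>tips K \<union> tips K'. H a p" using hub[OF P(1)] by blast
  obtain a' b' where ab': "mset P' = {#a', b'#}" "\<forall>p\<in>tips K \<union> tips K'. H a' p" using hub[OF P(2)] by blast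
  have len: "length P = 2" "length P' = 2" using P by (auto simp: pairs_def)
  have PC: "P \<in># C" "P' \<in># C" using P by (auto simp: pairs_def)
  have ne: "P \<noteq> K" "P \<noteq> K'" "P' \<noteq> K" "P' \<noteq> K'" using k len by auto
  obtain C1 where C1: "C = add_mset P (add_mset P' C1)" using two_parts[OF PC P(3)] .
  then have "K \<in># C1" "K' \<in># C1" using k ne by auto
  then obtain C0 where "C1 = add_mset K (add_mset K' C0)" using two_parts[OF _ _ T(2)] by metis
  then have C0: "C = {#P, P', K, K'#} + C0" using C1 by simp
  have dis: "set P \<inter> set P' = {}" using cover_disjoint[of P P' C1] minimal_cover[OF C(1)] C1 by simp
  have mem: "b \<in> set P" "b' \<in> set P'" using ab ab' by (metis set_mset_mset union_single_eq_member add_mset_add_single add_mset_commute)+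
  \<comment> \<open>A pair missing between \<open>P\<close> and \<open>P'\<close> occurs in both
    orders, so it would contribute 2 to \<open>?Q\<close>.\<close>
  have "H b b'"
  proof (rule ccontr)
    assume "\<not> H b b'"
    then have "hm b b' = 1" "hm b' b = 1" using dis mem H_sym by (auto simp: hm_def)
    have one: "1 \<le> cross Q Q'" if "q \<in> set Q" "q' \<in> set Q'" "hm q q' = 1" for q q' Q Q'
    proof -
      have "hm q q' \<in> set (map (hm q) Q')" using that(2) by simp
      from member_le_sum_list[OF this] have 1: "hm q q' \<le> (\<Sum>t\<leftarrow>Q'. hm q t)" by simp
      have "(\<Sum>t\<leftarrow>Q'. hm q t) \<in> set (map (\<lambda>s. \<Sum>t\<leftarrow>Q'. hm s t) Q)" using that(1) by simp
      from member_le_sum_list[OF this] have "(\<Sum>t\<leftarrow>Q'. hm q t) \<le> cross Q Q'" by (simp add: cross_def)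
      then show ?thesis using that(3) 1 by linarith
    qed
    have c: "1 \<le> cross P P'" "1 \<le> cross P' P" using one mem \<open>hm b b' = 1\<close> \<open>hm b' b = 1\<close> by metis+
    have "(\<Sum>R\<in>{P, P'}. \<Sum>R'\<in>{P, P'}. cross R R') \<le> (\<Sum>R\<in>pairs C. \<Sum>R'\<in>{P, P'}. cross R R')"
      using P by (intro sum_mono2) auto
    also have "\<dots> \<le> ?Q" using P by (intro sum_mono sum_mono2) auto
    finally show False using c Q1 P(3) by simp
  qed
  obtain p where p: "p \<in> tips K" by (auto simp: tips_def)
  obtain p' where p': "p' \<in> tips K'" by (auto simp: tips_def)
  obtain q where q: "H (K ! 1) q" "mset K = {#p, K ! 1, q#}" using triple_end[OF k(3,2) p] by metis
  obtain q' where q': "H (K' ! 1) q'" "mset K' = {#p', K' ! 1, q'#}" using triple_end[OF k(6,5) p'] by metis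
  show False
    using minimal_replace(1)[of "{#P, P', K, K'#}" C0 "{#[a, p], [b, b'], [a', p'], [K ! 1, q], [K' ! 1, q']#}"]
      C(1) C0 ab ab' p p' q q' \<open>H b b'\<close> k len by (auto simp: add_mset_commute)
qed

lemma cover_sets:
  assumes "cover C"
  shows "(\<Union>K\<in>set_mset C. set K) = V"
    and "K \<in># C \<Longrightarrow> K' \<in># C \<Longrightarrow> K \<noteq> K' \<Longrightarrow> set K \<inter> set K' = {}"
    and "K \<in># C \<Longrightarrow> distinct K"
proof -
  have "set_mset (\<Sum>K\<in>#C. mset K) = (\<Union>K\<in>set_mset C. set K)" by (induction C) auto
  moreover have "set_mset (\<Sum>K\<in>#C. mset K) = V" using assms finite_V unfolding cover_def by simp
  ultimately show "(\<Union>K\<in>set_mset C. set K) = V" by simp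
  show "set K \<inter> set K' = {}" if "K \<in># C" "K' \<in># C" "K \<noteq> K'"
    using two_parts[OF that] cover_disjoint assms by metis
  show "distinct K" if "K \<in># C" using multi_member_split[OF that] cover_distinct assms by metis
qed

end

section \<open>Segments of properly coloured paths\<close>

context edge_coloured_multigraph
begin

definition joined :: "nat \<Rightarrow> 'v \<Rightarrow> 'v \<Rightarrow> bool" where
  "joined i s t \<longleftrightarrow> (\<exists>e\<in>edges G. ends G e = {s, t} \<and> colour G e = i)"

lemma joined_sym: "joined i s t \<Longrightarrow> joined i t s"
  by (auto simp: joined_def insert_commute)

lemma joined_irrefl: "\<not> joined i s s"
  using no_loops by (fastforce simp: joined_def)

lemma joined_verts: "joined i s t \<Longrightarrow> s \<in> verts G \<and> t \<in> verts G"
  using ends_subset by (fastforce simp: joined_def)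

text \<open>A segment may be extended at its tips by edges with colours in \<open>D\<close>;
  the vertices in \<open>X\<close> are never extended, so nothing is required of a tip in \<open>X\<close>.\<close>

definition segment :: "nat set \<Rightarrow> 'v set \<Rightarrow> 'v list \<Rightarrow> bool" where
  "segment D X xs \<longleftrightarrow> (\<exists>es. proper_path G xs es \<and>
     (hd xs \<notin> X \<longrightarrow> es \<noteq> [] \<and> colour G (hd es) \<notin> D) \<and>
     (last xs \<notin> X \<longrightarrow> es \<noteq> [] \<and> colour G (last es) \<notin> D))"

definition link :: "nat set \<Rightarrow> 'v set \<Rightarrow> 'v \<Rightarrow> 'v \<Rightarrow> bool" where
  "link D X s t \<longleftrightarrow> s \<notin> X \<and> t \<notin> X \<and> (\<exists>i\<in>D. joined i s t)"

lemma link_sym: "link D X s t \<Longrightarrow> link D X t s"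
  using joined_sym by (auto simp: link_def)

lemma is_path_rev:
  assumes "is_path G xs es" shows "is_path G (rev xs) (rev es)"
proof -
  have "ends G (rev es ! i) = {rev xs ! i, rev xs ! (i + 1)}" if i: "i < length es" for i
  proof -
    let ?j = "length es - Suc i"
    have "rev es ! i = es ! ?j" "rev xs ! i = xs ! (?j + 1)" "rev xs ! (i + 1) = xs ! ?j"
      using assms i by (auto simp: is_path_def rev_nth Suc_diff_Suc)
    moreover have "ends G (es ! ?j) = {xs ! ?j, xs ! (?j + 1)}" using assms i by (auto simp: is_path_def)
    ultimately show ?thesis by auto
  qed
  then show ?thesis using assms by (auto simp: is_path_def)
qed

lemma segment_rev:
  assumes "segment D X xs" shows "segment D X (rev xs)"
proof -
  obtain es where es: "proper_path G xs es" "hd xs \<notin> X \<longrightarrow> es \<noteq> [] \<and> colour G (hd es) \<notin> D"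
      "last xs \<notin> X \<longrightarrow> es \<noteq> [] \<and> colour G (last es) \<notin> D"
    using assms by (auto simp: segment_def)
  have "xs \<noteq> []" using es by (auto simp: proper_path_def is_path_def)
  moreover have "successively (\<lambda>e f. colour G f \<noteq> colour G e) es"
    using es(1) unfolding proper_path_def by (auto elim: successively_mono)
  ultimately show ?thesis using es is_path_rev unfolding segment_def proper_path_def
    by (intro exI[of _ "rev es"]) (auto simp: hd_rev last_rev)
qed

lemma is_path_append:
  assumes xs: "is_path G xs es" and ys: "is_path G ys fs" and dis: "set xs \<inter> set ys = {}"
    and e: "e \<in> edges G" "ends G e = {last xs, hd ys}"
  shows "is_path G (xs @ ys) (es @ e # fs)"
proof -
  have len: "length xs = length es + 1" "length ys = length fs + 1" using xs ys by (auto simp: is_path_def)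
  then have "xs \<noteq> []" "ys \<noteq> []" by auto
  then have lh: "last xs = xs ! length es" "hd ys = ys ! 0" using len by (auto simp: last_conv_nth hd_conv_nth)
  have "ends G ((es @ e # fs) ! i) = {(xs @ ys) ! i, (xs @ ys) ! (i + 1)}"
    if i: "i < length (es @ e # fs)" for i
  proof -
    consider "i < length es" | "i = length es" | "i > length es" by linarith
    then show ?thesis
    proof cases
      case 1
      then show ?thesis using xs len by (auto simp: is_path_def nth_append)
    next
      case 2
      then show ?thesis using e lh len by (auto simp: nth_append)
    next
      case 3
      then obtain j where j: "i = length xs + j" using len by (metis Suc_eq_plus1 Suc_le_eq le_Suc_ex)
      then have "j < length fs" using i len by simp
      then show ?thesis using ys len j by (auto simp: is_path_def nth_append)
    qed
  qed
  then show ?thesis using xs ys dis e by (auto simp: is_path_def)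
qed

lemma proper_path_append:
  assumes xs: "proper_path G xs es" and ys: "proper_path G ys fs" and dis: "set xs \<inter> set ys = {}"
    and e: "e \<in> edges G" "ends G e = {last xs, hd ys}"
    and "es \<noteq> [] \<Longrightarrow> colour G (last es) \<noteq> colour G e" "fs \<noteq> [] \<Longrightarrow> colour G e \<noteq> colour G (hd fs)"
  shows "proper_path G (xs @ ys) (es @ e # fs)"
  using assms is_path_append[OF _ _ dis e]
  by (cases fs) (auto simp: proper_path_def successively_append_iff successively_Cons)

lemma segment_append:
  assumes xs: "segment D X xs" and ys: "segment D X ys" and dis: "set xs \<inter> set ys = {}"
    and l: "link D X (last xs) (hd ys)"
  shows "segment D X (xs @ ys)"
proof -
  obtain es where es: "proper_path G xs es" "hd xs \<notin> X \<longrightarrow> es \<noteq> [] \<and> colour G (hd es) \<notin> D"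
      "last xs \<notin> X \<longrightarrow> es \<noteq> [] \<and> colour G (last es) \<notin> D"
    using xs by (auto simp: segment_def)
  obtain fs where fs: "proper_path G ys fs" "hd ys \<notin> X \<longrightarrow> fs \<noteq> [] \<and> colour G (hd fs) \<notin> D"
      "last ys \<notin> X \<longrightarrow> fs \<noteq> [] \<and> colour G (last fs) \<notin> D"
    using ys by (auto simp: segment_def)
  obtain e where e: "e \<in> edges G" "ends G e = {last xs, hd ys}" "colour G e \<in> D"
    using l by (auto simp: link_def joined_def)
  have ne: "xs \<noteq> []" "ys \<noteq> []" using es fs by (auto simp: proper_path_def is_path_def)
  have nx: "es \<noteq> []" "colour G (last es) \<notin> D" "fs \<noteq> []" "colour G (hd fs) \<notin> D"
    using l es fs by (auto simp: link_def)
  have "colour G (last es) \<noteq> colour G e" "colour G e \<noteq> colour G (hd fs)" using nx e by metis+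
  then have "proper_path G (xs @ ys) (es @ e # fs)"
    using proper_path_append[OF es(1) fs(1) dis e(1,2)] by blast
  then show ?thesis unfolding segment_def
    by (rule exI[of _ "es @ e # fs", OF conjI]) (use ne nx es fs in auto)
qed

text \<open>The new first edge has a colour in \<open>D\<close>, so nothing may be linked to
  \<open>v\<close> afterwards; hence \<open>v\<close> has to be a dead tip, an element of
  \<open>X\<close>.\<close>

lemma segment_Cons:
  assumes ys: "segment D X ys" "hd ys \<notin> X" and v: "v \<in> X" "v \<notin> set ys"
    and l: "joined i v (hd ys)" "i \<in> D"
  shows "segment D X (v # ys)"
proof -
  obtain fs where fs: "proper_path G ys fs" "fs \<noteq> []" "colour G (hd fs) \<notin> D"
      "last ys \<notin> X \<longrightarrow> colour G (last fs) \<notin> D"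
    using ys by (auto simp: segment_def)
  obtain e where e: "e \<in> edges G" "ends G e = {v, hd ys}" "colour G e = i"
    using l by (auto simp: joined_def)
  have "proper_path G [v] []" using joined_verts[OF l(1)] by (auto simp: proper_path_def is_path_def)
  then have "proper_path G ([v] @ ys) ([] @ e # fs)"
    using v e fs l by (intro proper_path_append) auto
  moreover have "ys \<noteq> []" using fs by (auto simp: proper_path_def is_path_def)
  ultimately show ?thesis unfolding segment_def using fs v by (intro exI[of _ "e # fs"]) auto
qed

lemma segment_pair:
  assumes "joined i a b" "a \<notin> X \<or> b \<notin> X \<Longrightarrow> i \<notin> D"
  shows "segment D X [a, b]"
proof -
  obtain e where "e \<in> edges G" "ends G e = {a, b}" "colour G e = i" using assms by (auto simp: joined_def)
  then show ?thesis unfolding segment_def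
    by (intro exI[of _ "[e]"])
      (use assms joined_verts[OF assms(1)] joined_irrefl in \<open>auto simp: proper_path_def is_path_def\<close>)
qed

lemma segment_triple:
  assumes "joined i x y" "joined j y z" "i \<noteq> j" "x \<noteq> z" "x \<notin> X \<Longrightarrow> i \<notin> D" "z \<notin> X \<Longrightarrow> j \<notin> D"
  shows "segment D X [x, y, z]"
proof -
  obtain e f where "e \<in> edges G" "ends G e = {x, y}" "colour G e = i"
    "f \<in> edges G" "ends G f = {y, z}" "colour G f = j" using assms by (auto simp: joined_def)
  then show ?thesis unfolding segment_def
    by (intro exI[of _ "[e, f]"])
      (use assms joined_verts[OF assms(1)] joined_verts[OF assms(2)] joined_irrefl in
        \<open>auto simp: proper_path_def is_path_def less_Suc_eq\<close>)
qed

lemma segment_hamiltonian: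
  assumes "segment D X xs" "set xs = verts G"
  shows "\<exists>vs es. proper_hamiltonian_path G vs es"
  using assms by (auto simp: segment_def proper_hamiltonian_path_def)

section \<open>Families of segments as systems of ports\<close>

definition segments :: "nat set \<Rightarrow> 'v set \<Rightarrow> 'v list set \<Rightarrow> bool" where
  "segments D X S \<longleftrightarrow> finite S \<and> S \<noteq> {} \<and> (\<forall>K\<in>S. segment D X K \<and> hd K \<noteq> last K) \<and>
     (\<forall>K\<in>S. \<forall>K'\<in>S. K \<noteq> K' \<longrightarrow> set K \<inter> set K' = {}) \<and> (\<Union>K\<in>S. set K) = verts G"

definition ports :: "'v list set \<Rightarrow> 'v set" where "ports S = hd ` S \<union> last ` S"

definition far :: "('v \<Rightarrow> 'v \<Rightarrow> bool) \<Rightarrow> 'v list set \<Rightarrow> ('v \<times> 'v) set" where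
  "far L S = {(s, t). s \<in> ports S \<and> t \<in> ports S \<and> \<not> (\<exists>K\<in>S. s \<in> set K \<and> t \<in> set K) \<and> \<not> L s t}"

definition covers :: "nat set \<Rightarrow> 'v set \<Rightarrow> 'v \<Rightarrow> 'v \<Rightarrow> 'v set \<Rightarrow> bool" where
  "covers D X s t A \<longleftrightarrow> (\<exists>xs. segment D X xs \<and> xs \<noteq> [] \<and> hd xs = s \<and> last xs = t \<and> set xs = A)"

lemma joining: "joining (link D X) (covers D X)"
proof
  fix s t A assume "covers D X s t A"
  then obtain xs where "segment D X xs" "xs \<noteq> []" "hd xs = s" "last xs = t" "set xs = A"
    by (auto simp: covers_def)
  then show "covers D X t s A" unfolding covers_def
    by (intro exI[of _ "rev xs"]) (auto simp: hd_rev last_rev segment_rev)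
next
  fix a y A x b A' assume *: "covers D X a y A" "covers D X x b A'" "link D X y x" "A \<inter> A' = {}"
  then obtain xs ys where "segment D X xs" "xs \<noteq> []" "hd xs = a" "last xs = y" "set xs = A"
    "segment D X ys" "ys \<noteq> []" "hd ys = x" "last ys = b" "set ys = A'"
    by (auto simp: covers_def)
  with * show "covers D X a b (A \<union> A')" unfolding covers_def
    by (intro exI[of _ "xs @ ys"]) (auto simp: segment_append)
qed (rule link_sym)

text \<open>Disjointness makes the segment of a port unique, so mates and vertex sets can be read
  off from it; distinct tips give exactly two ports for each segment.\<close>

lemma segments_system:
  assumes S: "segments D X S"
  obtains m W where "joining.system (covers D X) (ports S) m W" "(\<Union>s\<in>ports S. W s) = verts G"
    "nonlinks L (ports S) m = far L S" "card (ports S) = 2 * card S"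
    "\<And>K. K \<in> S \<Longrightarrow> m (hd K) = last K \<and> m (last K) = hd K"
proof -
  note j = joining[of D X]
  define comp where "comp s = (THE K. K \<in> S \<and> s \<in> set K)" for s
  define m where "m s = (if s = hd (comp s) then last (comp s) else hd (comp s))" for s
  define W where "W s = set (comp s)" for s
  have dis: "K = K'" if "K \<in> S" "K' \<in> S" "s \<in> set K" "s \<in> set K'" for K K' s
    using S that unfolding segments_def by blast
  have ne: "K \<noteq> []" "hd K \<noteq> last K" "segment D X K" if "K \<in> S" for K
    using S that by (auto simp: segments_def segment_def proper_path_def is_path_def)
  have comp: "comp s = K" if "K \<in> S" "s \<in> set K" for s K
    unfolding comp_def using that dis by (intro the_equality) auto
  have hl: "hd K \<in> set K" "last K \<in> set K" if "K \<in> S" for K using ne[OF that] by auto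
  have m: "m (hd K) = last K" "m (last K) = hd K" "W (hd K) = set K" "W (last K) = set K" if "K \<in> S" for K
    using comp[OF that] hl[OF that] ne[OF that] by (auto simp: m_def W_def)
  have port: "\<exists>K\<in>S. s = hd K \<or> s = last K" if "s \<in> ports S" for s
    using that by (auto simp: ports_def)
  have inports: "hd K \<in> ports S" "last K \<in> ports S" if "K \<in> S" for K using that by (auto simp: ports_def)
  have cov: "covers D X (hd K) (last K) (set K)" "covers D X (last K) (hd K) (set K)" if "K \<in> S" for K
  proof -
    show "covers D X (hd K) (last K) (set K)" using ne[OF that] by (auto simp: covers_def)
    then show "covers D X (last K) (hd K) (set K)" using joining.Q_sym[OF j] by blast
  qed
  have sys: "joining.system (covers D X) (ports S) m W"
    unfolding joining.system_def[OF j]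
  proof (intro conjI ballI impI)
    show "finite (ports S)" using S by (auto simp: ports_def segments_def)
  next
    fix s assume "s \<in> ports S"
    then obtain K where K: "K \<in> S" "s = hd K \<or> s = last K" using port by blast
    then show "m s \<in> ports S" "m s \<noteq> s" "m (m s) = s" "covers D X s (m s) (W s)" "W (m s) = W s"
      using m[OF K(1)] inports[OF K(1)] ne[OF K(1)] cov[OF K(1)] by auto
  next
    fix s t assume "s \<in> ports S" "t \<in> ports S" and n: "t \<noteq> s" "t \<noteq> m s"
    then obtain K K' where K: "K \<in> S" "s = hd K \<or> s = last K" "K' \<in> S" "t = hd K' \<or> t = last K'"
      using port by metis
    then have "K \<noteq> K'" using n m by metis
    then have "set K \<inter> set K' = {}" using S K unfolding segments_def by blast
    then show "W s \<inter> W t = {}" using m K by auto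
  qed
  have U: "(\<Union>s\<in>ports S. W s) = verts G"
  proof -
    have "(\<Union>s\<in>ports S. W s) = (\<Union>K\<in>S. set K)"
      using m unfolding ports_def by auto
    then show ?thesis using S by (simp add: segments_def)
  qed
  have "(\<exists>K\<in>S. s \<in> set K \<and> t \<in> set K) \<longleftrightarrow> s = t \<or> t = m s" if st: "s \<in> ports S" "t \<in> ports S" for s t
  proof -
    obtain K K' where K: "K \<in> S" "s = hd K \<or> s = last K" "K' \<in> S" "t = hd K' \<or> t = last K'"
      using port st by metis
    show ?thesis
    proof
      assume "\<exists>K\<in>S. s \<in> set K \<and> t \<in> set K"
      then have "K = K'" using K dis hl by metis
      then show "s = t \<or> t = m s" using K m by metis
    next
      assume "s = t \<or> t = m s"
      then show "\<exists>K\<in>S. s \<in> set K \<and> t \<in> set K" using K m hl by metis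
    qed
  qed
  then have nl: "nonlinks L (ports S) m = far L S" unfolding nonlinks_def far_def by blast
  have "inj_on hd S" "inj_on last S" using dis hl by (metis inj_onI)+
  moreover have "hd ` S \<inter> last ` S = {}"
  proof (rule ccontr)
    assume "\<not> ?thesis"
    then obtain K K' where "K \<in> S" "K' \<in> S" "hd K = last K'" by auto
    then show False using dis hl ne by metis
  qed
  ultimately have "card (ports S) = 2 * card S"
    using S unfolding ports_def segments_def by (subst card_Un_disjoint) (auto simp: card_image)
  then show thesis using that[OF sys U nl] m by blast
qed

text \<open>The factor 8 is the 4 of \<open>chain_exists\<close> with two ports for each
  segment.\<close>

theorem link_segments:
  assumes S: "segments D X S" and "card (far (link D X) S) + 10 \<le> 8 * card S"
  shows "\<exists>vs es. proper_hamiltonian_path G vs es"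
proof -
  obtain m W where s: "joining.system (covers D X) (ports S) m W" "(\<Union>s\<in>ports S. W s) = verts G"
    "nonlinks (link D X) (ports S) m = far (link D X) S" "card (ports S) = 2 * card S"
    by (rule segments_system[OF S])
  have "ports S \<noteq> {}" using S by (auto simp: segments_def ports_def)
  then obtain a b where "covers D X a b (\<Union>s\<in>ports S. W s)"
    using joining.chain_exists[OF joining s(1)] s assms by auto
  then show ?thesis using s(2) segment_hamiltonian by (auto simp: covers_def)
qed

theorem link_segments_no_isolated:
  assumes S: "segments D X S" and "card S \<ge> 5" and "card (far (link D X) S) + 8 \<le> 8 * card S"
    and no: "\<And>K. K \<in> S \<Longrightarrow> \<exists>s\<in>{hd K, last K}. \<exists>t\<in>ports S. t \<notin> {hd K, last K} \<and> link D X s t"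
  shows "\<exists>vs es. proper_hamiltonian_path G vs es"
proof -
  note j = joining[of D X]
  obtain m W where s: "joining.system (covers D X) (ports S) m W" "(\<Union>s\<in>ports S. W s) = verts G"
    "nonlinks (link D X) (ports S) m = far (link D X) S" "card (ports S) = 2 * card S"
    and m: "\<And>K. K \<in> S \<Longrightarrow> m (hd K) = last K \<and> m (last K) = hd K"
    using segments_system[OF S] by metis
  have "\<not> joining.isolated (link D X) (ports S) m (m y)"
    if y: "y \<in> ports S" "joining.isolated (link D X) (ports S) m y" for y
  proof
    assume i: "joining.isolated (link D X) (ports S) m (m y)"
    obtain K where K: "K \<in> S" "y = hd K \<or> y = last K" using y by (auto simp: ports_def)
    have my: "{y, m y} = {hd K, last K}" "m (m y) = y" using K m by auto
    obtain s t where st: "s \<in> {y, m y}" "t \<in> ports S" "t \<notin> {y, m y}" "link D X s t"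
      using no[OF K(1)] my by auto
    have "m y \<in> ports S" using K m by (auto simp: ports_def)
    then have "joining.adj (link D X) (ports S) m s t"
      unfolding joining.adj_def[OF j] using st y(1) my(2) by auto
    then show False using st(1) y(2) i unfolding joining.isolated_def[OF j] by blast
  qed
  then obtain a b where "covers D X a b (\<Union>s\<in>ports S. W s)"
    using joining.chain_exists_no_isolated_node[OF j s(1)] s assms(2,3) by auto
  then show ?thesis using s(2) segment_hamiltonian by (auto simp: covers_def)
qed

lemma segments_card_ports: "segments D X S \<Longrightarrow> card (ports S) = 2 * card S"
  using segments_system by metis

lemma finite_ports: "segments D X S \<Longrightarrow> finite (ports S)"
  by (auto simp: ports_def segments_def)

lemma ports_insert: "ports (insert K S) = {hd K, last K} \<union> ports S"
  by (auto simp: ports_def)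

lemma ports_in_segment:
  assumes "segments D X S" "v \<in> ports S"
  shows "v \<in> verts G" "\<exists>K\<in>S. v \<in> set K"
proof -
  obtain K where K: "K \<in> S" "v = hd K \<or> v = last K" using assms unfolding ports_def by blast
  then have "K \<noteq> []" using assms(1) by (auto simp: segments_def segment_def proper_path_def is_path_def)
  then have "v \<in> set K" using K by auto
  then show "v \<in> verts G" "\<exists>K\<in>S. v \<in> set K" using K assms(1) by (auto simp: segments_def)
qed

text \<open>The two ends of \<open>K\<close> miss all \<open>2 * card S - 2\<close> other ports,
  which makes \<open>8 * card S - 8\<close> ordered pairs. This exhausts \<open>N\<close>, so every
  pair outside this explicit set is adjacent: the exceptional case becomes fully known.\<close>

lemma isolated_segment:
  assumes S: "segments D X S" and K: "K \<in> S"
    and no: "\<not> (\<exists>s\<in>{hd K, last K}. \<exists>t\<in>ports S. t \<notin> {hd K, last K} \<and> link D X s t)"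
    and N: "far (link D X) S \<subseteq> N" "finite N" "card N + 8 \<le> 8 * card S"
  shows "N = {hd K, last K} \<times> (ports S - {hd K, last K}) \<union> (ports S - {hd K, last K}) \<times> {hd K, last K}"
proof -
  let ?T = "{hd K, last K}"
  let ?A = "?T \<times> (ports S - ?T)" and ?B = "(ports S - ?T) \<times> ?T"
  have fin: "finite (ports S)" using finite_ports[OF S] .
  have T: "card ?T = 2" "?T \<subseteq> ports S" using S K by (auto simp: segments_def ports_def)
  have d: "card (ports S - ?T) = 2 * card S - 2"
    using T segments_card_ports[OF S] by (subst card_Diff_subset) auto
  have "card ?A = 2 * (2 * card S - 2)" "card ?B = 2 * (2 * card S - 2)"
    by (simp_all only: card_cartesian_product d T mult.commute)
  moreover have "card (?A \<union> ?B) = card ?A + card ?B" using fin by (intro card_Un_disjoint) auto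
  moreover have "card S > 0" using S K by (auto simp: segments_def card_gt_0_iff)
  ultimately have c: "card N \<le> card (?A \<union> ?B)" using N(3) by linarith
  have tip: "K' = K" if "K' \<in> S" "s \<in> set K'" "s \<in> ?T" for K' s
  proof -
    have "K \<noteq> []" using S K by (auto simp: segments_def segment_def proper_path_def is_path_def)
    then have "s \<in> set K" using that by auto
    then show ?thesis using S K that unfolding segments_def by blast
  qed
  have tip': "s \<in> ?T" if "s \<in> set K" "s \<in> ports S" for s
  proof -
    obtain K' where K': "K' \<in> S" "s = hd K' \<or> s = last K'" using \<open>s \<in> ports S\<close> by (auto simp: ports_def)
    have "K' \<noteq> []" using S K' by (auto simp: segments_def segment_def proper_path_def is_path_def)
    then have "s \<in> set K'" using K' by auto
    then have "K' = K" using S K K'(1) that unfolding segments_def by blast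
    then show ?thesis using K' by auto
  qed
  have "(s, t) \<in> far (link D X) S \<and> (t, s) \<in> far (link D X) S" if "s \<in> ?T" "t \<in> ports S - ?T" for s t
  proof -
    have "\<not> link D X s t" using no that by blast
    moreover have "\<not> (\<exists>K'\<in>S. s \<in> set K' \<and> t \<in> set K')" using tip tip' that by blast
    moreover have "s \<in> ports S" using T that by blast
    ultimately show ?thesis using that link_sym unfolding far_def by blast
  qed
  then have "?A \<union> ?B \<subseteq> N" using N(1) by blast
  then show ?thesis using card_seteq[OF N(2) _ c] by simp
qed

section \<open>Colour classes\<close>

lemma two_graphs_joined:
  assumes "\<And>s. s \<in> verts G \<Longrightarrow> \<exists>t. joined i s t" "\<And>s. s \<in> verts G \<Longrightarrow> \<exists>t. joined j s t"
  shows "two_graphs (verts G) (joined i) (joined j)"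
  using assms joined_verts joined_sym joined_irrefl finite_verts
  by unfold_locales (auto, (meson | blast)+)

lemma part_segment:
  assumes tg: "two_graphs (verts G) (joined i) (joined j)"
    and K: "two_graphs.part (joined i) (joined j) K" "distinct K" "length K \<noteq> 1"
    and "i \<notin> D" "j \<notin> D" "length K = 3 \<Longrightarrow> i \<noteq> j"
  shows "segment D X K" "hd K \<noteq> last K"
proof -
  interpret two_graphs "verts G" "joined i" "joined j" by fact
  consider a b where "K = [a, b]" "joined i a b \<or> joined j a b"
    | x y z where "K = [x, y, z]" "joined i x y" "joined j y z"
    using K unfolding part_def H_def by auto
  then show "segment D X K" "hd K \<noteq> last K"
    by (cases; use assms in \<open>auto intro: segment_pair segment_triple\<close>)+
qed

lemma cover_segments:
  assumes tg: "two_graphs (verts G) (joined i) (joined j)"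
    and C: "two_graphs.cover (verts G) (joined i) (joined j) C" "two_graphs.singles C = 0"
    and D: "i \<notin> D" "j \<notin> D" "two_graphs.triples C \<noteq> {} \<Longrightarrow> i \<noteq> j" and V: "verts G \<noteq> {}"
  shows "segments D X (set_mset C)" "card (set_mset C) = card (two_graphs.pairs C) + card (two_graphs.triples C)"
    "far (link D {}) (set_mset C) \<subseteq> nonadjacent (verts G) (\<lambda>s t. \<exists>d\<in>D. joined d s t)"
proof -
  interpret two_graphs "verts G" "joined i" "joined j" by fact
  note pt = pairs_triples[OF C]
  show "card (set_mset C) = card (pairs C) + card (triples C)"
    unfolding pt(1) using pt(2) by (simp add: card_Un_disjoint)
  have "segment D X K" "hd K \<noteq> last K" if K: "K \<in># C" for K
  proof -
    have "K \<in> pairs C \<or> K \<in> triples C" using K pt(1) by blast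
    then have 1: "length K \<noteq> 1" by (auto simp: pairs_def triples_def)
    have 2: "i \<noteq> j" if "length K = 3" using K that by (intro D(3)) (auto simp: triples_def)
    note part_segment[OF tg cover_part[OF C(1) K] cover_sets(3)[OF C(1) K] 1 D(1,2) 2]
    then show "segment D X K" "hd K \<noteq> last K" by simp_all
  qed
  moreover have "set_mset C \<noteq> {}" using cover_sets(1)[OF C(1)] V by auto
  ultimately show S: "segments D X (set_mset C)"
    using cover_sets[OF C(1)] by (simp add: segments_def)
  show "far (link D {}) (set_mset C) \<subseteq> nonadjacent (verts G) (\<lambda>s t. \<exists>d\<in>D. joined d s t)"
  proof -
    have hl: "hd K \<in> set K" "last K \<in> set K" if "K \<in># C" for K
      using cover_part[OF C(1) that] by (auto simp: part_def)
    then have "\<exists>K\<in>set_mset C. s \<in> set K" if "s \<in> ports (set_mset C)" for s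
      using that by (auto simp: ports_def)
    moreover from this have "ports (set_mset C) \<subseteq> verts G" using cover_sets(1)[OF C(1)] by blast
    ultimately show ?thesis by (fastforce simp: far_def nonadjacent_def link_def)
  qed
qed

text \<open>An edge yields two ordered pairs, and by \<open>parallel_colours\<close> different edges
  of the same colour yield different ones; the remaining summand is the diagonal.\<close>

lemma card_nonadjacent_joined:
  "card (nonadjacent (verts G) (joined i)) + 2 * card {e \<in> edges G. colour G e = i} + card (verts G)
    = card (verts G) * card (verts G)"
proof -
  let ?V = "verts G" and ?E = "{e \<in> edges G. colour G e = i}"
  let ?J = "{(s, t). joined i s t}" and ?D = "(\<lambda>s. (s, s)) ` ?V"
  have fin: "finite ?V" "finite ?E" using finite_verts finite_edges by auto
  have J: "?J = (\<Union>e\<in>?E. {(s, t). ends G e = {s, t}})" by (auto simp: joined_def)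
  have "card {(s, t). ends G e = {s, t}} = 2 \<and> finite {(s, t). ends G e = {s, t}}" if "e \<in> ?E" for e
  proof -
    have "card (ends G e) = 2" using no_loops that by auto
    then obtain a b where ab: "ends G e = {a, b}" "a \<noteq> b" by (meson card_2_iff)
    then have "{(s, t). ends G e = {s, t}} = {(a, b), (b, a)}" by (auto simp: doubleton_eq_iff)
    then show ?thesis using ab by simp
  qed
  then have "card ?J = 2 * card ?E"
    unfolding J using fin(2) parallel_colours by (subst card_UN_disjoint) auto
  have JV: "?J \<subseteq> ?V \<times> ?V" using joined_verts by auto
  have fJ: "finite ?J" using JV fin finite_subset by blast
  have "?V \<times> ?V = (nonadjacent ?V (joined i) \<union> ?J) \<union> ?D"
    using JV by (auto simp: nonadjacent_def)
  moreover have "(nonadjacent ?V (joined i) \<union> ?J) \<inter> ?D = {}" "nonadjacent ?V (joined i) \<inter> ?J = {}"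
    using joined_irrefl by (auto simp: nonadjacent_def)
  ultimately have "card (?V \<times> ?V) = card (nonadjacent ?V (joined i)) + card ?J + card ?D"
    using fin fJ by (simp add: card_Un_disjoint)
  moreover have "card ?D = card ?V" by (simp add: card_image inj_on_def)
  ultimately show ?thesis using \<open>card ?J = 2 * card ?E\<close> by (simp add: card_cartesian_product)
qed

text \<open>Only \<open>c\<close> colours exist, so a rainbow degree of at least \<open>c\<close>
  leaves none of them out.\<close>

lemma every_colour:
  assumes "min_rd G = c" "v \<in> verts G" "i \<in> {1..c}"
  shows "\<exists>t. joined i v t"
proof -
  let ?I = "colour G ` {e \<in> edges G. v \<in> ends G e}"
  have "min_rd G \<le> rd G v" unfolding min_rd_def using assms finite_verts by (intro Min_le) auto
  then have "c \<le> card ?I" using assms by (simp add: rd_def)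
  moreover have "?I \<subseteq> {1..c}" using colour_range by auto
  ultimately have "?I = {1..c}" by (intro card_seteq) auto
  then have "i \<in> ?I" using assms(3) by simp
  then obtain e where e: "e \<in> edges G" "v \<in> ends G e" "colour G e = i" by auto
  have "card (ends G e) = 2" using no_loops e by auto
  then obtain a b where "ends G e = {a, b}" by (meson card_2_iff)
  then have "\<exists>t. ends G e = {v, t}" using e(2) by auto
  then show ?thesis using e by (auto simp: joined_def)
qed

end

section \<open>Selecting three large colour classes\<close>

lemma ex_maximum:
  fixes f :: "'a \<Rightarrow> nat"
  assumes "finite A" "A \<noteq> {}"
  obtains x where "x \<in> A" "\<And>y. y \<in> A \<Longrightarrow> f y \<le> f x"
  using Max_in[of "f ` A"] Max_ge[of "f ` A"] assms by (metis (no_types, lifting) finite_imageI imageE image_eqI image_is_empty)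

text \<open>If the three largest values add up to at most \<open>3 * A\<close>, the least of them is
  at most \<open>A\<close>, hence so are all the others, and the whole sum is at most
  \<open>card I * A\<close>.\<close>

lemma top_three:
  fixes f :: "'a \<Rightarrow> nat"
  assumes I: "finite I" "card I \<ge> 3" and s: "card I * A + 1 \<le> (\<Sum>i\<in>I. f i)"
  obtains r b g where "r \<in> I" "b \<in> I" "g \<in> I" "r \<noteq> b" "r \<noteq> g" "b \<noteq> g"
    "f b \<le> f r" "f g \<le> f r" "3 * A + 1 \<le> f r + f b + f g"
proof -
  have "I \<noteq> {}" using I by auto
  then obtain r where r: "r \<in> I" "\<And>y. y \<in> I \<Longrightarrow> f y \<le> f r" using ex_maximum I(1) by metis
  have c1: "card (I - {r}) = card I - 1" using r I by simp
  then have "I - {r} \<noteq> {}" using I by (metis card.empty diff_is_0_eq not_numeral_le_zero numeral_le_one_iff order.trans semiring_norm(70))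
  then obtain b where b: "b \<in> I - {r}" "\<And>y. y \<in> I - {r} \<Longrightarrow> f y \<le> f b" using ex_maximum[of "I - {r}" f] I(1) by auto
  let ?J = "I - {r} - {b}"
  have c2: "card ?J = card I - 2" using b c1 I by simp
  then have "?J \<noteq> {}" using I(2) by (metis card.empty diff_is_0_eq not_less_eq_eq numeral_2_eq_2 numeral_3_eq_3)
  then obtain g where g: "g \<in> ?J" "\<And>y. y \<in> ?J \<Longrightarrow> f y \<le> f g" using ex_maximum[of ?J f] I(1) by auto
  have c3: "card (?J - {g}) + 3 = card I" using g c2 I by simp
  have sum: "(\<Sum>i\<in>I. f i) = f r + (f b + (f g + (\<Sum>i\<in>?J - {g}. f i)))"
    using r b g I(1) by (simp add: sum.remove)
  have "3 * A + 1 \<le> f r + f b + f g"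
  proof (rule ccontr)
    assume neg: "\<not> ?thesis"
    have "f g \<le> f b" "f g \<le> f r" using g b(2) r(2) by auto
    then have "f g \<le> A" using neg by linarith
    then have "(\<Sum>i\<in>?J - {g}. f i) \<le> card (?J - {g}) * A"
      using g(2) sum_bounded_above[of "?J - {g}" f A] order_trans by fastforce
    then have "(\<Sum>i\<in>I. f i) \<le> 3 * A + card (?J - {g}) * A" using sum neg by linarith
    also have "\<dots> = card I * A" using c3 by (metis add.commute distrib_right)
    finally show False using s by linarith
  qed
  then show thesis using that[of r b g] r b g by auto
qed

section \<open>The three largest colour classes\<close>

locale three_colours = edge_coloured_multigraph c G
  for c :: nat and G :: "('v, 'e) coloured_multigraph" +
  fixes r b g :: nat
  assumes colours: "r \<noteq> b" "r \<noteq> g" "b \<noteq> g"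
    and nbr: "s \<in> verts G \<Longrightarrow> \<exists>t. joined r s t" "s \<in> verts G \<Longrightarrow> \<exists>t. joined b s t"
      "s \<in> verts G \<Longrightarrow> \<exists>t. joined g s t"
    and card_verts: "11 \<le> card (verts G)"
    and total: "card (nonadjacent (verts G) (joined r)) + card (nonadjacent (verts G) (joined b))
      + card (nonadjacent (verts G) (joined g)) + 32 \<le> 12 * card (verts G)"
    and best: "card (nonadjacent (verts G) (joined r)) \<le> card (nonadjacent (verts G) (joined b))"
      "card (nonadjacent (verts G) (joined r)) \<le> card (nonadjacent (verts G) (joined g))"
begin

sublocale bg: two_graphs "verts G" "joined b" "joined g"
  using two_graphs_joined nbr by blast

sublocale rr: two_graphs "verts G" "joined r" "joined r"
  using two_graphs_joined nbr by blast

abbreviation V :: "'v set" where "V \<equiv> verts G"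
abbreviation mr :: nat where "mr \<equiv> card (nonadjacent V (joined r))"
abbreviation h :: nat where "h \<equiv> card (nonadjacent V bg.H)"

lemma V_ne: "V \<noteq> {}" using card_verts by auto

lemma even_mr: "even mr"
proof -
  have "mr + 2 * card {e \<in> edges G. colour G e = r} + card V = card V * card V"
    by (rule card_nonadjacent_joined)
  from arg_cong[OF this, of even] show ?thesis by (cases "even (card V)") simp_all
qed

text \<open>A third of the total allows \<open>mr\<close> up to \<open>4n - 11\<close>; parity
  lowers this to \<open>4n - 12\<close>.\<close>

lemma mr_le: "mr + 12 \<le> 4 * card V"
proof -
  obtain k where k: "mr = 2 * k" using even_mr by (auto elim: evenE)
  then have "3 * k + 16 \<le> 6 * card V" using total best by linarith
  then have "k + 6 \<le> 2 * card V" by linarith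
  then show ?thesis using k by linarith
qed

text \<open>A pair missing in \<open>bg.H\<close> is missing in both colours and counts
  twice.\<close>

lemma mr_h: "mr + 2 * h + 32 \<le> 12 * card V"
proof -
  have "h \<le> card (nonadjacent V (joined b))" "h \<le> card (nonadjacent V (joined g))"
    by (rule card_mono, simp add: bg.finite_V, force simp: nonadjacent_def bg.H_def)+
  then show ?thesis using total by linarith
qed

text \<open>The cover bounds, applied to \<open>r\<close> in both roles, contradict
  \<open>mr \<le> 4n - 12\<close> unless only edges occur. Evenness rules out exactly one triple.
  For two triples \<open>triples_bound\<close> gives \<open>8 * p + 12\<close>, which equals
  \<open>4n - 12\<close>, so \<open>two_triples_bound\<close> is essential.\<close>

lemma red_perfect_matching:
  assumes "even (card V)"
  obtains C where "rr.cover C" "rr.singles C = 0" "rr.triples C = {}" "2 * card (rr.pairs C) = card V"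
proof -
  obtain C where C: "rr.minimal C" using rr.ex_minimal by blast
  have s0: "rr.singles C = 0"
  proof (rule ccontr)
    assume "rr.singles C \<noteq> 0"
    then have "12 * card V \<le> mr + mr + 36" using rr.exposed_bound(1)[OF C refl] card_verts by simp
    then show False using mr_le card_verts by linarith
  qed
  define p t where "p = card (rr.pairs C)" and "t = card (rr.triples C)"
  have n: "card V = 2 * p + 3 * t" using rr.pairs_triples(3)[OF rr.minimal_cover[OF C] s0] by (simp add: p_def t_def)
  have H: "rr.H = joined r" by (intro ext) (simp add: rr.H_def)
  have "t = 0"
  proof (rule ccontr)
    assume "t \<noteq> 0"
    moreover have "t \<noteq> 1" using assms n by auto
    ultimately have t2: "t \<ge> 2" by linarith
    have tb: "4 * t * t + 4 * t * p \<le> mr + 2 * t"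
      using rr.triples_bound[OF C s0] t2 by (simp add: H p_def t_def)
    consider "t = 2" | "t = 3" | "t \<ge> 4" using t2 by linarith
    then show False
    proof cases
      case 1
      then have "8 * p + 14 \<le> mr" using rr.two_triples_bound[OF C s0] n card_verts by (simp add: H p_def t_def)
      then show False using mr_le n 1 by linarith
    next
      case 2
      then show False using tb mr_le n by simp
    next
      case 3
      then have "16 * t \<le> 4 * t * t" "16 * p \<le> 4 * t * p" by simp_all
      then show False using tb mr_le n 3 by linarith
    qed
  qed
  then show thesis using that[OF rr.minimal_cover[OF C] s0] n by (simp add: t_def p_def)
qed

section \<open>Cases by the numbers of single vertices and triples\<close>

lemma link_red:
  assumes C: "bg.minimal C" "bg.singles C = 0"
    and m: "mr + 10 \<le> 8 * (card (bg.pairs C) + card (bg.triples C))"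
  shows "\<exists>vs es. proper_hamiltonian_path G vs es"
proof -
  note s = cover_segments[OF bg.two_graphs_axioms bg.minimal_cover[OF C(1)] C(2), of "{r}"]
  have S: "segments {r} {} (set_mset C)" using s(1) colours V_ne by blast
  have "far (link {r} {}) (set_mset C) \<subseteq> nonadjacent V (joined r)" using s(3) colours V_ne by simp
  then have "card (far (link {r} {}) (set_mset C)) \<le> mr" using bg.finite_V by (intro card_mono) auto
  moreover have "card (set_mset C) = card (bg.pairs C) + card (bg.triples C)"
    using s(2) colours V_ne by simp
  ultimately show ?thesis using link_segments[OF S] m by simp
qed

text \<open>\<open>exposed_bound\<close> leaves one single vertex \<open>u\<close> and at most four
  ordered pairs missing in \<open>r\<close>. Some \<open>r\<close>-edge hangs \<open>u\<close> on
  another part, and the nonlinks of this dead tip still fit the bound for at least four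
  segments.\<close>

lemma one_single:
  assumes C: "bg.minimal C" "bg.singles C \<noteq> 0"
  shows "\<exists>vs es. proper_hamiltonian_path G vs es"
proof -
  have k1: "bg.singles C = 1" and mr4: "mr \<le> 4"
    using bg.exposed_bound[OF C(1) refl _ card_verts] C(2) total by linarith+
  have cov: "bg.cover C" using bg.minimal_cover[OF C(1)] .
  have "{#K \<in># C. length K = 1#} \<noteq> {#}" using k1 unfolding bg.singles_def by (metis size_empty zero_neq_one)
  then obtain K1 where "K1 \<in># {#K \<in># C. length K = 1#}" by (meson multiset_nonemptyE)
  then obtain u where u: "[u] \<in># C" by (auto simp: length_Suc_conv)
  then obtain C0 where C0: "C = add_mset [u] C0" using multi_member_split by metis
  then have "bg.singles C0 = 0" using k1 by simp
  then have "{#K \<in># C0. length K = 1#} = {#}" by (simp add: bg.singles_def)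
  then have l1: "length K \<noteq> 1" if "K \<in># C0" for K
    using that by (metis (mono_tags, lifting) filter_mset_eq_conv in_diff_count mem_Collect_eq set_mset_empty empty_iff set_mset_filter)
  let ?S = "set_mset C0"
  have ne: "K \<noteq> [u]" if "K \<in> ?S" for K using l1[OF that] by auto
  have uV: "u \<in> V" using bg.cover_subset[OF cov u] by simp
  have seg: "segment {r} X K" "hd K \<noteq> last K" "set K \<subseteq> V" "u \<notin> set K" "K \<noteq> []" "length K \<le> 3" if K: "K \<in> ?S" for K X
  proof -
    have KC: "K \<in># C" using K C0 by simp
    show "segment {r} X K" "hd K \<noteq> last K"
      using part_segment[OF bg.two_graphs_axioms bg.cover_part[OF cov KC] bg.cover_sets(3)[OF cov KC] l1[OF K],
          where D = "{r}"] colours by simp_all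
    show "set K \<subseteq> V" using bg.cover_subset[OF cov KC] .
    show "u \<notin> set K" using bg.cover_sets(2)[OF cov u KC] ne[OF K] by auto
    show "K \<noteq> []" "length K \<le> 3" using bg.cover_part[OF cov KC] by (auto simp: bg.part_def)
  qed
  have dis: "set K \<inter> set K' = {}" if "K \<in> ?S" "K' \<in> ?S" "K \<noteq> K'" for K K'
    using bg.cover_sets(2)[OF cov _ _ that(3)] that C0 by simp
  have U: "V = insert u (\<Union>K\<in>?S. set K)" using bg.cover_sets(1)[OF cov] C0 by simp
  define j where "j = card ?S"
  have "card V \<le> 1 + card (\<Union>K\<in>?S. set K)" using U by (simp add: card_insert_if)
  also have "card (\<Union>K\<in>?S. set K) \<le> (\<Sum>K\<in>?S. card (set K))" by (rule card_UN_le) simp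
  also have "\<dots> \<le> (\<Sum>K\<in>?S. 3)" by (intro sum_mono order_trans[OF card_length seg(6)])
  finally have j4: "j \<ge> 4" using card_verts by (simp add: j_def)
  have hd_inj: "inj_on hd ?S" using dis seg(5) by (intro inj_onI) (metis disjoint_iff hd_in_set)
  \<comment> \<open>Otherwise \<open>u\<close> misses the first vertex of every part:
    \<open>2 * j\<close>, at least 8, ordered pairs.\<close>
  have "\<exists>K\<in>?S. joined r u (hd K)"
  proof (rule ccontr)
    assume no: "\<not> ?thesis"
    have "Pair u ` hd ` ?S \<union> (\<lambda>v. (v, u)) ` hd ` ?S \<subseteq> nonadjacent V (joined r)"
    proof -
      have "hd K \<in> V \<and> hd K \<noteq> u \<and> \<not> joined r u (hd K) \<and> \<not> joined r (hd K) u" if K: "K \<in> ?S" for K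
      proof -
        have "hd K \<in> set K" using seg(5)[OF K] by simp
        then show ?thesis using K seg(3,4)[OF K] no joined_sym by blast
      qed
      then show ?thesis using uV by (auto simp: nonadjacent_def)
    qed
    then have "card (Pair u ` hd ` ?S \<union> (\<lambda>v. (v, u)) ` hd ` ?S) \<le> mr"
      using bg.finite_V by (intro card_mono) auto
    moreover have "card (Pair u ` hd ` ?S \<union> (\<lambda>v. (v, u)) ` hd ` ?S) = j + j"
    proof -
      have "u \<notin> hd ` ?S" using seg(4,5) by (metis hd_in_set imageE)
      then have "Pair u ` hd ` ?S \<inter> (\<lambda>v. (v, u)) ` hd ` ?S = {}" by auto
      then show ?thesis using hd_inj by (simp add: card_Un_disjoint card_image inj_on_def j_def)
    qed
    ultimately show False using mr4 j4 by linarith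
  qed
  then obtain K0 where K0: "K0 \<in> ?S" "joined r u (hd K0)" by blast
  let ?T = "insert (u # K0) (?S - {K0})"
  have uK0: "u # K0 \<notin> ?S" using seg(4) by fastforce
  have segs: "segments {r} {u} ?T"
    unfolding segments_def
  proof (intro conjI ballI impI)
    fix K assume K: "K \<in> ?T"
    have "segment {r} {u} (u # K0)"
      using seg(1,4,5)[OF K0(1)] K0(2) hd_in_set by (intro segment_Cons[where i = r]) fastforce+
    moreover have "u \<noteq> last K0" using seg(4,5)[OF K0(1)] by (metis last_in_set)
    ultimately show "segment {r} {u} K" "hd K \<noteq> last K"
      using K seg(1,2,5) K0(1) by auto
  next
    fix K K' assume "K \<in> ?T" "K' \<in> ?T" "K \<noteq> K'"
    then show "set K \<inter> set K' = {}" using dis seg(4) K0(1) by fastforce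
  next
    show "(\<Union>K\<in>?T. set K) = V" using U K0(1) by auto
  qed auto
  have cT: "card ?T = j" using K0(1) uK0 j4 by (simp add: j_def card_insert_if card_Diff_singleton)
  let ?P = "ports ?T - {u, last K0}"
  have lu: "last K0 \<noteq> u" using seg(4,5)[OF K0(1)] by (metis last_in_set)
  have up: "{u, last K0} \<subseteq> ports ?T" using seg(5)[OF K0(1)] by (auto simp: ports_def)
  have cP: "card ?P = 2 * j - 2"
    using up lu segments_card_ports[OF segs] cT by (subst card_Diff_subset) auto
  have fP: "finite ?P" using finite_ports[OF segs] by simp
  have "far (link {r} {u}) ?T \<subseteq> nonadjacent V (joined r) \<union> (Pair u ` ?P \<union> (\<lambda>v. (v, u)) ` ?P)"
  proof
    fix e assume e: "e \<in> far (link {r} {u}) ?T"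
    obtain s t where st: "e = (s, t)" by (cases e)
    have f: "s \<in> ports ?T" "t \<in> ports ?T" "\<not> (\<exists>K\<in>?T. s \<in> set K \<and> t \<in> set K)" "\<not> link {r} {u} s t"
      using e st by (auto simp: far_def)
    have pV: "v \<in> V \<and> (\<exists>K\<in>?T. v \<in> set K)" if v: "v \<in> ports ?T" for v
    proof -
      obtain K where "K \<in> ?T" "v = hd K \<or> v = last K" using v unfolding ports_def by blast
      moreover have "K \<noteq> []" using \<open>K \<in> ?T\<close> seg(5) by auto
      ultimately have "K \<in> ?T" "v \<in> set K" by auto
      then show ?thesis using U K0(1) by auto
    qed
    have "s \<noteq> t" using f(3) pV[OF f(1)] by blast
    have nuk: "\<not> (s \<in> {u, last K0} \<and> t \<in> {u, last K0})" using f(3) seg(5)[OF K0(1)] by auto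
    show "e \<in> nonadjacent V (joined r) \<union> (Pair u ` ?P \<union> (\<lambda>v. (v, u)) ` ?P)"
    proof (cases "s = u \<or> t = u")
      case True
      then show ?thesis using st f(1,2) nuk by auto
    next
      case False
      then show ?thesis using st f(4) pV f(1,2) \<open>s \<noteq> t\<close> by (auto simp: link_def nonadjacent_def)
    qed
  qed
  then have "card (far (link {r} {u}) ?T) \<le> card (nonadjacent V (joined r) \<union> (Pair u ` ?P \<union> (\<lambda>v. (v, u)) ` ?P))"
    using bg.finite_V fP by (intro card_mono) auto
  also have "\<dots> \<le> mr + (card ?P + card ?P)"
    using fP by (intro order_trans[OF card_Un_le] add_mono order.refl card_image_le)
  finally have "card (far (link {r} {u}) ?T) + 10 \<le> 8 * card ?T" using mr4 cP cT j4 by linarith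
  then show ?thesis using link_segments[OF segs] by blast
qed

text \<open>Here \<open>mr_le\<close> gives \<open>mr \<le> 8 * p\<close>, exactly the sharper bound
  for \<open>p + 1\<close> segments. Only a segment with both tips isolated needs a
  rearrangement.\<close>

lemma one_triple:
  assumes C: "bg.minimal C" "bg.singles C = 0" and t1: "card (bg.triples C) = 1"
  shows "\<exists>vs es. proper_hamiltonian_path G vs es"
proof -
  let ?S = "set_mset C" and ?N = "nonadjacent V (joined r)"
  have cov: "bg.cover C" using bg.minimal_cover[OF C(1)] .
  note cs = cover_segments[OF bg.two_graphs_axioms cov C(2), of "{r}"]
  have S: "segments {r} X ?S" for X using cs(1) colours V_ne by blast
  define p where "p = card (bg.pairs C)"
  have n: "card V = 2 * p + 3" using bg.pairs_triples(3)[OF cov C(2)] t1 by (simp add: p_def)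
  have p4: "p \<ge> 4" using n card_verts by linarith
  have cS: "card ?S = p + 1" using cs(2) colours V_ne t1 by (simp add: p_def)
  have farN: "far (link {r} {}) ?S \<subseteq> ?N" using cs(3) colours V_ne by simp
  have N8: "card ?N + 8 \<le> 8 * card ?S" using mr_le n cS by simp
  have finN: "finite ?N" using bg.finite_V by simp
  show ?thesis
  proof (cases "\<forall>K\<in>?S. \<exists>s\<in>{hd K, last K}. \<exists>t\<in>ports ?S. t \<notin> {hd K, last K} \<and> link {r} {} s t")
    case True
    have "card (far (link {r} {}) ?S) + 8 \<le> 8 * card ?S"
      using N8 card_mono[OF finN farN] by linarith
    then show ?thesis using link_segments_no_isolated[OF S] True cS p4 by auto
  next
    case False
    then obtain K where K: "K \<in> ?S"
      and no: "\<not> (\<exists>s\<in>{hd K, last K}. \<exists>t\<in>ports ?S. t \<notin> {hd K, last K} \<and> link {r} {} s t)" by blast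
    \<comment> \<open>All pairs missing in colour \<open>r\<close> join a tip of \<open>K\<close> to another port, so \<open>r\<close> is known exactly.\<close>
    note N = isolated_segment[OF S K no farN finN N8]
    have red: "joined r s t" if "s \<in> V" "t \<in> V" "s \<noteq> t" "s \<notin> {hd K, last K} \<or> t \<notin> ports ?S \<or> t \<in> {hd K, last K}"
      "t \<notin> {hd K, last K} \<or> s \<notin> ports ?S \<or> s \<in> {hd K, last K}" for s t
    proof (rule ccontr)
      assume "\<not> joined r s t"
      then have "(s, t) \<in> ?N" using that by (simp add: nonadjacent_def)
      then show False unfolding N using that by auto
    qed
    obtain T where T: "bg.triples C = {T}" using t1 card_1_singletonE by blast
    then have TS: "T \<in> ?S" "length T = 3" by (auto simp: bg.triples_def)
    obtain x y z where xyz: "T = [x, y, z]" "joined b x y" "joined g y z"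
      using bg.cover_part[OF cov TS(1)] TS(2) by (auto simp: bg.part_def)
    have dT: "x \<noteq> y" "y \<noteq> z" "x \<noteq> z" using bg.cover_sets(3)[OF cov TS(1)] xyz by auto
    have inV: "x \<in> V" "y \<in> V" "z \<in> V" using joined_verts xyz by blast+
    have dis: "set A \<inter> set B = {}" if "A \<in> ?S" "B \<in> ?S" "A \<noteq> B" for A B
      using bg.cover_sets(2)[OF cov] that by blast
    have yport: "y \<notin> ports ?S"
    proof
      assume "y \<in> ports ?S"
      then obtain A where A: "A \<in> ?S" "y = hd A \<or> y = last A" unfolding ports_def by blast
      then have "A \<noteq> T" using xyz dT by auto
      then have "y \<notin> set A" using dis[OF A(1) TS(1)] xyz by auto
      moreover have "A \<noteq> []" using bg.cover_part[OF cov A(1)] by (auto simp: bg.part_def)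
      ultimately show False using A by auto
    qed
    have rest: "segment {r} X A" "hd A \<noteq> last A" if "A \<in> ?S" for A X
      using S[of X] that by (auto simp: segments_def)
    have U: "(\<Union>A\<in>?S. set A) = V" using bg.cover_sets(1)[OF cov] .
    show ?thesis
    proof (cases "K = T")
      case True
      \<comment> \<open>Both ends of the new \<open>r\<close>-edge are tips of \<open>K\<close>, so
        it exists. The poorly linked \<open>x\<close> becomes an inner vertex, \<open>y\<close>
        becomes a live tip joined in \<open>r\<close> to all vertices since it was no port, and only
        the dead tip \<open>z\<close> has nonlinks.\<close>
      let ?A = "[z, x, y]"
      let ?S' = "insert ?A (?S - {T})"
      have "joined r z x" using red[of z x] True xyz inV dT by simp
      then have A: "segment {r} {z} ?A" using xyz dT colours by (intro segment_triple[of r _ _ b]) auto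
      have sA: "set ?A = set T" using xyz by auto
      have S': "segments {r} {z} ?S'"
        unfolding segments_def
      proof (intro conjI ballI impI)
        fix D assume "D \<in> ?S'"
        then show "segment {r} {z} D" "hd D \<noteq> last D" using A rest[of D] dT by auto
      next
        fix D E assume DE: "D \<in> ?S'" "E \<in> ?S'" "D \<noteq> E"
        define D' E' where "D' = (if D = ?A then T else D)" and "E' = (if E = ?A then T else E)"
        have "D' \<in> ?S" "E' \<in> ?S" "set D' = set D" "set E' = set E" using DE TS(1) sA by (auto simp: D'_def E'_def)
        moreover have "D' \<noteq> E'" using DE by (auto simp: D'_def E'_def)
        ultimately show "set D \<inter> set E = {}" using dis by metis
      next
        have "(\<Union>D\<in>?S'. set D) = set T \<union> (\<Union>D\<in>?S - {T}. set D)" using sA by simp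
        also have "\<dots> = (\<Union>D\<in>?S. set D)" using TS(1) by blast
        finally show "(\<Union>D\<in>?S'. set D) = V" using U by simp
      qed auto
      have "?A \<notin> ?S - {T}" using dis[of ?A T] TS xyz by auto
      then have cS': "card ?S' = p + 1" using cS TS(1) by (simp add: card_insert_if card_Diff_singleton)
      let ?P = "ports ?S' - {z, y}"
      have fP: "finite ?P" using finite_ports[OF S'] by simp
      have xport: "x \<notin> ports ?S'"
      proof
        assume "x \<in> ports ?S'"
        then obtain B where B: "B \<in> ?S - {T}" "x = hd B \<or> x = last B" using dT unfolding ports_def by auto
        moreover have "B \<noteq> []" using bg.cover_part[OF cov, of B] B(1) by (auto simp: bg.part_def)
        ultimately have "x \<in> set B" by auto
        then show False using dis[of B T] B(1) TS xyz by auto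
      qed
      have "far (link {r} {z}) ?S' \<subseteq> Pair z ` ?P \<union> (\<lambda>v. (v, z)) ` ?P"
      proof
        fix e assume e: "e \<in> far (link {r} {z}) ?S'"
        obtain s t where st: "e = (s, t)" by (cases e)
        have f: "s \<in> ports ?S'" "t \<in> ports ?S'" "\<not> (\<exists>A\<in>?S'. s \<in> set A \<and> t \<in> set A)" "\<not> link {r} {z} s t"
          using e st by (auto simp: far_def)
        have "s \<in> V" "t \<in> V" "s \<noteq> t" using ports_in_segment[OF S'] f by blast+
        have nzy: "\<not> (s \<in> {z, y} \<and> t \<in> {z, y})" using f(3) by auto
        show "e \<in> Pair z ` ?P \<union> (\<lambda>v. (v, z)) ` ?P"
        proof (cases "s = z \<or> t = z")
          case True
          then show ?thesis using st f(1,2) nzy by auto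
        next
          case False
          then have "s \<notin> {x, z}" "t \<notin> {x, z}" using f(1,2) xport by auto
          then have "joined r s t" using red[of s t] \<open>K = T\<close> xyz \<open>s \<in> V\<close> \<open>t \<in> V\<close> \<open>s \<noteq> t\<close> by simp
          then show ?thesis using f(4) False by (auto simp: link_def)
        qed
      qed
      then have "card (far (link {r} {z}) ?S') \<le> card (Pair z ` ?P \<union> (\<lambda>v. (v, z)) ` ?P)"
        using fP by (intro card_mono) auto
      also have "\<dots> \<le> card ?P + card ?P"
        using fP by (intro order_trans[OF card_Un_le] add_mono card_image_le)
      also have "card ?P = 2 * p"
        using segments_card_ports[OF S'] cS' dT by (subst card_Diff_subset) (auto simp: ports_insert)
      finally have "card (far (link {r} {z}) ?S') + 10 \<le> 8 * card ?S'" using cS' p4 by linarith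
      then show ?thesis using link_segments[OF S'] by blast
    next
      case False
      then have "K \<in> bg.pairs C" using K bg.pairs_triples(1)[OF cov C(2)] T by auto
      then obtain k l where kl: "K = [k, l]" by (auto simp: bg.pairs_def length_Suc_conv numeral_2_eq_2)
      have "\<not> bg.pairs C \<subseteq> {K}" using p4 card_mono[of "{K}" "bg.pairs C"] by (auto simp: p_def)
      then obtain Q where Q: "Q \<in> bg.pairs C" "Q \<noteq> K" by blast
      then obtain s t where st: "Q = [s, t]" by (auto simp: bg.pairs_def length_Suc_conv numeral_2_eq_2)
      have QS: "Q \<in> ?S" "Q \<noteq> T" using Q TS by (auto simp: bg.pairs_def)
      have dKT: "k \<notin> {x, y, z}" "l \<notin> {x, y, z}" using dis[OF K TS(1) False] kl xyz by auto
      have dQT: "s \<notin> {x, y, z}" "t \<notin> {x, y, z}" using dis[OF QS(1) TS(1) QS(2)] st xyz by auto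
      have dQK: "s \<notin> {k, l}" "t \<notin> {k, l}" using dis[OF QS(1) K Q(2)] st kl by auto
      have ne: "k \<noteq> l" "s \<noteq> t" using rest(2)[OF K] rest(2)[OF QS(1)] kl st by auto
      have inV': "k \<in> V" "l \<in> V" "s \<in> V" "t \<in> V" using U K QS(1) kl st by force+
      \<comment> \<open>Three segments become two. As \<open>y\<close> was no port, an
        \<open>r\<close>-edge joins it to \<open>l\<close>, which hides \<open>l\<close>; the
        leftover \<open>z\<close> is hung on \<open>Q\<close> as a dead tip. Nonlinks remain only at
        \<open>k\<close> and \<open>z\<close>, at most \<open>8 * p - 10\<close>, which just
        suffices for \<open>p\<close> segments.\<close>
      let ?A = "[k, l, y, x]" and ?B = "[z, s, t]"
      let ?R = "?S - {T, K, Q}"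
      let ?S' = "insert ?A (insert ?B ?R)"
      have "joined r l y" using red[of l y] yport kl inV inV' dKT by auto
      moreover have "segment {r} {z} [k, l]" using rest(1)[OF K] kl by simp
      moreover have "segment {r} {z} [y, x]" using xyz colours joined_sym by (intro segment_pair[of b]) auto
      ultimately have A: "segment {r} {z} ?A"
        using segment_append[of "{r}" "{z}" "[k, l]" "[y, x]"] dKT dT by (auto simp: link_def)
      have "joined r z s" using red[of z s] kl inV inV' dKT dQT dQK by auto
      then have B: "segment {r} {z} ?B"
        using segment_Cons[of "{r}" "{z}" "[s, t]" z r] rest(1)[OF QS(1), of "{z}"] st dQT by auto
      have disR: "set D \<inter> {x, y, z, k, l, s, t} = {}" if "D \<in> ?R" for D
        using dis[of D T] dis[of D K] dis[of D Q] that TS(1) K QS(1) xyz kl st by auto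
      have U': "V = {x, y, z, k, l, s, t} \<union> (\<Union>D\<in>?R. set D)"
      proof -
        have "?S = {T, K, Q} \<union> ?R" using TS(1) K QS(1) by auto
        then have "V = (\<Union>D\<in>{T, K, Q} \<union> ?R. set D)" using U by simp
        then show ?thesis using xyz kl st by auto
      qed
      have S': "segments {r} {z} ?S'"
        unfolding segments_def
      proof (intro conjI ballI impI)
        fix D assume "D \<in> ?S'"
        then show "segment {r} {z} D" "hd D \<noteq> last D" using A B rest[of D] dKT dQT by auto
      next
        fix D E assume "D \<in> ?S'" "E \<in> ?S'" "D \<noteq> E"
        then consider "D \<in> ?R" "E \<in> ?R" | "{D, E} = {?A, ?B}" | "D \<in> ?R" "E \<in> {?A, ?B}" | "E \<in> ?R" "D \<in> {?A, ?B}"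
          by blast
        then show "set D \<inter> set E = {}"
        proof cases
          case 1
          then show ?thesis using dis[of D E] \<open>D \<noteq> E\<close> by blast
        next
          case 2
          then have "set D \<inter> set E = set ?A \<inter> set ?B" by (auto simp: doubleton_eq_iff)
          then show ?thesis using dKT dQT dQK dT by auto
        next
          case 3
          then show ?thesis using disR[of D] by auto
        next
          case 4
          then show ?thesis using disR[of E] by auto
        qed
      next
        show "(\<Union>D\<in>?S'. set D) = V" using U' by auto
      qed auto
      have "?A \<notin> insert ?B ?R" "?B \<notin> ?R" using disR by fastforce+
      moreover have "card ?R = p - 2"
        using cS TS(1) K QS(1) False Q(2) QS(2) by (subst card_Diff_subset) (auto simp: card_insert_if)
      ultimately have cS': "card ?S' = p" using p4 by simp
      have pS': "ports ?S' = {k, x, z, t} \<union> ports ?R" by (auto simp: ports_insert)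
      have lport: "l \<notin> ports ?S'"
      proof
        assume "l \<in> ports ?S'"
        then have "l \<in> ports ?R" using pS' ne dKT dQK by auto
        then obtain D where D: "D \<in> ?R" "l = hd D \<or> l = last D" unfolding ports_def by blast
        moreover have "D \<noteq> []" using bg.cover_part[OF cov, of D] D(1) by (auto simp: bg.part_def)
        ultimately have "l \<in> set D" by auto
        then show False using disR[OF D(1)] by auto
      qed
      let ?P = "ports ?S' - {k, x}" and ?P' = "ports ?S' - {z, t, k}"
      have fP: "finite ?P" "finite ?P'" using finite_ports[OF S'] by simp_all
      have cP: "card ?P = 2 * p - 2" "card ?P' = 2 * p - 3"
        using segments_card_ports[OF S'] cS' dKT dQT dQK
        by (subst card_Diff_subset; force simp: pS' card_insert_if)+
      have "far (link {r} {z}) ?S' \<subseteq> (Pair k ` ?P \<union> (\<lambda>v. (v, k)) ` ?P) \<union> (Pair z ` ?P' \<union> (\<lambda>v. (v, z)) ` ?P')"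
      proof
        fix e assume e: "e \<in> far (link {r} {z}) ?S'"
        obtain s' t' where e': "e = (s', t')" by (cases e)
        have f: "s' \<in> ports ?S'" "t' \<in> ports ?S'" "\<not> (\<exists>A\<in>?S'. s' \<in> set A \<and> t' \<in> set A)" "\<not> link {r} {z} s' t'"
          using e e' by (auto simp: far_def)
        have v: "s' \<in> V" "t' \<in> V" "s' \<noteq> t'" using ports_in_segment[OF S'] f by blast+
        have n1: "\<not> (s' \<in> {k, x} \<and> t' \<in> {k, x})" and n2: "\<not> (s' \<in> {z, t} \<and> t' \<in> {z, t})" using f(3) by auto
        consider "s' = k \<or> t' = k" | "s' \<noteq> k" "t' \<noteq> k" "s' = z \<or> t' = z" | "s' \<notin> {k, z}" "t' \<notin> {k, z}" by blast
        then show "e \<in> (Pair k ` ?P \<union> (\<lambda>v. (v, k)) ` ?P) \<union> (Pair z ` ?P' \<union> (\<lambda>v. (v, z)) ` ?P')"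
        proof cases
          case 1
          then show ?thesis using e' f(1,2) n1 by auto
        next
          case 2
          then show ?thesis using e' f(1,2) n2 by auto
        next
          case 3
          have "s' \<noteq> l" "t' \<noteq> l" using f(1,2) lport by auto
          then have "joined r s' t'" using red[of s' t'] kl v 3 by simp
          then show ?thesis using f(4) 3 by (auto simp: link_def)
        qed
      qed
      then have "card (far (link {r} {z}) ?S') \<le>
          card ((Pair k ` ?P \<union> (\<lambda>v. (v, k)) ` ?P) \<union> (Pair z ` ?P' \<union> (\<lambda>v. (v, z)) ` ?P'))"
        using fP by (intro card_mono) auto
      also have "\<dots> \<le> (card ?P + card ?P) + (card ?P' + card ?P')"
        using fP by (intro order_trans[OF card_Un_le] add_mono card_image_le)
      finally have "card (far (link {r} {z}) ?S') + 10 \<le> 8 * card ?S'" using cS' cP p4 by linarith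
      then show ?thesis using link_segments[OF S'] by blast
    qed
  qed
qed

text \<open>If \<open>h\<close> is at least \<open>4n - 7\<close>, then \<open>mr_h\<close> leaves
  \<open>mr\<close> at most \<open>4n - 18\<close>, enough for \<open>p + 2\<close> segments.
  Otherwise \<open>h\<close> is at most \<open>4n - 8\<close>, which is the sharper bound for the
  \<open>n / 2\<close> edges of a matching in \<open>r\<close>, linked in \<open>b\<close> and
  \<open>g\<close>.\<close>

lemma two_triples:
  assumes C: "bg.minimal C" "bg.singles C = 0" and t2: "card (bg.triples C) = 2"
  shows "\<exists>vs es. proper_hamiltonian_path G vs es"
proof -
  have cov: "bg.cover C" using bg.minimal_cover[OF C(1)] .
  define p where "p = card (bg.pairs C)"
  have n: "card V = 2 * p + 6" using bg.pairs_triples(3)[OF cov C(2)] t2 by (simp add: p_def)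
  show ?thesis
  proof (cases "h + 7 \<ge> 4 * card V")
    case True
    then show ?thesis using link_red[OF C] mr_h n t2 by (simp add: p_def)
  next
    case False
    have "8 * p + 14 \<le> h" using bg.two_triples_bound[OF C t2] n card_verts by (simp add: p_def)
    obtain M where M: "rr.cover M" "rr.singles M = 0" "rr.triples M = {}" "2 * card (rr.pairs M) = card V"
      using red_perfect_matching n by auto
    let ?S = "set_mset M"
    note cs = cover_segments[OF rr.two_graphs_axioms M(1,2), of "{b, g}"]
    have S: "segments {b, g} {} ?S" using cs(1) colours V_ne M(3) by blast
    have cS: "2 * card ?S = card V" using cs(2) colours V_ne M(3,4) by simp
    have H: "(\<lambda>s t. \<exists>d\<in>{b, g}. joined d s t) = bg.H" by (intro ext) (auto simp: bg.H_def)
    have "far (link {b, g} {}) ?S \<subseteq> nonadjacent V (\<lambda>s t. \<exists>d\<in>{b, g}. joined d s t)"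
      by (rule cs(3)) (use colours V_ne M(3) in auto)
    then have farH: "far (link {b, g} {}) ?S \<subseteq> nonadjacent V bg.H" unfolding H .
    have finH: "finite (nonadjacent V bg.H)" using bg.finite_V by simp
    have h8: "h + 8 \<le> 8 * card ?S" using False cS by linarith
    show ?thesis
    proof (cases "\<forall>K\<in>?S. \<exists>s\<in>{hd K, last K}. \<exists>t\<in>ports ?S. t \<notin> {hd K, last K} \<and> link {b, g} {} s t")
      case True
      have "card (far (link {b, g} {}) ?S) + 8 \<le> 8 * card ?S"
        using h8 card_mono[OF finH farH] by linarith
      moreover have "card ?S \<ge> 5" using cS card_verts by linarith
      ultimately show ?thesis using link_segments_no_isolated[OF S] True by auto
    next
      case no: False
      then obtain K where K: "K \<in> ?S"
        and no: "\<not> (\<exists>s\<in>{hd K, last K}. \<exists>t\<in>ports ?S. t \<notin> {hd K, last K} \<and> link {b, g} {} s t)" by blast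
      note N = isolated_segment[OF S K no farH finH h8]
      have pm: "K' \<in> rr.pairs M" if "K' \<in> ?S" for K' using that rr.pairs_triples(1)[OF M(1,2)] M(3) by auto
      \<comment> \<open>Every missing pair of \<open>bg.H\<close> has exactly one end in
        \<open>K\<close>, hence no edge of the matching is missing there. So \<open>M\<close> would
        also cover in colours \<open>b\<close> and \<open>g\<close>, at cost 0.\<close>
      have "bg.part K'" if K': "K' \<in># M" for K'
      proof -
        obtain s t where st: "K' = [s, t]" using pm[OF K'] by (auto simp: rr.pairs_def length_Suc_conv numeral_2_eq_2)
        have "s \<noteq> t" "s \<in> V" "t \<in> V" using rr.cover_sets(3)[OF M(1) K'] rr.cover_subset[OF M(1) K'] st by auto
        moreover have "(s, t) \<notin> nonadjacent V bg.H"
        proof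
          assume a: "(s, t) \<in> nonadjacent V bg.H"
          then have ij: "(s \<in> {hd K, last K}) \<noteq> (t \<in> {hd K, last K})" unfolding N by blast
          then have "K' \<noteq> K" using st by (metis insertCI last.simps list.sel(1) list.distinct(1))
          then have "set K' \<inter> set K = {}" using rr.cover_sets(2)[OF M(1) K' K] by blast
          moreover have "K \<noteq> []" using pm[OF K] by (auto simp: rr.pairs_def)
          then have "hd K \<in> set K" "last K \<in> set K" by auto
          ultimately show False using st ij by auto
        qed
        ultimately show ?thesis using st by (simp add: nonadjacent_def)
      qed
      then have "bg.cover M" using M(1) by (simp add: bg.cover_def rr.cover_def)
      then have "bg.cost C \<le> bg.cost M" using C(1) by (simp add: bg.minimal_def)
      moreover have "bg.cost M = 0" unfolding bg.cost_def using pm by (auto simp: rr.pairs_def)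
      moreover have "bg.cost C \<noteq> 0"
      proof -
        have "bg.triples C \<noteq> {}" using t2 by auto
        then obtain K' where "K' \<in># C" "length K' = 3" by (auto simp: bg.triples_def)
        moreover from this obtain D where "C = add_mset K' D" using multi_member_split by metis
        ultimately show ?thesis by simp
      qed
      ultimately show ?thesis by simp
    qed
  qed
qed

theorem hamiltonian: "\<exists>vs es. proper_hamiltonian_path G vs es"
proof -
  obtain C where C: "bg.minimal C" using bg.ex_minimal by blast
  show ?thesis
  proof (cases "bg.singles C = 0")
    case False
    then show ?thesis using one_single[OF C] by blast
  next
    case s0: True
    define p t where "p = card (bg.pairs C)" and "t = card (bg.triples C)"
    have n: "card V = 2 * p + 3 * t" using bg.pairs_triples(3)[OF bg.minimal_cover[OF C] s0] by (simp add: p_def t_def)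
    consider "t = 0" | "t = 1" | "t = 2" | "t = 3" | "t \<ge> 4" by linarith
    then show ?thesis
    proof cases
      case 1
      then show ?thesis using link_red[OF C s0] mr_le n by (simp add: p_def t_def)
    next
      case 2
      then show ?thesis using one_triple[OF C s0] by (simp add: t_def)
    next
      case 3
      then show ?thesis using two_triples[OF C s0] by (simp add: t_def)
    next
      case 4
      \<comment> \<open>This says \<open>h \<ge> 12 * p + 30\<close>, while
        \<open>n = 2 * p + 9\<close>: in \<open>mr_h\<close> the terms with \<open>p\<close> cancel
        and 16 remains.\<close>
      have "4 * t * t + 4 * t * p \<le> h + 2 * t" using bg.triples_bound[OF C s0] 4 by (simp add: p_def t_def)
      then have "mr \<le> 16" using mr_h n 4 by simp
      moreover have "p \<ge> 1" using n card_verts 4 by linarith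
      ultimately show ?thesis using link_red[OF C s0] 4 by (simp add: p_def t_def)
    next
      case 5
      have "4 * t * t + 4 * t * p \<le> h + 2 * t" using bg.triples_bound[OF C s0] 5 by (simp add: p_def t_def)
      moreover have "16 * t \<le> 4 * t * t" "16 * p \<le> 4 * t * p" using 5 by simp_all
      ultimately have "16 * t + 16 * p \<le> h + 2 * t" by (rule order_trans[OF add_mono, rotated 2])
      then have "mr + 10 \<le> 8 * p + 8 * t" using mr_h n 5 by linarith
      then show ?thesis using link_red[OF C s0] by (simp add: p_def t_def)
    qed
  qed
qed

end

theorem theorem4p8:
  fixes G :: "('v, 'e) coloured_multigraph" and c n m :: nat
  assumes "edge_coloured_multigraph c G"
    and "card (verts G) = n" and "n \<ge> 11"
    and "c \<ge> 3"
    and "card (edges G) = m"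
    and "min_rd G = c"
    and "m \<ge> c * ((n - 2) choose 2) + 2 * c + 1"
  shows "\<exists>vs es. proper_hamiltonian_path G vs es"
proof -
  interpret edge_coloured_multigraph c G by fact
  \<comment> \<open>The summand 2 absorbs \<open>2 * c\<close>, so the hypothesis on
    \<open>m\<close> reads \<open>m \<ge> c * A + 1\<close>.\<close>
  define A where "A = ((n - 2) choose 2) + 2"
  define f where "f i = card {e \<in> edges G. colour G e = i}" for i
  have "edges G = (\<Union>i\<in>{1..c}. {e \<in> edges G. colour G e = i})" using colour_range by auto
  moreover have "card (\<Union>i\<in>{1..c}. {e \<in> edges G. colour G e = i}) = (\<Sum>i\<in>{1..c}. f i)"
    unfolding f_def using finite_edges by (intro card_UN_disjoint) auto
  ultimately have "(\<Sum>i\<in>{1..c}. f i) = m" using assms(5) by simp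
  then have sum: "card {1..c} * A + 1 \<le> (\<Sum>i\<in>{1..c}. f i)" using assms(7) by (simp add: A_def algebra_simps)
  have "3 \<le> card {1..c}" using assms(4) by simp
  from top_three[OF finite_atLeastAtMost this sum]
  obtain r b g where rbg: "r \<in> {1..c}" "b \<in> {1..c}" "g \<in> {1..c}" "r \<noteq> b" "r \<noteq> g" "b \<noteq> g"
    and f: "f b \<le> f r" "f g \<le> f r" "3 * A + 1 \<le> f r + f b + f g" .
  have ne: "card (nonadjacent (verts G) (joined i)) + 2 * f i + n = n * n" for i
    using card_nonadjacent_joined[of i] assms(2) by (simp add: f_def)
  define k where "k = n - 3"
  have k: "n = k + 3" using assms(3) by (simp add: k_def)
  have "2 * (Suc k choose 2) = Suc k * k" unfolding choose_two by simp
  then have "2 * A = Suc k * k + 4" using k by (simp add: A_def eval_nat_numeral)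
  then have "2 * A + 5 * n = n * n + 10" using k by (simp add: algebra_simps)
  \<comment> \<open>A colour class with \<open>A\<close> edges misses
    \<open>n * n - n - 2 * A = 4 * n - 10\<close> ordered pairs; three of them with one edge more
    miss \<open>12 * n - 32\<close>.\<close>
  then have total: "card (nonadjacent (verts G) (joined r)) + card (nonadjacent (verts G) (joined b))
      + card (nonadjacent (verts G) (joined g)) + 32 \<le> 12 * card (verts G)"
    using ne[of r] ne[of b] ne[of g] f(3) assms(2) by linarith
  have "three_colours c G r b g"
    using rbg every_colour[OF assms(6)] assms(2,3) total ne[of r] ne[of b] ne[of g] f
    by unfold_locales auto
  then show ?thesis by (rule three_colours.hamiltonian)
qed

end
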